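(* Let $H$ be a numerical semigroup with $\operatorname{embdim}(H)=4$ which is symmetric and not a complete intersection. The following are equivalent: (a) $H$ is Koszul; (b) $H$ is quadratic; (c) $e(H)=5$; (d) $H=\langle 5,4a+b,2a+3b,3a+2b\rangle$ for some positive integers $a,b$ such that $a-b$ is not divisible by $5$. Moreover, the integers $a$ and $b$ in (d) are uniquely determined by $H$.
   Context: A numerical semigroup is a submonoid $H\subseteq\mathbb{N}$ with finite complement; $G(H)$ is its minimal generating set, $e(H)=\min G(H)$, $\operatorname{embdim}(H)=|G(H)|$. The Frobenius number is $g(H)=\max(\mathbb{N}\setminus H)$; $H$ is symmetric if for every integer $m$ exactly one of $m$ and $g(H)-m$ lies in $H$. $K$ is a field, $K[H]=\bigoplus_{h\in H}Kt^h$ with maximal ideal $\mathfrak m$; with $G(H)=\{a_1,\dots,a_n\}$, $I_H=\ker(K[x_1,\dots,x_n]\to K[H],\ x_i\mapsto t^{a_i})$; $H$ is a complete intersection if $I_H$ is minimally generated by $\operatorname{height}I_H$ elements. $f^*$ is the lowest-degree homogeneous component of $f\neq 0$, $I_H^*=(f^*:0\neq f\in I_H)$, $\operatorname{gr}_{\mathfrak m}K[H]\cong K[x_1,\dots,x_n]/I_H^*$. $H$ is quadratic if $I_H^*$ is generated in degree 2 and Koszul if $\operatorname{gr}_{\mathfrak m}K[H]$ is a Koszul algebra (its residue field has a linear free resolution over it). *)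

theory Defs
  imports "HOL-Library.Poly_Mapping" "HOL-Library.Extended_Nat" "HOL-Computational_Algebra.Polynomial"
begin

inductive_set sg_gen :: "nat set \<Rightarrow> nat set" for S :: "nat set" where
  zero: "0 \<in> sg_gen S"
| gen: "x \<in> S \<Longrightarrow> x \<in> sg_gen S"
| add: "x \<in> sg_gen S \<Longrightarrow> y \<in> sg_gen S \<Longrightarrow> x + y \<in> sg_gen S"

definition numerical_semigroup :: "nat set \<Rightarrow> bool" where
  "numerical_semigroup H \<longleftrightarrow> 0 \<in> H \<and> (\<forall>x\<in>H. \<forall>y\<in>H. x + y \<in> H) \<and> finite (UNIV - H)"

definition min_gens :: "nat set \<Rightarrow> nat set" where
  "min_gens H = (THE S. S \<subseteq> H \<and> sg_gen S = H \<and> (\<forall>T. T \<subset> S \<longrightarrow> sg_gen T \<noteq> H))"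

definition embdim :: "nat set \<Rightarrow> nat" where
  "embdim H = card (min_gens H)"

definition sg_mult :: "nat set \<Rightarrow> nat" where
  "sg_mult H = Min (min_gens H)"

definition frobenius :: "nat set \<Rightarrow> int" where
  "frobenius H = (if UNIV - H = {} then -1 else Max (int ` (UNIV - H)))"

definition symmetric_sg :: "nat set \<Rightarrow> bool" where
  "symmetric_sg H \<longleftrightarrow> (\<forall>m::int. (m \<in> int ` H) \<noteq> (frobenius H - m \<in> int ` H))"

text \<open>The minimal generators listed increasingly: a_1 < ... < a_n,
  corresponding to the variables x_0, ..., x_(n-1).\<close>
definition gens_list :: "nat set \<Rightarrow> nat list" where
  "gens_list H = sorted_list_of_set (min_gens H)"

type_synonym 'k mpoly = "(nat \<Rightarrow>\<^sub>0 nat) \<Rightarrow>\<^sub>0 'k"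

definition polys :: "nat \<Rightarrow> ('k::field) mpoly set" where
  "polys n = {f. \<forall>m\<in>Poly_Mapping.keys f. \<forall>i\<in>Poly_Mapping.keys m. i < n}"

definition ideal_gen :: "nat \<Rightarrow> ('k::field) mpoly set \<Rightarrow> 'k mpoly set" where
  "ideal_gen n S = {f. \<exists>T r. finite T \<and> T \<subseteq> S \<and> (\<forall>s\<in>T. r s \<in> polys n)
                        \<and> f = (\<Sum>s\<in>T. r s * s)}"

definition is_ideal :: "nat \<Rightarrow> ('k::field) mpoly set \<Rightarrow> bool" where
  "is_ideal n I \<longleftrightarrow> I \<subseteq> polys n \<and> 0 \<in> I \<and> (\<forall>f\<in>I. \<forall>g\<in>I. f + g \<in> I)
      \<and> (\<forall>r\<in>polys n. \<forall>f\<in>I. r * f \<in> I)"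

definition prime_ideal :: "nat \<Rightarrow> ('k::field) mpoly set \<Rightarrow> bool" where
  "prime_ideal n P \<longleftrightarrow> is_ideal n P \<and> P \<noteq> polys n
      \<and> (\<forall>f\<in>polys n. \<forall>g\<in>polys n. f * g \<in> P \<longrightarrow> f \<in> P \<or> g \<in> P)"

definition height_prime :: "nat \<Rightarrow> ('k::field) mpoly set \<Rightarrow> enat" where
  "height_prime n P = Sup {enat k | k. \<exists>c :: nat \<Rightarrow> 'k mpoly set.
      (\<forall>i\<le>k. prime_ideal n (c i)) \<and> (\<forall>i<k. c i \<subset> c (Suc i)) \<and> c k = P}"

definition height :: "nat \<Rightarrow> ('k::field) mpoly set \<Rightarrow> enat" where
  "height n I = (INF P\<in>{P. prime_ideal n P \<and> I \<subseteq> P}. height_prime n P)"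

definition num_gens :: "nat \<Rightarrow> ('k::field) mpoly set \<Rightarrow> nat" where
  "num_gens n I = (LEAST k. \<exists>S. finite S \<and> card S = k \<and> S \<subseteq> polys n \<and> ideal_gen n S = I)"

text \<open>The K-algebra map x_i \<mapsto> t^(a_i) into K[t].\<close>
definition sg_eval :: "nat list \<Rightarrow> ('k::field) mpoly \<Rightarrow> 'k poly" where
  "sg_eval a f = (\<Sum>m\<in>Poly_Mapping.keys f.
      Polynomial.monom (Poly_Mapping.lookup f m)
        (\<Sum>i\<in>Poly_Mapping.keys m. Poly_Mapping.lookup m i * a ! i))"

definition toric_ideal :: "('k::field) itself \<Rightarrow> nat set \<Rightarrow> ('k::field) mpoly set" where
  "toric_ideal _ H = {f \<in> polys (embdim H). sg_eval (gens_list H) f = 0}"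

definition complete_intersection :: "('k::field) itself \<Rightarrow> nat set \<Rightarrow> bool" where
  "complete_intersection K H \<longleftrightarrow>
     enat (num_gens (embdim H) (toric_ideal K H)) = height (embdim H) (toric_ideal K H)"

definition tdeg :: "(nat \<Rightarrow>\<^sub>0 nat) \<Rightarrow> nat" where
  "tdeg m = (\<Sum>i\<in>Poly_Mapping.keys m. Poly_Mapping.lookup m i)"

definition homogeneous :: "nat \<Rightarrow> ('k::field) mpoly \<Rightarrow> bool" where
  "homogeneous d f \<longleftrightarrow> (\<forall>m\<in>Poly_Mapping.keys f. tdeg m = d)"

definition init_form :: "('k::field) mpoly \<Rightarrow> 'k mpoly" where
  "init_form f = (let d = Min (tdeg ` Poly_Mapping.keys f) in
      \<Sum>m\<in>{m\<in>Poly_Mapping.keys f. tdeg m = d}. Poly_Mapping.single m (Poly_Mapping.lookup f m))"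

text \<open>I_H^*, so that gr_m K[H] = K[x]/I_H^*.\<close>
definition initial_ideal :: "('k::field) itself \<Rightarrow> nat set \<Rightarrow> ('k::field) mpoly set" where
  "initial_ideal K H = ideal_gen (embdim H) {init_form f | f. f \<in> toric_ideal K H \<and> f \<noteq> 0}"

definition quadratic :: "('k::field) itself \<Rightarrow> nat set \<Rightarrow> bool" where
  "quadratic K H \<longleftrightarrow> (\<exists>S :: ('k::field) mpoly set.
      (\<forall>s\<in>S. s \<in> polys (embdim H) \<and> homogeneous 2 s) \<and> ideal_gen (embdim H) S = initial_ideal K H)"

text \<open>K has a linear free resolution over R = K[x]/J, J = I_H^*:
  ... -> R(-2)^(b 2) --M 2--> R(-1)^(b 1) --M 1--> R^(b 0) = R -> K -> 0,
  all matrix entries M i j k (row j, column k) linear forms, exact everywhere.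
  Computations in R are done on representatives modulo J.\<close>
definition koszul :: "('k::field) itself \<Rightarrow> nat set \<Rightarrow> bool" where
  "koszul K H \<longleftrightarrow> (let n = embdim H; J = initial_ideal K H in
     \<exists>(b :: nat \<Rightarrow> nat) (M :: nat \<Rightarrow> nat \<Rightarrow> nat \<Rightarrow> ('k::field) mpoly).
       b 0 = 1
     \<and> (\<forall>i j k. j < b i \<longrightarrow> k < b (Suc i) \<longrightarrow>
           M (Suc i) j k \<in> polys n \<and> homogeneous 1 (M (Suc i) j k))
     \<and> ideal_gen n ({M 1 0 k | k. k < b 1} \<union> J) = {f \<in> polys n. Poly_Mapping.lookup f 0 = 0}
     \<and> (\<forall>i\<ge>1. \<forall>v :: nat \<Rightarrow> 'k mpoly. (\<forall>k<b i. v k \<in> polys n) \<longrightarrow>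
          ((\<forall>j<b (i - 1). (\<Sum>k<b i. M i j k * v k) \<in> J) \<longleftrightarrow>
           (\<exists>w :: nat \<Rightarrow> 'k mpoly. (\<forall>l<b (Suc i). w l \<in> polys n) \<and>
              (\<forall>k<b i. v k - (\<Sum>l<b (Suc i). M (Suc i) k l * w l) \<in> J)))))"

end

theory Submission
  imports Defs
begin

text \<open>Write a_0 < a_1 < a_2 < a_3 for the minimal generators. The initial ideal J is cut out by
  the linear functionals that sum the coefficients of the longest factorizations of a fixed element
  of H.

  If J is generated by quadrics, then 2 a_i must have a second factorization of length at least two
  for every i > 0, since otherwise no power of x_i lies in J. This forces every element of the Apery
  set of a_0 to be a squarefree sum of a_1, a_2, a_3. If a_1 + a_2 + a_3 is in the Apery set, then
  rewriting the squares x_i^2 shows that the toric ideal is generated by three binomials, so that H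
  is a complete intersection (its height is 3 because a chain of n + 1 proper inclusions of primes
  in n variables would give n + 1 algebraically independent polynomials). Otherwise symmetry leaves
  only the Apery set {0, a_1, a_2, a_3, a_1 + a_3} with 2 a_2 = a_1 + a_3, hence a_0 = 5.

  For a_0 = 5 that Apery set gives both the parametrization by a and b (residues modulo 5) and the
  Koszul filtration (x_0), (x_0,x_1), (x_0,x_1,x_2), (x_0,x_1,x_2,x_3) modulo J, from which a linear
  resolution of the residue field is built one column at a time.\<close>



text \<open>The step from Koszul to quadratic is not in the overview. J has no terms of degree below
  two, so each of its elements is a linear combination of linear forms generating the maximal ideal,
  and the coefficients form a syzygy modulo J. If these syzygies are generated by vectors of linear
  forms, J is generated by the resulting products of two linear forms. Membership in J or in the
  toric ideal is tested by sums of coefficients over sets of monomials, so questions about ideals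
  turn into questions about factorizations and their lengths. The parameters in (d) come from
  doubling modulo 5: for e = 5 it sends one outer generator r to the other one p, and p to a_2.
  Writing 2 p = a_2 + 5 x and 2 r = p + 5 y and solving together with 2 a_2 = p + r gives p = 4 x +
  y, r = 2 x + 3 y and a_2 = 3 x + 2 y.\<close>

abbreviation "lookup \<equiv> Poly_Mapping.lookup"
abbreviation "keys \<equiv> Poly_Mapping.keys"
abbreviation "single \<equiv> Poly_Mapping.single"

subsection \<open>Monomials, weights and fibre sums\<close>

definition mons :: "nat \<Rightarrow> (nat \<Rightarrow>\<^sub>0 nat) set" where
  "mons n = {m. keys m \<subseteq> {..<n}}"

definition wt :: "(nat \<Rightarrow> nat) \<Rightarrow> (nat \<Rightarrow>\<^sub>0 nat) \<Rightarrow> nat" where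
  "wt a m = (\<Sum>i\<in>keys m. lookup m i * a i)"

text \<open>Coefficients, membership in the toric ideal and membership in the initial ideal are all
  conditions on such sums, so linearity and the behaviour under multiplication by a term are proved
  once, for an arbitrary predicate.\<close>

definition fsum :: "('m \<Rightarrow> bool) \<Rightarrow> ('m \<Rightarrow>\<^sub>0 'k::comm_monoid_add) \<Rightarrow> 'k" where
  "fsum P f = (\<Sum>m\<in>{m\<in>keys f. P m}. lookup f m)"

lemma single_decomposition: "f = (\<Sum>m\<in>keys f. single m (lookup f m))"
proof (rule poly_mapping_eqI)
  fix k
  have "lookup (\<Sum>m\<in>keys f. single m (lookup f m)) k = (\<Sum>m\<in>keys f. if m = k then lookup f m else 0)"
    by (simp add: lookup_sum lookup_single when_def)
  also have "\<dots> = lookup f k"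
    by (simp add: in_keys_iff)
  finally show "lookup f k = lookup (\<Sum>m\<in>keys f. single m (lookup f m)) k" by simp
qed

lemma mons_add_iff: "u + v \<in> mons n \<longleftrightarrow> u \<in> mons n \<and> v \<in> mons n"
proof -
  have "keys (u + v) = keys u \<union> keys v"
    by (auto simp: in_keys_iff lookup_add)
  then show ?thesis by (auto simp: mons_def)
qed

lemma mons_zero [simp]: "0 \<in> mons n"
  by (simp add: mons_def)

lemma mons_single [simp]: "i < n \<Longrightarrow> single i k \<in> mons n"
  by (cases "k = 0") (auto simp: mons_def)

lemma wt_superset: "finite A \<Longrightarrow> keys m \<subseteq> A \<Longrightarrow> wt a m = (\<Sum>i\<in>A. lookup m i * a i)"
  unfolding wt_def by (rule sum.mono_neutral_left) (auto simp: in_keys_iff)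

lemma wt_mons: "m \<in> mons n \<Longrightarrow> wt a m = (\<Sum>i<n. lookup m i * a i)"
  by (rule wt_superset) (auto simp: mons_def)

lemma wt_add [simp]: "wt a (u + v) = wt a u + wt a v"
proof -
  let ?A = "keys u \<union> keys v"
  have "keys (u + v) \<subseteq> ?A" by (rule keys_add)
  then have "wt a (u + v) = (\<Sum>i\<in>?A. lookup (u + v) i * a i)"
    by (intro wt_superset) auto
  also have "\<dots> = wt a u + wt a v"
    using wt_superset[of ?A u a] wt_superset[of ?A v a]
    by (simp add: lookup_add sum.distrib algebra_simps)
  finally show ?thesis .
qed

lemma wt_zero [simp]: "wt a 0 = 0"
  by (simp add: wt_def)

lemma wt_single [simp]: "wt a (single i k) = k * a i"
  by (simp add: wt_def)

lemma tdeg_eq_wt: "tdeg m = wt (\<lambda>_. 1) m"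
  by (simp add: tdeg_def wt_def)

lemma tdeg_add [simp]: "tdeg (u + v) = tdeg u + tdeg v"
  by (simp add: tdeg_eq_wt)

lemma tdeg_zero [simp]: "tdeg 0 = 0"
  by (simp add: tdeg_eq_wt)

lemma tdeg_single [simp]: "tdeg (single i k) = k"
  by (simp add: tdeg_eq_wt)

lemma tdeg_eq_0_iff: "tdeg m = 0 \<longleftrightarrow> m = 0"
proof
  assume "tdeg m = 0"
  then show "m = 0" by (intro poly_mapping_eqI) (auto simp: tdeg_def in_keys_iff)
qed simp

lemma monomial_split: "i \<in> keys m \<Longrightarrow> \<exists>m'. m = single i 1 + (m'::nat \<Rightarrow>\<^sub>0 nat)"
proof
  assume "i \<in> keys m"
  then have "lookup m i > 0" by (simp add: in_keys_iff)
  then show "m = single i 1 + (m - single i 1)"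
    by (intro poly_mapping_eqI) (auto simp: lookup_add lookup_minus lookup_single when_def)
qed

lemma tdeg_le_wt:
  assumes "m \<in> mons n" "\<And>i. i < n \<Longrightarrow> 0 < a i"
  shows "tdeg m \<le> wt a m"
proof -
  have "lookup m i \<le> lookup m i * a i" if "i < n" for i
    using assms(2)[OF that] by (cases "a i") auto
  then show ?thesis using assms(1)
    by (auto simp: tdeg_eq_wt wt_mons intro!: sum_mono)
qed

lemma fsum_superset:
  "finite A \<Longrightarrow> keys f \<subseteq> A \<Longrightarrow> fsum P f = (\<Sum>m\<in>A. if P m then lookup f m else 0)"
  unfolding fsum_def
  by (subst sum.inter_filter[symmetric]) (auto intro!: sum.mono_neutral_left simp: in_keys_iff)

lemma fsum_zero [simp]: "fsum P 0 = 0"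
  by (simp add: fsum_def)

lemma fsum_single [simp]: "fsum P (single m c) = (if P m then c else 0)"
  by (subst fsum_superset[of "{m}"]) auto

lemma fsum_add: "fsum P (f + g) = fsum P f + fsum P g"
proof -
  let ?A = "keys f \<union> keys g"
  have "keys (f + g) \<subseteq> ?A" by (rule keys_add)
  then show ?thesis
    using fsum_superset[of ?A f P] fsum_superset[of ?A g P] fsum_superset[of ?A "f + g" P]
    by (simp add: lookup_add if_distrib sum.distrib[symmetric] cong: if_cong)
qed

lemma fsum_uminus: "fsum P (- f) = - fsum P (f :: 'm \<Rightarrow>\<^sub>0 'k::ab_group_add)"
  using fsum_add[of P f "- f"] by (simp add: eq_neg_iff_add_eq_0 add.commute)

lemma fsum_diff: "fsum P (f - g) = fsum P f - fsum P (g :: 'm \<Rightarrow>\<^sub>0 'k::ab_group_add)"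
  using fsum_add[of P f "- g"] by (simp add: fsum_uminus)

lemma fsum_sum: "fsum P (\<Sum>i\<in>A. f i) = (\<Sum>i\<in>A. fsum P (f i))"
  by (induction A rule: infinite_finite_induct) (auto simp: fsum_add)

lemma fsum_cong: "(\<And>m. m \<in> keys f \<Longrightarrow> P m \<longleftrightarrow> Q m) \<Longrightarrow> fsum P f = fsum Q f"
  unfolding fsum_def by (intro sum.cong) auto

lemma fsum_eq_lookup: "fsum (\<lambda>m. m = u) f = lookup f u"
  by (cases "u \<in> keys f") (auto simp: fsum_superset[of "keys f"] in_keys_iff)

text \<open>A term translates exponents, so the functional for \<open>P\<close> pulls back to the
  one for the translated predicate. Closure of a kernel under multiplication becomes a question
  about predicates on monomials.\<close>

lemma fsum_monomial_mult:
  fixes f :: "'m::monoid_add \<Rightarrow>\<^sub>0 'k::semiring_0"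
  shows "fsum P (single u c * f) = c * fsum (\<lambda>m. P (u + m)) f"
proof -
  have "single u c * f = (\<Sum>m\<in>keys f. single (u + m) (c * lookup f m))"
    by (subst (1) single_decomposition[of f]) (simp add: sum_distrib_left mult_single)
  then have "fsum P (single u c * f) = (\<Sum>m\<in>keys f. if P (u + m) then c * lookup f m else 0)"
    by (simp add: fsum_sum)
  also have "\<dots> = c * fsum (\<lambda>m. P (u + m)) f"
    by (simp add: fsum_superset[of "keys f"] sum_distrib_left if_distrib cong: if_cong)
  finally show ?thesis .
qed

text \<open>After the replacement, the terms of one fibre share a single monomial whose coefficient
  is a vanishing fibre sum. This lets a polynomial with vanishing fibre sums be written through
  binomials of the form monomial minus representative.\<close>

lemma fibre_representatives_cancel:
  fixes f :: "'m \<Rightarrow>\<^sub>0 'k::comm_monoid_add"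
  assumes "\<And>h. fsum (\<lambda>m. v m = h \<and> P m) f = 0"
  shows "(\<Sum>m\<in>{m\<in>keys f. P m}. single (rep (v m)) (lookup f m)) = 0"
proof -
  let ?A = "{m\<in>keys f. P m}"
  have "(\<Sum>m\<in>?A. single (rep (v m)) (lookup f m))
      = (\<Sum>h\<in>v ` ?A. \<Sum>m\<in>{m\<in>?A. v m = h}. single (rep (v m)) (lookup f m))"
    by (rule sum.image_gen) simp
  also have "\<dots> = (\<Sum>h\<in>v ` ?A. 0)"
  proof (rule sum.cong[OF refl])
    fix h
    have "(\<Sum>m\<in>{m\<in>?A. v m = h}. single (rep (v m)) (lookup f m))
        = (\<Sum>m\<in>{m\<in>keys f. v m = h \<and> P m}. single (rep h) (lookup f m))"
      by (rule sum.cong) auto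
    also have "\<dots> = single (rep h) (fsum (\<lambda>m. v m = h \<and> P m) f)"
      by (intro poly_mapping_eqI) (simp add: lookup_sum lookup_single when_def fsum_def)
    finally show "(\<Sum>m\<in>{m\<in>?A. v m = h}. single (rep (v m)) (lookup f m)) = 0"
      using assms[of h] by simp
  qed
  finally show ?thesis by simp
qed

lemma lookup_monomial_mult_add [simp]:
  fixes f :: "(nat \<Rightarrow>\<^sub>0 nat) \<Rightarrow>\<^sub>0 'k::field"
  shows "lookup (single u c * f) (u + m) = c * lookup f m"
  using fsum_monomial_mult[of "\<lambda>x. x = u + m" u c f] by (simp add: fsum_eq_lookup)

lemma lookup_monomial_mult_eq_0:
  fixes f :: "(nat \<Rightarrow>\<^sub>0 nat) \<Rightarrow>\<^sub>0 'k::field"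
  assumes "\<And>v. m = u + v \<Longrightarrow> lookup f v = 0"
  shows "lookup (single u c * f) m = 0"
proof -
  have "fsum (\<lambda>v. u + v = m) f = 0"
    unfolding fsum_def using assms by (intro sum.neutral) auto
  then show ?thesis
    using fsum_monomial_mult[of "\<lambda>x. x = m" u c f] by (simp add: fsum_eq_lookup)
qed

lemma mult_decomposition: "r * f = (\<Sum>u\<in>keys r. single u (lookup r u) * f)"
  by (subst (1) single_decomposition[of r]) (simp add: sum_distrib_right)

text \<open>The hypothesis kills the contribution of every nonconstant term of \<open>r\<close>. It
  applies when \<open>m\<close> has the lowest degree possible in \<open>s\<close>.\<close>

lemma lookup_mult_unit_part:
  fixes r s :: "'k::field mpoly"
  assumes "\<And>u v. u \<noteq> 0 \<Longrightarrow> u + v = m \<Longrightarrow> lookup s v = 0"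
  shows "lookup (r * s) m = lookup r 0 * lookup s m"
proof -
  have "lookup (r * s) m = (\<Sum>u\<in>keys r. lookup (single u (lookup r u) * s) m)"
    by (subst mult_decomposition) (simp add: lookup_sum)
  also have "\<dots> = (\<Sum>u\<in>keys r. if u = 0 then lookup r 0 * lookup s m else 0)"
    using lookup_monomial_mult_add[of 0 _ s m]
    by (intro sum.cong refl) (auto intro!: lookup_monomial_mult_eq_0 assms)
  also have "\<dots> = lookup r 0 * lookup s m"
    by (simp add: in_keys_iff)
  finally show ?thesis .
qed

lemma lookup_mult_zero:
  fixes r s :: "'k::field mpoly"
  shows "lookup (r * s) 0 = lookup r 0 * lookup s 0"
  by (rule lookup_mult_unit_part) (metis add_eq_0_iff_both_eq_0 tdeg_add tdeg_eq_0_iff tdeg_zero)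

subsection \<open>Ideals of the polynomial ring\<close>

lemma polys_iff: "f \<in> polys n \<longleftrightarrow> keys f \<subseteq> mons n"
  by (auto simp: polys_def mons_def)

lemma polys_zero [simp]: "0 \<in> polys n"
  by (simp add: polys_iff)

lemma polys_single [simp]: "m \<in> mons n \<Longrightarrow> single m c \<in> polys n"
  by (simp add: polys_iff)

lemma polys_one [simp]: "1 \<in> polys n"
  using polys_single[of 0 n 1] by (simp add: single_one)

lemma polys_add [intro]: "f \<in> polys n \<Longrightarrow> g \<in> polys n \<Longrightarrow> f + g \<in> polys n"
  using keys_add[of f g] by (auto simp: polys_iff)

lemma polys_uminus [intro]: "f \<in> polys n \<Longrightarrow> - f \<in> polys n"
  by (simp add: polys_iff)

lemma polys_diff [intro]: "f \<in> polys n \<Longrightarrow> g \<in> polys n \<Longrightarrow> f - g \<in> polys n"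
  using polys_add[of f n "- g"] by auto

lemma polys_mult [intro]: "f \<in> polys n \<Longrightarrow> g \<in> polys n \<Longrightarrow> f * g \<in> polys n"
  using keys_mult[of f g] by (fastforce simp: polys_iff mons_add_iff)

lemma polys_sum [intro]: "(\<And>i. i \<in> A \<Longrightarrow> f i \<in> polys n) \<Longrightarrow> (\<Sum>i\<in>A. f i) \<in> polys n"
  by (induction A rule: infinite_finite_induct) auto

lemma polys_power [intro]: "f \<in> polys n \<Longrightarrow> f ^ k \<in> polys n"
  by (induction k) auto

lemma is_ideal_polys: "is_ideal n (polys n)"
  by (auto simp: is_ideal_def)

context
  fixes n :: nat and I :: "'k::field mpoly set"
  assumes I: "is_ideal n I"
begin

lemma ideal_in_polys: "f \<in> I \<Longrightarrow> f \<in> polys n"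
  and ideal_zero: "0 \<in> I"
  and ideal_add: "f \<in> I \<Longrightarrow> g \<in> I \<Longrightarrow> f + g \<in> I"
  and ideal_mult: "r \<in> polys n \<Longrightarrow> f \<in> I \<Longrightarrow> r * f \<in> I"
  using I by (auto simp: is_ideal_def)

lemma ideal_uminus: "f \<in> I \<Longrightarrow> - f \<in> I"
  using ideal_mult[of "- 1" f] by (simp add: polys_uminus)

lemma ideal_diff: "f \<in> I \<Longrightarrow> g \<in> I \<Longrightarrow> f - g \<in> I"
  using ideal_add[of f "- g"] ideal_uminus by auto

lemma ideal_sum: "(\<And>i. i \<in> A \<Longrightarrow> f i \<in> I) \<Longrightarrow> (\<Sum>i\<in>A. f i) \<in> I"
  by (induction A rule: infinite_finite_induct) (auto intro: ideal_zero ideal_add)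

lemma ideal_mult_right: "r \<in> polys n \<Longrightarrow> f \<in> I \<Longrightarrow> f * r \<in> I"
  using ideal_mult[of r f] by (simp add: mult.commute)

lemma ideal_add_cancel: "f - g \<in> I \<Longrightarrow> f \<in> I \<longleftrightarrow> g \<in> I"
  using ideal_add[of "f - g" g] ideal_diff[of f "f - g"] by auto

lemma ideal_gen_least: "S \<subseteq> I \<Longrightarrow> ideal_gen n S \<subseteq> I"
  by (auto simp: ideal_gen_def intro!: ideal_sum ideal_mult)

end

lemma ideal_gen_base: "s \<in> S \<Longrightarrow> s \<in> ideal_gen n S"
  unfolding ideal_gen_def
  by (auto intro!: exI[of _ "{s}"] exI[of _ "\<lambda>_. 1"])

lemma is_ideal_ideal_gen:
  assumes "S \<subseteq> polys n"
  shows "is_ideal n (ideal_gen n S)"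
  unfolding is_ideal_def
proof (intro conjI ballI)
  show "ideal_gen n S \<subseteq> polys n"
    by (rule ideal_gen_least[OF is_ideal_polys assms])
  show "0 \<in> ideal_gen n S"
    unfolding ideal_gen_def by (auto intro!: exI[of _ "{}"])
next
  fix f g :: "'a mpoly"
  assume "f \<in> ideal_gen n S" "g \<in> ideal_gen n S"
  then obtain T r U q where T: "finite T" "T \<subseteq> S" "\<forall>s\<in>T. r s \<in> polys n" "f = (\<Sum>s\<in>T. r s * s)"
    and U: "finite U" "U \<subseteq> S" "\<forall>s\<in>U. q s \<in> polys n" "g = (\<Sum>s\<in>U. q s * s)"
    unfolding ideal_gen_def by blast
  define p where "p s = (if s \<in> T then r s else 0) + (if s \<in> U then q s else 0)" for s
  have "f = (\<Sum>s\<in>T \<union> U. (if s \<in> T then r s else 0) * s)"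
    unfolding T(4) by (rule sum.mono_neutral_cong_left) (use T U in auto)
  moreover have "g = (\<Sum>s\<in>T \<union> U. (if s \<in> U then q s else 0) * s)"
    unfolding U(4) by (rule sum.mono_neutral_cong_left) (use T U in auto)
  ultimately have "f + g = (\<Sum>s\<in>T \<union> U. p s * s)"
    by (simp add: p_def algebra_simps sum.distrib)
  moreover have "\<forall>s\<in>T \<union> U. p s \<in> polys n"
    using T(3) U(3) by (auto simp: p_def)
  ultimately show "f + g \<in> ideal_gen n S"
    using T(1,2) U(1,2) unfolding ideal_gen_def
    by (auto intro!: exI[of _ "T \<union> U"] exI[of _ p])
next
  fix p f :: "'a mpoly"
  assume "p \<in> polys n" "f \<in> ideal_gen n S"
  then obtain T r where T: "finite T" "T \<subseteq> S" "\<forall>s\<in>T. r s \<in> polys n" "f = (\<Sum>s\<in>T. r s * s)"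
    unfolding ideal_gen_def by blast
  have "p * f = (\<Sum>s\<in>T. (p * r s) * s)"
    by (simp add: T(4) sum_distrib_left mult.assoc)
  with T \<open>p \<in> polys n\<close> show "p * f \<in> ideal_gen n S"
    unfolding ideal_gen_def by (auto intro!: exI[of _ T] exI[of _ "\<lambda>s. p * r s"])
qed

lemma is_idealI:
  fixes I :: "'k::field mpoly set"
  assumes "I \<subseteq> polys n" "0 \<in> I" "\<And>f g. f \<in> I \<Longrightarrow> g \<in> I \<Longrightarrow> f + g \<in> I"
    and mon: "\<And>u c f. u \<in> mons n \<Longrightarrow> f \<in> I \<Longrightarrow> single u c * f \<in> I"
  shows "is_ideal n I"
proof -
  have sums: "(\<Sum>i\<in>A. g i) \<in> I" if "\<And>i. i \<in> A \<Longrightarrow> g i \<in> I"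
    for A and g :: "(nat \<Rightarrow>\<^sub>0 nat) \<Rightarrow> 'k mpoly"
    using that by (induction A rule: infinite_finite_induct) (auto intro: assms)
  have "r * f \<in> I" if "r \<in> polys n" "f \<in> I" for r f
    using that by (subst mult_decomposition) (auto intro!: sums mon simp: polys_iff)
  with assms show ?thesis by (auto simp: is_ideal_def)
qed

lemma in_ideal_if_monomials:
  assumes "is_ideal n I" "f \<in> polys n"
    and "\<And>m. m \<in> keys f \<Longrightarrow> m \<in> mons n \<Longrightarrow> single m 1 \<in> I"
  shows "(f :: 'k::field mpoly) \<in> I"
proof -
  have "single m (lookup f m) \<in> I" if "m \<in> keys f" for m
    using ideal_mult[OF assms(1) polys_single[OF mons_zero, of "lookup f m"] assms(3)[OF that]]
      that assms(2) by (auto simp: mult_single polys_iff)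
  then show ?thesis
    by (subst single_decomposition[of f]) (auto intro: ideal_sum[OF assms(1)])
qed


subsection \<open>Kernels of monomial maps and the ideal of initial forms\<close>

text \<open>For additive \<open>v\<close>, the kernel of the K-algebra map that sends x^m to the
  basis element with index \<open>v m\<close> of a monoid algebra. With \<open>v = wt a\<close> it
  is the toric ideal; finer choices of \<open>v\<close> give the smaller primes in the chain for the
  height.\<close>

definition fibre_kernel :: "nat \<Rightarrow> ((nat \<Rightarrow>\<^sub>0 nat) \<Rightarrow> 'm) \<Rightarrow> 'k::field mpoly set" where
  "fibre_kernel n v = {f \<in> polys n. \<forall>h. fsum (\<lambda>m. v m = h) f = 0}"

text \<open>By cancellation in the target of \<open>v\<close>, a fibre pulled back along translation
  by \<open>u\<close> is again a single fibre, or it is empty.\<close>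

lemma is_ideal_fibre_kernel:
  fixes v :: "(nat \<Rightarrow>\<^sub>0 nat) \<Rightarrow> 'm::cancel_comm_monoid_add"
  assumes v: "\<And>x y. v (x + y) = v x + v y"
  shows "is_ideal n (fibre_kernel n v :: 'k::field mpoly set)"
proof (rule is_idealI)
  fix u c and f :: "'k mpoly"
  assume u: "u \<in> mons n" and f: "f \<in> fibre_kernel n v"
  have "fsum (\<lambda>m. v m = h) (single u c * f) = 0" for h
  proof (cases "\<exists>m0. v (u + m0) = h")
    case True
    then obtain m0 where "v u + v m0 = h" by (auto simp: v)
    then have "(\<lambda>m. v (u + m) = h) = (\<lambda>m. v m = v m0)"
      by (auto simp: v)
    then show ?thesis using f by (auto simp: fsum_monomial_mult fibre_kernel_def)
  next
    case False
    then have "fsum (\<lambda>m. v (u + m) = h) f = 0" by (simp add: fsum_def)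
    then show ?thesis by (simp add: fsum_monomial_mult)
  qed
  then show "single u c * f \<in> fibre_kernel n v"
    using u f by (auto simp: fibre_kernel_def)
qed (auto simp: fibre_kernel_def fsum_add)

lemma single_eq_0_iff [simp]: "single i k = 0 \<longleftrightarrow> k = 0"
  by (metis lookup_single_eq lookup_zero single_zero)

lemma monomial_eq_iff [simp]: "single u (1::'k::zero_neq_one) = single w 1 \<longleftrightarrow> u = w"
proof
  assume "single u (1::'k) = single w 1"
  then have "keys (single u (1::'k)) = keys (single w (1::'k))" by simp
  then show "u = w" by simp
qed simp

lemma binomial_in_fibre_kernel:
  assumes "u \<in> mons n" "w \<in> mons n" "v u = v w"
  shows "single u 1 - single w 1 \<in> fibre_kernel n v"
  using assms by (auto simp: fibre_kernel_def fsum_diff)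

text \<open>In the associated graded ring the class of a monomial survives exactly if it is a
  longest factorization of its weight.\<close>
definition longest :: "nat \<Rightarrow> (nat \<Rightarrow> nat) \<Rightarrow> (nat \<Rightarrow>\<^sub>0 nat) \<Rightarrow> bool" where
  "longest n a m \<longleftrightarrow> (\<forall>m'\<in>mons n. wt a m' = wt a m \<longrightarrow> tdeg m' \<le> tdeg m)"

text \<open>The kernel of the map from K[x] onto the associated graded ring. That ring has a basis
  indexed by the semigroup, and a monomial goes to the basis element of its weight if it is a
  longest factorization and to 0 otherwise.\<close>

definition graded_kernel :: "nat \<Rightarrow> (nat \<Rightarrow> nat) \<Rightarrow> 'k::field mpoly set" where
  "graded_kernel n a = {f \<in> polys n. \<forall>h. fsum (\<lambda>m. wt a m = h \<and> longest n a m) f = 0}"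

text \<open>A longer factorization of the weight of \<open>m\<close> could be multiplied by
  \<open>u\<close>.\<close>

lemma longest_addD: "u \<in> mons n \<Longrightarrow> longest n a (u + m) \<Longrightarrow> longest n a m"
  unfolding longest_def by (metis mons_add_iff tdeg_add wt_add nat_add_left_cancel_le)

lemma longest_same_tdeg:
  "longest n a m \<Longrightarrow> longest n a m' \<Longrightarrow> m \<in> mons n \<Longrightarrow> m' \<in> mons n \<Longrightarrow> wt a m = wt a m' \<Longrightarrow>
    tdeg m = tdeg m'"
  unfolding longest_def by (metis order_antisym)

lemma longest_transfer:
  "longest n a m \<Longrightarrow> wt a m = wt a m' \<Longrightarrow> tdeg m = tdeg m' \<Longrightarrow> longest n a m'"
  unfolding longest_def by simp

text \<open>Longest factorizations of equal weight have equal length, so translation by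
  \<open>u\<close> keeps either all or none of them longest. The functional at \<open>h\<close>
  therefore pulls back to the functional at a single weight or to an empty sum.\<close>

lemma is_ideal_graded_kernel: "is_ideal n (graded_kernel n a :: 'k::field mpoly set)"
proof (rule is_idealI)
  fix u c and f :: "'k mpoly"
  assume u: "u \<in> mons n" and f: "f \<in> graded_kernel n a"
  have "fsum (\<lambda>m. wt a m = h \<and> longest n a m) (single u c * f) = 0" for h
  proof (cases "\<exists>m0\<in>mons n. wt a (u + m0) = h \<and> longest n a (u + m0)")
    case True
    then obtain m0 where m0: "m0 \<in> mons n" "wt a (u + m0) = h" "longest n a (u + m0)" by blast
    have "fsum (\<lambda>m. wt a (u + m) = h \<and> longest n a (u + m)) f
        = fsum (\<lambda>m. wt a m = wt a m0 \<and> longest n a m) f"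
    proof (rule fsum_cong)
      fix m assume "m \<in> keys f"
      then have m: "m \<in> mons n" using f by (auto simp: graded_kernel_def polys_iff)
      show "wt a (u + m) = h \<and> longest n a (u + m) \<longleftrightarrow> wt a m = wt a m0 \<and> longest n a m"
        using m0 m u longest_addD[OF u m0(3)] longest_addD[OF u, of a m]
          longest_same_tdeg[of n a m m0] longest_transfer[OF m0(3), of "u + m"] by auto
    qed
    then show ?thesis using f by (auto simp: fsum_monomial_mult graded_kernel_def)
  next
    case False
    have "{m \<in> keys f. wt a (u + m) = h \<and> longest n a (u + m)} = {}"
      using False f by (fastforce simp: graded_kernel_def polys_iff)
    then have "fsum (\<lambda>m. wt a (u + m) = h \<and> longest n a (u + m)) f = 0"
      unfolding fsum_def by (simp only: sum.empty)
    then show ?thesis by (simp add: fsum_monomial_mult)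
  qed
  then show "single u c * f \<in> graded_kernel n a"
    using u f by (auto simp: graded_kernel_def)
qed (auto simp: graded_kernel_def fsum_add)

lemma lookup_init_form:
  "lookup (init_form f) m = (if tdeg m = Min (tdeg ` keys f) then lookup f m else 0)"
  unfolding init_form_def Let_def lookup_sum lookup_single when_def
  by (auto simp: in_keys_iff sum.delta' intro!: sum.neutral)

text \<open>A term of the initial form that is a longest factorization of \<open>h\<close> has the
  least degree in \<open>f\<close> and the greatest degree possible in weight \<open>h\<close>. All
  terms of \<open>f\<close> of weight \<open>h\<close> then share this degree, so the functional
  sees a full fibre sum of \<open>f\<close>; without such a term it sees nothing.\<close>

lemma init_form_in_graded_kernel:
  assumes f: "f \<in> fibre_kernel n (wt a)" and "f \<noteq> (0 :: 'k::field mpoly)"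
  shows "init_form f \<in> graded_kernel n a"
proof -
  let ?d = "Min (tdeg ` keys f)"
  have keys_init: "keys (init_form f) = {m \<in> keys f. tdeg m = ?d}"
    by (auto simp: in_keys_iff lookup_init_form split: if_splits)
  have keysf: "keys f \<subseteq> mons n" using f by (auto simp: fibre_kernel_def polys_iff)
  have "fsum (\<lambda>m. wt a m = h \<and> longest n a m) (init_form f) = 0" for h
  proof (cases "\<exists>m0\<in>keys f. tdeg m0 = ?d \<and> wt a m0 = h \<and> longest n a m0")
    case True
    then obtain m0 where m0: "m0 \<in> keys f" "tdeg m0 = ?d" "wt a m0 = h" "longest n a m0" by blast
    have "tdeg m = ?d \<and> longest n a m" if "m \<in> keys f" "wt a m = h" for m
    proof -
      have "?d \<le> tdeg m" using that by simp
      moreover have "tdeg m \<le> ?d"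
        using m0 that keysf by (auto simp: longest_def)
      ultimately have "tdeg m = ?d" by (rule order_antisym[rotated])
      moreover have "longest n a m"
        by (rule longest_transfer[OF m0(4)]) (use m0 that calculation in simp_all)
      ultimately show ?thesis ..
    qed
    then have "{m \<in> keys (init_form f). wt a m = h \<and> longest n a m} = {m \<in> keys f. wt a m = h}"
      by (auto simp: keys_init)
    moreover have "(\<Sum>m\<in>{m \<in> keys (init_form f). wt a m = h \<and> longest n a m}. lookup (init_form f) m)
        = (\<Sum>m\<in>{m \<in> keys (init_form f). wt a m = h \<and> longest n a m}. lookup f m)"
      by (rule sum.cong) (auto simp: lookup_init_form keys_init)
    moreover have "(\<Sum>m\<in>{m \<in> keys f. wt a m = h}. lookup f m) = 0"
      using f by (auto simp: fibre_kernel_def fsum_def)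
    ultimately show ?thesis by (simp add: fsum_def)
  next
    case False
    then have "{m \<in> keys (init_form f). wt a m = h \<and> longest n a m} = {}"
      by (auto simp: keys_init)
    then show ?thesis unfolding fsum_def by (simp only: sum.empty)
  qed
  then show ?thesis using keysf by (auto simp: graded_kernel_def polys_iff keys_init)
qed

lemma ex_longest:
  assumes pos: "\<And>i. i < n \<Longrightarrow> 0 < a i" and m: "m \<in> mons n"
  shows "\<exists>m'\<in>mons n. wt a m' = wt a m \<and> longest n a m' \<and> tdeg m \<le> tdeg m'"
proof -
  let ?P = "\<lambda>m'. m' \<in> mons n \<and> wt a m' = wt a m"
  have "\<exists>m'. ?P m' \<and> (\<forall>y. ?P y \<longrightarrow> tdeg y \<le> tdeg m')"
  proof (rule ex_has_greatest_nat[of ?P m tdeg "Suc (wt a m)"])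
    show "\<forall>y. ?P y \<longrightarrow> tdeg y < Suc (wt a m)"
      using tdeg_le_wt[of _ n a] pos by (metis le_imp_less_Suc)
  qed (use m in auto)
  then show ?thesis using m by (auto simp: longest_def)
qed

lemma init_form_binomial:
  assumes "u \<noteq> w" "tdeg u < tdeg w"
  shows "init_form (single u 1 - single w (1 :: 'k::field)) = single u 1"
proof -
  have "keys (single u 1 - single w (1 :: 'k)) = {u, w}"
    using assms(1) by (auto simp: in_keys_iff lookup_minus lookup_single when_def split: if_splits)
  moreover have "Min {tdeg u, tdeg w} = tdeg u" using assms by simp
  ultimately show ?thesis using assms
    by (intro poly_mapping_eqI) (auto simp: lookup_init_form lookup_minus lookup_single when_def)
qed

lemma init_form_homogeneous_binomial:
  assumes "u \<noteq> w" "tdeg u = tdeg w"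
  shows "init_form (single u 1 - single w (1 :: 'k::field)) = single u 1 - single w 1"
proof -
  have "keys (single u 1 - single w (1 :: 'k)) = {u, w}"
    using assms(1) by (auto simp: in_keys_iff lookup_minus lookup_single when_def split: if_splits)
  then show ?thesis using assms
    by (intro poly_mapping_eqI) (auto simp: lookup_init_form lookup_minus lookup_single when_def)
qed

text \<open>A monomial that is not longest is the initial form of its difference with a longer
  factorization. Two longest factorizations of one weight differ by a homogeneous binomial, which is
  its own initial form. These two kinds of elements span the common kernel of the
  functionals.\<close>

theorem init_ideal_eq_graded_kernel:
  assumes pos: "\<And>i. i < n \<Longrightarrow> 0 < a i"
  shows "ideal_gen n {init_form f | f. f \<in> fibre_kernel n (wt a) \<and> f \<noteq> 0}
       = (graded_kernel n a :: 'k::field mpoly set)" (is "ideal_gen n ?S = ?J")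
proof
  have S: "?S \<subseteq> ?J" using init_form_in_graded_kernel by blast
  then show "ideal_gen n ?S \<subseteq> ?J"
    by (rule ideal_gen_least[OF is_ideal_graded_kernel])
  have idl: "is_ideal n (ideal_gen n ?S)"
    using S ideal_in_polys[OF is_ideal_graded_kernel[of n a]] by (intro is_ideal_ideal_gen) blast
  define rep where "rep h = (SOME m. m \<in> mons n \<and> wt a m = h \<and> longest n a m)" for h
  have rep: "rep (wt a m) \<in> mons n \<and> wt a (rep (wt a m)) = wt a m \<and> longest n a (rep (wt a m))"
    if "m \<in> mons n" for m
    unfolding rep_def by (rule someI_ex) (use ex_longest[of n a m, OF _ that] pos in blast)
  have short: "single m 1 \<in> ideal_gen n ?S" if m: "m \<in> mons n" "\<not> longest n a m" for m
  proof -
    obtain w where w: "w \<in> mons n" "wt a w = wt a m" "tdeg m < tdeg w"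
      using m by (auto simp: longest_def not_le)
    then have "single m 1 - single w (1::'k) \<in> fibre_kernel n (wt a)"
      using that by (intro binomial_in_fibre_kernel) auto
    moreover have "single m 1 - single w (1::'k) \<noteq> 0" using w by auto
    moreover have "init_form (single m 1 - single w (1::'k)) = single m 1"
      using w by (intro init_form_binomial) auto
    ultimately have "single m 1 \<in> ?S" by (metis (mono_tags, lifting) mem_Collect_eq)
    then show ?thesis by (rule ideal_gen_base)
  qed
  have long: "single m 1 - single (rep (wt a m)) (1::'k) \<in> ideal_gen n ?S"
    if "m \<in> mons n" "longest n a m" for m
  proof (cases "m = rep (wt a m)")
    case True
    then show ?thesis using ideal_zero[OF idl] by auto
  next
    case False
    let ?b = "single m 1 - single (rep (wt a m)) (1::'k)"
    have "?b \<in> fibre_kernel n (wt a)" "?b \<noteq> 0"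
      using that rep[of m] False by (auto intro!: binomial_in_fibre_kernel)
    moreover have "init_form ?b = ?b"
      using False longest_same_tdeg[of n a m "rep (wt a m)"] rep[of m] that
      by (intro init_form_homogeneous_binomial) auto
    ultimately have "?b \<in> ?S" by (metis (mono_tags, lifting) mem_Collect_eq)
    then show ?thesis by (rule ideal_gen_base)
  qed
  have scale: "single 0 c * g \<in> ideal_gen n ?S" if "g \<in> ideal_gen n ?S" for c g
    by (rule ideal_mult[OF idl _ that]) simp
  show "?J \<subseteq> ideal_gen n ?S"
  proof
    fix f :: "'k mpoly" assume f: "f \<in> ?J"
    then have keysf: "keys f \<subseteq> mons n" by (auto simp: graded_kernel_def polys_iff)
    let ?L = "{m \<in> keys f. longest n a m}"
    have "f = (\<Sum>m\<in>keys f. single m (lookup f m))" by (rule single_decomposition)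
    also have "\<dots> = (\<Sum>m\<in>?L. single m (lookup f m))
        + (\<Sum>m\<in>{m \<in> keys f. \<not> longest n a m}. single m (lookup f m))"
      by (subst sum.union_disjoint[symmetric]) (auto intro!: sum.cong)
    also have "(\<Sum>m\<in>?L. single m (lookup f m))
        = (\<Sum>m\<in>?L. single 0 (lookup f m) * (single m 1 - single (rep (wt a m)) 1))
          + (\<Sum>m\<in>?L. single (rep (wt a m)) (lookup f m))"
      by (simp add: sum.distrib[symmetric] algebra_simps mult_single)
    also have "(\<Sum>m\<in>?L. single (rep (wt a m)) (lookup f m)) = 0"
      by (rule fibre_representatives_cancel) (use f in \<open>auto simp: graded_kernel_def\<close>)
    also have "(\<Sum>m\<in>{m \<in> keys f. \<not> longest n a m}. single m (lookup f m))
        = (\<Sum>m\<in>{m \<in> keys f. \<not> longest n a m}. single 0 (lookup f m) * single m 1)"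
      by (simp add: mult_single)
    finally have f_eq: "f = (\<Sum>m\<in>?L. single 0 (lookup f m) * (single m 1 - single (rep (wt a m)) 1)) + 0
        + (\<Sum>m\<in>{m \<in> keys f. \<not> longest n a m}. single 0 (lookup f m) * single m 1)" .
    show "f \<in> ideal_gen n ?S"
      by (subst f_eq, intro ideal_add[OF idl] ideal_sum[OF idl] scale ideal_zero[OF idl])
         (use keysf short long in auto)
  qed
qed

subsection \<open>Homogeneous components\<close>

definition hcomp :: "nat \<Rightarrow> 'k::field mpoly \<Rightarrow> 'k mpoly" where
  "hcomp d f = (\<Sum>m\<in>{m\<in>keys f. tdeg m = d}. single m (lookup f m))"

lemma lookup_hcomp: "lookup (hcomp d f) m = (if tdeg m = d then lookup f m else 0)"
  unfolding hcomp_def lookup_sum lookup_single when_def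
  by (auto simp: in_keys_iff intro!: sum.neutral)

lemma homogeneous_hcomp [simp]: "homogeneous d (hcomp d f)"
  by (auto simp: homogeneous_def in_keys_iff lookup_hcomp split: if_splits)

lemma hcomp_add: "hcomp d (f + g) = hcomp d f + hcomp d g"
  by (intro poly_mapping_eqI) (simp add: lookup_hcomp lookup_add)

lemma hcomp_zero [simp]: "hcomp d 0 = 0"
  by (intro poly_mapping_eqI) (simp add: lookup_hcomp)

lemma hcomp_sum: "hcomp d (\<Sum>i\<in>A. f i) = (\<Sum>i\<in>A. hcomp d (f i))"
  by (induction A rule: infinite_finite_induct) (auto simp: hcomp_add)

lemma hcomp_homogeneous: "homogeneous e f \<Longrightarrow> hcomp d f = (if d = e then f else 0)"
  by (intro poly_mapping_eqI) (auto simp: lookup_hcomp homogeneous_def in_keys_iff)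

lemma hcomp_in_polys [intro]: "f \<in> polys n \<Longrightarrow> hcomp d f \<in> polys n"
  by (auto simp: polys_iff subset_iff in_keys_iff lookup_hcomp split: if_splits)

text \<open>For \<open>f = 0\<close> the bound is the maximum of the empty set, hence unspecified,
  but then every component vanishes.\<close>

lemma hcomp_sum_all:
  fixes f :: "'k::field mpoly"
  shows "f = (\<Sum>d\<le>Max (tdeg ` keys f). hcomp d f)"
proof (rule poly_mapping_eqI)
  fix m
  have "tdeg m \<le> Max (tdeg ` keys f)" if "lookup f m \<noteq> 0"
    using that by (intro Max_ge) (auto simp: in_keys_iff)
  then show "lookup f m = lookup (\<Sum>d\<le>Max (tdeg ` keys f). hcomp d f) m"
    by (auto simp: lookup_sum lookup_hcomp)
qed

lemma hcomp_monomial_mult: "hcomp (tdeg u + d) (single u c * f) = single u c * hcomp d f"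
proof (rule poly_mapping_eqI)
  fix m
  show "lookup (hcomp (tdeg u + d) (single u c * f)) m = lookup (single u c * hcomp d f) m"
  proof (cases "\<exists>v. m = u + v")
    case True
    then show ?thesis by (auto simp: lookup_hcomp)
  next
    case False
    then show ?thesis
      using lookup_monomial_mult_eq_0[of m u f c] lookup_monomial_mult_eq_0[of m u "hcomp d f" c]
      by (auto simp: lookup_hcomp)
  qed
qed

lemma hcomp_mult:
  assumes "homogeneous e l"
  shows "hcomp (e + d) (l * f) = l * hcomp d f"
proof -
  have "hcomp (e + d) (l * f) = (\<Sum>u\<in>keys l. hcomp (e + d) (single u (lookup l u) * f))"
    by (subst mult_decomposition) (rule hcomp_sum)
  also have "\<dots> = (\<Sum>u\<in>keys l. single u (lookup l u) * hcomp d f)"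
  proof (rule sum.cong[OF refl])
    fix u assume "u \<in> keys l"
    then have "tdeg u = e" using assms by (simp add: homogeneous_def)
    then show "hcomp (e + d) (single u (lookup l u) * f) = single u (lookup l u) * hcomp d f"
      using hcomp_monomial_mult[of u d "lookup l u" f] by simp
  qed
  also have "\<dots> = l * hcomp d f" by (rule mult_decomposition[symmetric])
  finally show ?thesis .
qed

lemma homogeneous_mult:
  assumes "homogeneous d f" "homogeneous e g"
  shows "homogeneous (d + e) (f * g)"
  using hcomp_mult[OF assms(1), of e g] hcomp_homogeneous[OF assms(2), of e] homogeneous_hcomp[of "d + e" "f * g"]
  by simp

lemma homogeneous_zero [simp]: "homogeneous d 0"
  by (simp add: homogeneous_def)

lemma homogeneous_sum:
  "(\<And>i. i \<in> A \<Longrightarrow> homogeneous d (f i)) \<Longrightarrow> homogeneous d (\<Sum>i\<in>A. f i)"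
proof (induction A rule: infinite_finite_induct)
  case (insert x F)
  then show ?case using keys_add[of "f x" "sum f F"] by (auto simp: homogeneous_def)
qed auto

text \<open>All longest factorizations of one weight lie in one degree, so each functional sees at
  most one homogeneous component.\<close>

lemma hcomp_graded_kernel:
  assumes "f \<in> graded_kernel n a"
  shows "hcomp d f \<in> graded_kernel n a"
proof -
  have keysf: "keys f \<subseteq> mons n" using assms by (auto simp: graded_kernel_def polys_iff)
  have keys_h: "keys (hcomp d f) = {m \<in> keys f. tdeg m = d}"
    by (auto simp: in_keys_iff lookup_hcomp split: if_splits)
  have "fsum (\<lambda>m. wt a m = h \<and> longest n a m) (hcomp d f) = 0" for h
  proof (cases "\<exists>m0\<in>keys f. tdeg m0 = d \<and> wt a m0 = h \<and> longest n a m0")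
    case True
    then have "tdeg m = d" if "m \<in> keys f" "wt a m = h" "longest n a m" for m
      using that longest_same_tdeg keysf by (metis subsetD)
    then have "fsum (\<lambda>m. wt a m = h \<and> longest n a m) (hcomp d f)
        = fsum (\<lambda>m. wt a m = h \<and> longest n a m) f"
      unfolding fsum_def by (intro sum.cong) (auto simp: keys_h lookup_hcomp)
    then show ?thesis using assms by (simp add: graded_kernel_def)
  next
    case False
    then have "{m \<in> keys (hcomp d f). wt a m = h \<and> longest n a m} = {}"
      by (auto simp: keys_h)
    then show ?thesis unfolding fsum_def by (simp only: sum.empty)
  qed
  then show ?thesis using keysf by (auto simp: graded_kernel_def polys_iff keys_h)
qed


subsection \<open>Koszul implies quadratic\<close>

text \<open>The uniqueness hypothesis makes \<open>m0\<close> the only longest factorization of its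
  weight, so the functional at that weight is the coefficient at \<open>m0\<close>.\<close>

lemma graded_kernel_lookup_eq_0:
  assumes f: "f \<in> graded_kernel n a" and m0: "m0 \<in> mons n"
    and uniq: "\<And>m. m \<in> mons n \<Longrightarrow> wt a m = wt a m0 \<Longrightarrow> tdeg m0 \<le> tdeg m \<Longrightarrow> m = m0"
  shows "lookup f m0 = 0"
proof -
  have long: "longest n a m0"
    unfolding longest_def using uniq by (metis nat_le_linear order_refl)
  have "fsum (\<lambda>m. wt a m = wt a m0 \<and> longest n a m) f = fsum (\<lambda>m. m = m0) f"
  proof (rule fsum_cong)
    fix m assume "m \<in> keys f"
    then have "m \<in> mons n" using f by (auto simp: graded_kernel_def polys_iff)
    then show "wt a m = wt a m0 \<and> longest n a m \<longleftrightarrow> m = m0"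
      using uniq[of m] long m0 by (auto simp: longest_def)
  qed
  then show ?thesis using f by (simp add: graded_kernel_def fsum_eq_lookup)
qed

lemma short_in_graded_kernel:
  assumes "m \<in> mons n" "\<not> longest n a m"
  shows "single m c \<in> graded_kernel n a"
  using assms by (auto simp: graded_kernel_def)

definition irredundant :: "nat \<Rightarrow> (nat \<Rightarrow> nat) \<Rightarrow> bool" where
  "irredundant n a \<longleftrightarrow>
     (\<forall>i<n. 0 < a i \<and> (\<forall>m\<in>mons n. wt a m = a i \<longrightarrow> m = single i 1))"

lemma wt_eq_0_iff:
  assumes "irredundant n a" "m \<in> mons n"
  shows "wt a m = 0 \<longleftrightarrow> m = 0"
  using tdeg_le_wt[of m n a] assms tdeg_eq_0_iff[of m] by (auto simp: irredundant_def)

lemma tdeg_eq_1E: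
  assumes "tdeg m = Suc 0" "m \<in> mons n"
  obtains i where "i < n" "m = single i 1"
proof -
  have "m \<noteq> 0" using assms by auto
  then obtain i where i: "i \<in> keys m" by (metis ex_in_conv keys_eq_empty)
  then obtain m' where m': "m = single i 1 + m'" using monomial_split by blast
  then have "tdeg m' = 0" using assms by simp
  then have "m = single i 1" using m' by (simp add: tdeg_eq_0_iff)
  moreover have "i < n" using i assms by (auto simp: mons_def)
  ultimately show ?thesis using that by blast
qed

text \<open>Zero and each irredundant generator have only one factorization.\<close>

lemma graded_kernel_low_degree:
  assumes irr: "irredundant n a" and f: "f \<in> graded_kernel n a" and m: "tdeg m \<le> 1"
  shows "lookup f m = 0"
proof (cases "m \<in> mons n")
  case False
  then show ?thesis using f by (auto simp: graded_kernel_def polys_iff in_keys_iff)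
next
  case True
  show ?thesis
  proof (rule graded_kernel_lookup_eq_0[OF f True])
    fix m' assume m': "m' \<in> mons n" "wt a m' = wt a m"
    show "m' = m"
    proof (cases "tdeg m = 0")
      case True
      then show ?thesis using m' wt_eq_0_iff[OF irr m'(1)] by (simp add: tdeg_eq_0_iff)
    next
      case False
      then obtain i where "i < n" "m = single i 1"
        using tdeg_eq_1E[OF _ True] m by auto
      then show ?thesis using m' irr by (auto simp: irredundant_def)
    qed
  qed
qed

text \<open>Unlike \<open>ideal_gen\<close>, this keeps coefficient vectors indexed by position,
  because exactness of a resolution speaks about such vectors.\<close>

lemma is_ideal_linear_combinations:
  fixes l :: "nat \<Rightarrow> 'k::field mpoly"
  assumes l: "\<And>k. k < b \<Longrightarrow> l k \<in> polys n"
  shows "is_ideal n {\<Sum>k<b. l k * v k | v. \<forall>k<b. v k \<in> polys n}" (is "is_ideal n ?L")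
  unfolding is_ideal_def
proof (intro conjI ballI)
  show "?L \<subseteq> polys n" using l by (auto intro!: polys_sum polys_mult)
  show "0 \<in> ?L" by (auto intro!: exI[of _ "\<lambda>_. 0"])
next
  fix f g assume "f \<in> ?L" "g \<in> ?L"
  then obtain v w where "\<forall>k<b. v k \<in> polys n" "\<forall>k<b. w k \<in> polys n"
    "f = (\<Sum>k<b. l k * v k)" "g = (\<Sum>k<b. l k * w k)" by blast
  then show "f + g \<in> ?L"
    by (auto intro!: exI[of _ "\<lambda>k. v k + w k"] simp: algebra_simps sum.distrib)
next
  fix r f :: "'k mpoly" assume "r \<in> polys n" "f \<in> ?L"
  then obtain v where "\<forall>k<b. v k \<in> polys n" "f = (\<Sum>k<b. l k * v k)" by blast
  with \<open>r \<in> polys n\<close> show "r * f \<in> ?L"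
    by (auto intro!: exI[of _ "\<lambda>k. r * v k"] simp: algebra_simps sum_distrib_left)
qed

lemma in_ideal_if_no_constant:
  assumes I: "is_ideal n I" and X: "\<And>i. i < n \<Longrightarrow> single (single i 1) 1 \<in> I"
    and f: "f \<in> polys n" "lookup f 0 = 0"
  shows "(f :: 'k::field mpoly) \<in> I"
proof (rule in_ideal_if_monomials[OF I f(1)])
  fix m assume m: "m \<in> keys f" "m \<in> mons n"
  then have "m \<noteq> 0" using f by (auto simp: in_keys_iff)
  then obtain i where i: "i \<in> keys m" by (metis ex_in_conv keys_eq_empty)
  then obtain m' where m': "m = single i 1 + m'" using monomial_split by blast
  moreover have "i < n" using i m by (auto simp: mons_def)
  ultimately have "single m' 1 * single (single i 1) (1::'k) \<in> I"
    using m by (intro ideal_mult[OF I] X) (auto simp: mons_add_iff)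
  then show "single m 1 \<in> I" by (simp add: mult_single m' add.commute)
qed

text \<open>Since \<open>J\<close> starts in degree two, the forms \<open>l k\<close> generate the
  polynomials without constant term even without \<open>J\<close>. A homogeneous f in J of degree d
  > 2 is thus a sum of l_k v_k with v_k of degree d - 1. The syzygy v equals u + M w with all u_k in
  J, and the columns of M yield quadrics q_j of J. Now f is the sum of the l_k u_k and the q_j w_j,
  and induction on the degree handles the u_k.\<close>

theorem linear_syzygies_imp_quadratic:
  fixes J :: "'k::field mpoly set" and b c :: nat
  assumes J: "is_ideal n J" and hom: "\<And>d f. f \<in> J \<Longrightarrow> hcomp d f \<in> J"
    and low: "\<And>f m. f \<in> J \<Longrightarrow> tdeg m \<le> 1 \<Longrightarrow> lookup f m = 0"
    and l: "\<And>k. k < b \<Longrightarrow> l k \<in> polys n" "\<And>k. k < b \<Longrightarrow> homogeneous 1 (l k)"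
    and M: "\<And>k j. k < b \<Longrightarrow> j < c \<Longrightarrow> M k j \<in> polys n"
      "\<And>k j. k < b \<Longrightarrow> j < c \<Longrightarrow> homogeneous 1 (M k j)"
    and gen: "ideal_gen n ({l k | k. k < b} \<union> J) = {f \<in> polys n. lookup f 0 = 0}"
    and col: "\<And>j. j < c \<Longrightarrow> (\<Sum>k<b. l k * M k j) \<in> J"
    and exact: "\<And>v. (\<forall>k<b. v k \<in> polys n) \<Longrightarrow> (\<Sum>k<b. l k * v k) \<in> J \<Longrightarrow>
        \<exists>w. (\<forall>j<c. w j \<in> polys n) \<and> (\<forall>k<b. v k - (\<Sum>j<c. M k j * w j) \<in> J)"
  shows "ideal_gen n {q \<in> J. homogeneous 2 q} = J"
proof
  let ?S = "{q \<in> J. homogeneous 2 q}" and ?J2 = "ideal_gen n {q \<in> J. homogeneous 2 q}"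
  show "?J2 \<subseteq> J" by (rule ideal_gen_least[OF J]) auto
  have J2: "is_ideal n ?J2"
    using ideal_in_polys[OF J] by (intro is_ideal_ideal_gen) auto
  let ?L = "{\<Sum>k<b. l k * v k | v. \<forall>k<b. v k \<in> polys n}"
  have L: "is_ideal n ?L" using is_ideal_linear_combinations[of b l n] l(1) by blast
  have lL: "l k \<in> ?L" if "k < b" for k
    using that by (auto intro!: exI[of _ "\<lambda>i. if i = k then 1 else 0"] simp: if_distrib cong: if_cong)
  have varL: "single (single i 1) 1 \<in> ?L" if i: "i < n" for i
  proof -
    let ?x = "single (single i 1) (1::'k)"
    have "?x \<in> ideal_gen n ({l k | k. k < b} \<union> J)"
      using i unfolding gen by (auto simp: lookup_single when_def)
    then obtain T r where T: "finite T" "T \<subseteq> {l k | k. k < b} \<union> J" "\<forall>s\<in>T. r s \<in> polys n"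
      "?x = (\<Sum>s\<in>T. r s * s)" unfolding ideal_gen_def by blast
    \<comment> \<open>In degree one the summands from \<open>J\<close> vanish, and the others keep
      only the constant term of their coefficient.\<close>
    have "hcomp 1 (r s * s) \<in> ?L" if sT: "s \<in> T" for s
    proof (cases "s \<in> J")
      case True
      then have "r s * s \<in> J" using T sT by (intro ideal_mult[OF J]) auto
      then have "hcomp 1 (r s * s) = 0"
        by (intro poly_mapping_eqI) (simp add: lookup_hcomp low)
      then show ?thesis using ideal_zero[OF L] by simp
    next
      case False
      then obtain k where k: "k < b" "s = l k" using T(2) sT by auto
      have "hcomp 1 (r s * s) = hcomp 0 (r s) * s"
        using hcomp_mult[OF l(2)[OF k(1)], of 0 "r s"] by (simp add: k mult.commute)
      moreover have "hcomp 0 (r s) * s \<in> ?L"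
        using T(3) sT lL[OF k(1)] unfolding k(2) by (intro ideal_mult[OF L] hcomp_in_polys) simp_all
      ultimately show ?thesis by (simp only:)
    qed
    then have "hcomp 1 ?x \<in> ?L" by (subst T(4), subst hcomp_sum) (rule ideal_sum[OF L])
    moreover have "hcomp 1 ?x = ?x"
      by (subst hcomp_homogeneous[of 1]) (auto simp: homogeneous_def)
    ultimately show ?thesis by simp
  qed
  have main: "homogeneous d f \<Longrightarrow> f \<in> J \<Longrightarrow> f \<in> ?J2" for d f
  proof (induction d arbitrary: f rule: less_induct)
    case (less d)
    consider "d \<le> 1" | "d = 2" | e where "d = Suc (Suc (Suc e))"
      by (metis Suc_1 One_nat_def not0_implies_Suc not_less_eq_eq le_zero_eq)
    then show ?case
    proof cases
      case 1
      then have "f = 0" using less.prems low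
        by (intro poly_mapping_eqI) (metis homogeneous_def in_keys_iff lookup_zero)
      then show ?thesis using ideal_zero[OF J2] by simp
    next
      case 2
      then show ?thesis using less.prems by (auto intro: ideal_gen_base)
    next
      case 3
      have "f \<in> ?L"
        by (rule in_ideal_if_no_constant[OF L varL ideal_in_polys[OF J less.prems(2)]])
           (use less.prems low[of f 0] in auto)
      then obtain v where v: "\<forall>k<b. v k \<in> polys n" "f = (\<Sum>k<b. l k * v k)" by blast
      define v' where "v' k = hcomp (Suc (Suc e)) (v k)" for k
      have mult1: "hcomp d (l k * g) = l k * hcomp (Suc (Suc e)) g" if "k < b" for k g
        using hcomp_mult[OF l(2)[OF that], of "Suc (Suc e)" g] by (simp add: 3)
      have "f = hcomp d f" using hcomp_homogeneous[OF less.prems(1), of d] by simp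
      also have "\<dots> = (\<Sum>k<b. l k * v' k)"
        unfolding v(2) hcomp_sum by (intro sum.cong refl) (simp add: mult1 v'_def)
      finally have f_eq: "f = (\<Sum>k<b. l k * v' k)" .
      then obtain w where w: "\<forall>j<c. w j \<in> polys n" "\<forall>k<b. v' k - (\<Sum>j<c. M k j * w j) \<in> J"
        using exact[of v'] less.prems(2) v(1) by (auto simp: v'_def)
      define u where "u k = v' k - (\<Sum>j<c. M k j * w j)" for k
      define q where "q j = (\<Sum>k<b. l k * M k j)" for j
      have "(\<Sum>k<b. l k * (\<Sum>j<c. M k j * w j)) = (\<Sum>j<c. q j * w j)"
        unfolding q_def sum_distrib_left sum_distrib_right
        by (subst sum.swap) (simp add: mult.assoc)
      then have f_eq2: "f = (\<Sum>k<b. l k * u k) + (\<Sum>j<c. q j * w j)"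
        unfolding f_eq u_def by (simp add: algebra_simps sum_subtractf)
      have q2: "homogeneous 2 (q j)" if "j < c" for j
        unfolding q_def using homogeneous_mult[OF l(2) M(2)] that
        by (intro homogeneous_sum) (auto simp: numeral_2_eq_2)
      \<comment> \<open>The entries of u and w need not be homogeneous. Taking the component of
        degree d once more replaces u_k by its part of degree d - 1, where the induction hypothesis
        applies.\<close>
      have "f = hcomp d f" using hcomp_homogeneous[OF less.prems(1), of d] by simp
      also have "\<dots> = (\<Sum>k<b. l k * hcomp (Suc (Suc e)) (u k)) + (\<Sum>j<c. q j * hcomp (Suc e) (w j))"
        unfolding f_eq2 hcomp_add hcomp_sum
        using hcomp_mult[OF q2, of _ "Suc e"] mult1 by (simp add: 3)
      also have "\<dots> \<in> ?J2"
      proof (intro ideal_add[OF J2] ideal_sum[OF J2])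
        fix k assume k: "k \<in> {..<b}"
        have "hcomp (Suc (Suc e)) (u k) \<in> ?J2"
          by (rule less.IH[of "Suc (Suc e)"]) (use w(2) k 3 in \<open>auto simp: u_def intro: hom\<close>)
        then show "l k * hcomp (Suc (Suc e)) (u k) \<in> ?J2"
          using l(1) k by (intro ideal_mult[OF J2]) auto
      next
        fix j assume j: "j \<in> {..<c}"
        then have "q j \<in> ?J2" using col q2 by (intro ideal_gen_base) (auto simp: q_def)
        then show "q j * hcomp (Suc e) (w j) \<in> ?J2"
          using w(1) j by (intro ideal_mult_right[OF J2]) auto
      qed
      finally show ?thesis .
    qed
  qed
  show "J \<subseteq> ?J2"
  proof
    fix f assume "f \<in> J"
    then show "f \<in> ?J2"
      by (subst hcomp_sum_all[of f]) (intro ideal_sum[OF J2] main[OF homogeneous_hcomp] hom)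
  qed
qed

text \<open>If the square of a variable is the only longest factorization of its weight, then no
  quadric of the initial ideal involves it, so that no power of the variable can lie in an ideal
  generated by quadrics; but a suitable power does.\<close>

lemma quadratic_imp_square_relation:
  fixes S :: "'k::field mpoly set"
  assumes S: "\<And>s. s \<in> S \<Longrightarrow> s \<in> polys n \<and> homogeneous 2 s"
    and gen: "ideal_gen n S = graded_kernel n a"
    and i: "i < n" "a 0 < a i" "0 < a 0"
  shows "\<exists>m\<in>mons n. m \<noteq> single i 2 \<and> wt a m = 2 * a i \<and> 2 \<le> tdeg m"
proof (rule ccontr)
  assume neg: "\<not> ?thesis"
  have s0: "lookup s (single i 2) = 0" if "s \<in> S" for s
    by (rule graded_kernel_lookup_eq_0[of s n a])
       (use neg i that ideal_gen_base[OF that, of n] gen in auto)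
  have no_power: "lookup (r * s) (single i N) = 0" if "s \<in> S" for r s N
  proof -
    have "lookup (single u (lookup r u) * s) (single i N) = 0" for u
    proof (rule lookup_monomial_mult_eq_0)
      fix v assume uv: "single i N = u + v"
      have "v = single i (lookup v i)"
      proof (rule poly_mapping_eqI)
        fix j
        have "lookup (single i N) j = lookup u j + lookup v j" by (simp add: uv lookup_add)
        then show "lookup v j = lookup (single i (lookup v i)) j"
          by (auto simp: lookup_single when_def split: if_splits)
      qed
      then have "v = single i (tdeg v)" by (metis tdeg_single)
      moreover have "tdeg v = 2" if "v \<in> keys s"
        using S[OF \<open>s \<in> S\<close>] that by (simp add: homogeneous_def)
      ultimately show "lookup s v = 0"
        using s0[OF that] by (cases "v \<in> keys s") (auto simp: in_keys_iff)
    qed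
    then show ?thesis by (subst mult_decomposition) (simp add: lookup_sum)
  qed
  have "lookup f (single i N) = 0" if "f \<in> graded_kernel n a" for f :: "'k mpoly" and N
    using that unfolding gen[symmetric] ideal_gen_def
    by (auto simp: lookup_sum intro!: sum.neutral no_power)
  \<comment> \<open>The power x_i^(a_0) has the weight of x_0^(a_i), which is longer because a_0 <
    a_i.\<close>
  moreover have "single (single i (a 0)) (1::'k) \<in> graded_kernel n a"
  proof (rule short_in_graded_kernel)
    have "single 0 (a i) \<in> mons n" "wt a (single 0 (a i)) = wt a (single i (a 0))"
      using i by (auto simp: mult.commute)
    then show "\<not> longest n a (single i (a 0))"
      using i unfolding longest_def by (metis tdeg_single not_less)
  qed (use i in auto)
  ultimately show False by (metis lookup_single_eq zero_neq_one)
qed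


subsection \<open>Linear resolutions from Koszul filtrations\<close>

abbreviation var :: "nat \<Rightarrow> 'k::field mpoly" where
  "var i \<equiv> single (single i 1) 1"

text \<open>The ideal J + (x_0, ..., x_(j-1)), with the coefficients of the variables made explicit
  because they become entries of syzygies.\<close>

definition initial_vars :: "nat \<Rightarrow> 'k::field mpoly set \<Rightarrow> nat \<Rightarrow> 'k mpoly set" where
  "initial_vars n J j =
     {f \<in> polys n. \<exists>r. (\<forall>i<j. r i \<in> polys n) \<and> f - (\<Sum>i<j. r i * var i) \<in> J}"

locale homogeneous_ideal =
  fixes n :: nat and J :: "'k::field mpoly set"
  assumes J: "is_ideal n J"
    and hom: "f \<in> J \<Longrightarrow> hcomp d f \<in> J"
begin

abbreviation "Q \<equiv> initial_vars n J"

lemma is_ideal_Q: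
  assumes "j \<le> n"
  shows "is_ideal n (Q j)"
  unfolding is_ideal_def
proof (intro conjI ballI)
  show "Q j \<subseteq> polys n" by (auto simp: initial_vars_def)
  show "0 \<in> Q j"
    using ideal_zero[OF J] by (auto simp: initial_vars_def intro!: exI[of _ "\<lambda>_. 0"])
next
  fix f g assume "f \<in> Q j" "g \<in> Q j"
  then obtain r s where rs: "\<forall>i<j. r i \<in> polys n" "f - (\<Sum>i<j. r i * var i) \<in> J"
    "\<forall>i<j. s i \<in> polys n" "g - (\<Sum>i<j. s i * var i) \<in> J" "f \<in> polys n" "g \<in> polys n"
    by (auto simp: initial_vars_def)
  have "(f + g) - (\<Sum>i<j. (r i + s i) * var i)
      = (f - (\<Sum>i<j. r i * var i)) + (g - (\<Sum>i<j. s i * var i))"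
    by (simp add: algebra_simps sum.distrib)
  then have "(f + g) - (\<Sum>i<j. (r i + s i) * var i) \<in> J"
    using ideal_add[OF J rs(2,4)] by (simp only:)
  then show "f + g \<in> Q j"
    using rs by (auto simp: initial_vars_def intro!: exI[of _ "\<lambda>i. r i + s i"])
next
  fix p f :: "'k mpoly" assume p: "p \<in> polys n" and "f \<in> Q j"
  then obtain r where r: "\<forall>i<j. r i \<in> polys n" "f - (\<Sum>i<j. r i * var i) \<in> J" "f \<in> polys n"
    by (auto simp: initial_vars_def)
  have "p * f - (\<Sum>i<j. (p * r i) * var i) = p * (f - (\<Sum>i<j. r i * var i))"
    by (simp add: algebra_simps sum_distrib_left)
  then have "p * f - (\<Sum>i<j. (p * r i) * var i) \<in> J"
    using ideal_mult[OF J p r(2)] by (simp only:)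
  then show "p * f \<in> Q j"
    using r p by (auto simp: initial_vars_def intro!: exI[of _ "\<lambda>i. p * r i"])
qed

lemma Q_0 [simp]: "Q 0 = J"
  using ideal_in_polys[OF J] by (auto simp: initial_vars_def)

lemma Q_mono:
  assumes "j \<le> k"
  shows "Q j \<subseteq> Q k"
proof
  fix f assume "f \<in> Q j"
  then obtain r where r: "\<forall>i<j. r i \<in> polys n" "f - (\<Sum>i<j. r i * var i) \<in> J" "f \<in> polys n"
    by (auto simp: initial_vars_def)
  have "(\<Sum>i<k. (if i < j then r i else 0) * var i) = (\<Sum>i<j. r i * var i)"
    by (rule sum.mono_neutral_cong_right) (use assms in auto)
  then show "f \<in> Q k"
    using r by (auto simp: initial_vars_def intro!: exI[of _ "\<lambda>i. if i < j then r i else 0"])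
qed

lemma var_in_Q:
  assumes "i < j" "i < n"
  shows "var i \<in> Q j"
proof -
  have "(\<Sum>k<j. (if k = i then 1 else 0) * var k) = (var i :: 'k mpoly)"
    using assms by (simp add: if_distrib[of "\<lambda>x. x * _"] cong: if_cong)
  then show ?thesis using assms ideal_zero[OF J]
    by (auto simp: initial_vars_def intro!: exI[of _ "\<lambda>k. if k = i then 1 else 0"])
qed

lemma Q_SucE:
  assumes "f \<in> Q (Suc j)" "j < n"
  obtains r where "r \<in> polys n" "f - r * var j \<in> Q j"
proof -
  obtain r where r: "\<forall>i<Suc j. r i \<in> polys n" "f - (\<Sum>i<Suc j. r i * var i) \<in> J" "f \<in> polys n"
    using assms by (auto simp: initial_vars_def)
  have "(f - r j * var j) - (\<Sum>i<j. r i * var i) \<in> J"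
    using r(2) by (simp add: algebra_simps)
  moreover have "f - r j * var j \<in> polys n"
    using assms(2) r by (intro polys_diff polys_mult) auto
  ultimately have "f - r j * var j \<in> Q j"
    using r(1) by (auto simp: initial_vars_def intro!: exI[of _ r])
  then show ?thesis using r(1) by (intro that) auto
qed

end

text \<open>The ideals J + (x_0, \<dots>, x_(j-1)) form a Koszul filtration of the quotient by J:
  each successive colon ideal is again in the family.\<close>
locale koszul_filtration = homogeneous_ideal n J for n and J :: "'k::field mpoly set" +
  fixes c :: "nat \<Rightarrow> nat"
  assumes colon_le: "j < n \<Longrightarrow> c j \<le> n"
    and colon: "j < n \<Longrightarrow> r \<in> polys n \<Longrightarrow> r * var j \<in> Q j \<longleftrightarrow> r \<in> Q (c j)"
begin

abbreviation syzygy :: "nat \<Rightarrow> nat \<Rightarrow> (nat \<Rightarrow> nat \<Rightarrow> 'k mpoly) \<Rightarrow> (nat \<Rightarrow> 'k mpoly) \<Rightarrow> bool" where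
  "syzygy p q M v \<equiv> \<forall>j<p. (\<Sum>k<q. M j k * v k) \<in> J"

abbreviation in_span :: "nat \<Rightarrow> nat \<Rightarrow> (nat \<Rightarrow> nat \<Rightarrow> 'k mpoly) \<Rightarrow> (nat \<Rightarrow> 'k mpoly) \<Rightarrow> bool" where
  "in_span q r N v \<equiv> \<exists>w. (\<forall>l<r. w l \<in> polys n) \<and> (\<forall>k<q. v k - (\<Sum>l<r. N k l * w l) \<in> J)"

definition linear_matrix :: "nat \<Rightarrow> nat \<Rightarrow> (nat \<Rightarrow> nat \<Rightarrow> 'k mpoly) \<Rightarrow> bool" where
  "linear_matrix p q M \<longleftrightarrow> (\<forall>j<p. \<forall>k<q. M j k \<in> polys n \<and> homogeneous 1 (M j k))"

text \<open>The annihilator of column t modulo the span of the earlier columns is the member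
  with index s t of the filtration.\<close>
definition filtered_columns ::
    "nat \<Rightarrow> nat \<Rightarrow> (nat \<Rightarrow> nat \<Rightarrow> 'k mpoly) \<Rightarrow> (nat \<Rightarrow> nat) \<Rightarrow> bool" where
  "filtered_columns p q M s \<longleftrightarrow> (\<forall>t<q. s t \<le> n \<and> (\<forall>r\<in>polys n. r \<in> Q (s t) \<longleftrightarrow>
     (\<exists>v. (\<forall>k<t. v k \<in> polys n) \<and> (\<forall>j<p. (\<Sum>k<t. M j k * v k) + M j t * r \<in> J))))"

text \<open>The columns of the matrix N generate those syzygies of M that vanish modulo J beyond
  position t and whose entry in position t lies in the s-th ideal of the filtration.\<close>
definition partial_syzygies ::
    "nat \<Rightarrow> nat \<Rightarrow> (nat \<Rightarrow> nat \<Rightarrow> 'k mpoly) \<Rightarrow> nat \<Rightarrow> nat \<Rightarrow>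
      nat \<Rightarrow> (nat \<Rightarrow> nat \<Rightarrow> 'k mpoly) \<Rightarrow> (nat \<Rightarrow> nat) \<Rightarrow> bool" where
  "partial_syzygies p q M t s q' N s' \<longleftrightarrow>
     linear_matrix q q' N \<and> filtered_columns q q' N s' \<and>
     (\<forall>l<q'. \<forall>k<q. t < k \<longrightarrow> N k l = 0) \<and>
     (t < q \<longrightarrow> (\<forall>l<q'. N t l \<in> Q s)) \<and>
     (\<forall>l<q'. \<forall>j<p. (\<Sum>k<q. M j k * N k l) \<in> J) \<and>
     (\<forall>v. (\<forall>k<q. v k \<in> polys n) \<longrightarrow> syzygy p q M v \<longrightarrow>
        (\<forall>k<q. t < k \<longrightarrow> v k \<in> J) \<longrightarrow> (t < q \<longrightarrow> v t \<in> Q s) \<longrightarrow>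
        in_span q q' N v)"

lemma sum_split_at:
  fixes f :: "nat \<Rightarrow> 'a::comm_monoid_add"
  assumes "t < q"
  shows "(\<Sum>k<q. f k) = (\<Sum>k<t. f k) + f t + (\<Sum>k\<in>{t<..<q}. f k)"
proof -
  have "{..<q} = insert t ({..<t} \<union> {t<..<q})" "{..<t} \<inter> {t<..<q} = {}" using assms by auto
  then show ?thesis by (simp add: sum.union_disjoint add.assoc add.left_commute)
qed

text \<open>The next variable x_s of \<open>Q (cs t)\<close> adds one column. As x_s annihilates
  column t of \<open>M\<close> modulo the earlier columns, there is a syzygy with entry x_s at
  position t and 0 beyond. Its annihilator modulo the old columns is the colon ideal of
  \<open>Q s\<close> by x_s, which is \<open>Q (c s)\<close>, so the columns stay filtered.\<close>

lemma partial_syzygies_extend: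
  assumes M: "linear_matrix p q M" "filtered_columns p q M cs"
    and t: "t < q" "s < cs t"
    and ps: "partial_syzygies p q M t s q' N s'"
  shows "\<exists>q' N s'. partial_syzygies p q M t (Suc s) q' N s'"
proof -
  have cst: "cs t \<le> n" using M t by (auto simp: filtered_columns_def)
  then have sn: "s < n" using t by simp
  have Mp: "M j k \<in> polys n" "homogeneous 1 (M j k)" if "j < p" "k < q" for j k
    using M that by (auto simp: linear_matrix_def)
  note ps' = ps[unfolded partial_syzygies_def]
  note lin = ps'[THEN conjunct1] and fil = ps'[THEN conjunct2, THEN conjunct1]
  note ps' = ps'[THEN conjunct2, THEN conjunct2]
  have zero: "N k l = 0" if "l < q'" "k < q" "t < k" for l k
    using ps'[THEN conjunct1] that by simp
  note ps' = ps'[THEN conjunct2]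
  have Nt: "N t l \<in> Q s" if "l < q'" for l
    using ps'[THEN conjunct1] that t by simp
  note ps' = ps'[THEN conjunct2]
  have syz: "(\<Sum>k<q. M j k * N k l) \<in> J" if "l < q'" "j < p" for l j
    using ps'[THEN conjunct1] that by simp
  have gen: "in_span q q' N v"
    if "\<forall>k<q. v k \<in> polys n" "syzygy p q M v"
      "\<forall>k<q. t < k \<longrightarrow> v k \<in> J" "v t \<in> Q s" for v
    using ps'[THEN conjunct2, THEN spec[of _ v]] that by simp
  have "var s \<in> Q (cs t)" using t sn by (intro var_in_Q)
  then obtain v where v: "\<forall>k<t. v k \<in> polys n"
      "\<forall>j<p. (\<Sum>k<t. M j k * v k) + M j t * var s \<in> J"
    using M(2)[unfolded filtered_columns_def, rule_format, OF t(1), THEN conjunct2, rule_format, of "var s"] sn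
    by auto
  \<comment> \<open>The entries before t are cut down to their linear parts. As \<open>M\<close> is
    linear and \<open>J\<close> homogeneous, the vector remains a syzygy.\<close>
  define u where "u k = (if k < t then hcomp 1 (v k) else if k = t then var s else 0)" for k
  have u_t: "u t = var s" and u_gt: "\<And>k. t < k \<Longrightarrow> u k = 0" by (auto simp: u_def)
  have var1: "homogeneous 1 (var s :: 'k mpoly)" by (auto simp: homogeneous_def)
  have u_polys: "u k \<in> polys n" and u_hom: "homogeneous 1 (u k)" for k
    using v(1) sn var1 homogeneous_hcomp[of 1 "v k"]
    by (auto simp: u_def simp del: homogeneous_hcomp)
  have u_syz: "(\<Sum>k<q. M j k * u k) \<in> J" if j: "j < p" for j
  proof -
    have "hcomp (1 + 1) ((\<Sum>k<t. M j k * v k) + M j t * var s) \<in> J"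
      using v(2) j hom by blast
    also have "hcomp (1 + 1) ((\<Sum>k<t. M j k * v k) + M j t * var s)
        = (\<Sum>k<t. M j k * hcomp 1 (v k)) + M j t * hcomp 1 (var s)"
      unfolding hcomp_add hcomp_sum
      using hcomp_mult[OF Mp(2)[OF j]] t by (intro arg_cong2[where f = "(+)"] sum.cong) auto
    also have "hcomp 1 (var s) = (var s :: 'k mpoly)"
      using hcomp_homogeneous[OF var1, of 1] by simp
    also have "(\<Sum>k<t. M j k * hcomp 1 (v k)) + M j t * var s = (\<Sum>k<q. M j k * u k)"
      using t by (subst sum_split_at[OF t(1)]) (simp add: u_def)
    finally show ?thesis .
  qed
  define N' where "N' k l = (if l < q' then N k l else u k)" for k l
  define s'' where "s'' l = (if l < q' then s' l else c s)" for l
  have A: "linear_matrix q (Suc q') N'"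
    using lin u_polys u_hom by (auto simp: linear_matrix_def N'_def)
  have B: "filtered_columns q (Suc q') N' s''"
    unfolding filtered_columns_def
  proof (intro allI impI)
    fix l assume "l < Suc q'"
    then consider "l < q'" | "l = q'" by linarith
    then show "s'' l \<le> n \<and> (\<forall>r\<in>polys n. r \<in> Q (s'' l) \<longleftrightarrow>
       (\<exists>v. (\<forall>k<l. v k \<in> polys n) \<and> (\<forall>j<q. (\<Sum>k<l. N' j k * v k) + N' j l * r \<in> J)))"
    proof cases
      case 1
      then have "(\<Sum>k<l. N' j k * v k) = (\<Sum>k<l. N j k * v k)" for j v
        by (intro sum.cong) (auto simp: N'_def)
      then show ?thesis using fil 1 by (auto simp: filtered_columns_def N'_def s''_def)
    next
      case 2
      have N'_eq: "(\<Sum>k<l. N' j k * v k) = (\<Sum>k<q'. N j k * v k)" for j v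
        by (intro sum.cong) (auto simp: N'_def 2)
      \<comment> \<open>If r x_s lies in \<open>Q s\<close>, then r times the new column is
        generated by the old ones. Conversely, entry t of a relation shows r x_s in
        \<open>Q s\<close>, since the old columns have their entry t there.\<close>
      have "r \<in> Q (c s) \<longleftrightarrow> (\<exists>v. (\<forall>k<q'. v k \<in> polys n) \<and>
          (\<forall>j<q. (\<Sum>k<q'. N j k * v k) + u j * r \<in> J))" if r: "r \<in> polys n" for r
      proof
        assume "r \<in> Q (c s)"
        then have "r * var s \<in> Q s" using colon[OF sn r] by simp
        then have "\<exists>w. (\<forall>l<q'. w l \<in> polys n) \<and> (\<forall>k<q. r * u k - (\<Sum>l<q'. N k l * w l) \<in> J)"
        proof (intro gen)
          show "\<forall>k<q. r * u k \<in> polys n" using r u_polys by auto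
          show "\<forall>j<p. (\<Sum>k<q. M j k * (r * u k)) \<in> J"
          proof (intro allI impI)
            fix j assume "j < p"
            have "(\<Sum>k<q. M j k * (r * u k)) = r * (\<Sum>k<q. M j k * u k)"
              by (simp add: sum_distrib_left algebra_simps)
            then show "(\<Sum>k<q. M j k * (r * u k)) \<in> J"
              using ideal_mult[OF J r u_syz[OF \<open>j < p\<close>]] by (simp only:)
          qed
          show "\<forall>k<q. t < k \<longrightarrow> r * u k \<in> J" using u_gt ideal_zero[OF J] by simp
        qed (simp add: u_t)
        then obtain w where w: "\<forall>l<q'. w l \<in> polys n" "\<forall>k<q. r * u k - (\<Sum>l<q'. N k l * w l) \<in> J"
          by blast
        have "(\<Sum>k<q'. N j k * (- w k)) + u j * r = r * u j - (\<Sum>l<q'. N j l * w l)" for j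
          by (simp add: sum_negf algebra_simps)
        then have "\<forall>j<q. (\<Sum>k<q'. N j k * (- w k)) + u j * r \<in> J"
          using w(2) by (simp only:)
        then show "\<exists>v. (\<forall>k<q'. v k \<in> polys n) \<and> (\<forall>j<q. (\<Sum>k<q'. N j k * v k) + u j * r \<in> J)"
          using w(1) by (intro exI[of _ "\<lambda>k. - w k"]) auto
      next
        assume "\<exists>v. (\<forall>k<q'. v k \<in> polys n) \<and> (\<forall>j<q. (\<Sum>k<q'. N j k * v k) + u j * r \<in> J)"
        then obtain v where v: "\<forall>k<q'. v k \<in> polys n" "(\<Sum>k<q'. N t k * v k) + var s * r \<in> J"
          using t u_t by metis
        have Qs: "is_ideal n (Q s)" using sn by (intro is_ideal_Q) simp
        have "(\<Sum>k<q'. N t k * v k) \<in> Q s"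
          using v(1) Nt by (intro ideal_sum[OF Qs] ideal_mult_right[OF Qs]) auto
        moreover have "(\<Sum>k<q'. N t k * v k) + var s * r \<in> Q s"
          using v(2) Q_mono[of 0 s] by auto
        ultimately have "var s * r \<in> Q s"
          using ideal_diff[OF Qs] by (metis add_diff_cancel_left')
        then show "r \<in> Q (c s)" using colon[OF sn r] by (simp add: mult.commute)
      qed
      then show ?thesis using colon_le[OF sn] by (simp add: N'_eq) (simp add: N'_def s''_def 2)
    qed
  qed
  have C: "\<forall>l<Suc q'. \<forall>k<q. t < k \<longrightarrow> N' k l = 0"
    using zero u_gt by (simp add: N'_def)
  have D: "\<forall>l<Suc q'. N' t l \<in> Q (Suc s)"
    using Nt Q_mono[of s "Suc s"] var_in_Q[of s "Suc s"] sn by (auto simp: N'_def u_t)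
  have E: "\<forall>l<Suc q'. \<forall>j<p. (\<Sum>k<q. M j k * N' k l) \<in> J"
  proof (intro allI impI)
    fix l j assume "l < Suc q'" "j < p"
    then show "(\<Sum>k<q. M j k * N' k l) \<in> J"
      using syz[of l j] u_syz[of j] by (cases "l < q'") (simp_all add: N'_def)
  qed
  have F: "in_span q (Suc q') N' v"
    if v: "\<forall>k<q. v k \<in> polys n" "syzygy p q M v"
      "\<forall>k<q. t < k \<longrightarrow> v k \<in> J" "v t \<in> Q (Suc s)" for v
  proof -
    \<comment> \<open>Subtracting \<open>r\<close> times the new column moves entry t from
      \<open>Q (Suc s)\<close> back into \<open>Q s\<close>.\<close>
    obtain r where r: "r \<in> polys n" "v t - r * var s \<in> Q s" using Q_SucE[OF v(4) sn] .
    have "\<exists>w. (\<forall>l<q'. w l \<in> polys n) \<and> (\<forall>k<q. (v k - r * u k) - (\<Sum>l<q'. N k l * w l) \<in> J)"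
    proof (intro gen)
      show "\<forall>k<q. v k - r * u k \<in> polys n"
        using v(1) r(1) u_polys by (intro allI impI polys_diff polys_mult) simp_all
      show "\<forall>j<p. (\<Sum>k<q. M j k * (v k - r * u k)) \<in> J"
      proof (intro allI impI)
        fix j assume j: "j < p"
        have "(\<Sum>k<q. M j k * (v k - r * u k)) = (\<Sum>k<q. M j k * v k) - r * (\<Sum>k<q. M j k * u k)"
          by (simp add: sum_distrib_left algebra_simps sum_subtractf)
        also have "\<dots> \<in> J"
          using v(2) j by (intro ideal_diff[OF J] ideal_mult[OF J r(1) u_syz[OF j]]) blast
        finally show "(\<Sum>k<q. M j k * (v k - r * u k)) \<in> J" .
      qed
      show "\<forall>k<q. t < k \<longrightarrow> v k - r * u k \<in> J" using v(3) u_gt by simp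
    qed (use r(2) u_t in simp)
    then obtain w where w: "\<forall>l<q'. w l \<in> polys n"
      "\<forall>k<q. (v k - r * u k) - (\<Sum>l<q'. N k l * w l) \<in> J" by blast
    define w' where "w' l = (if l < q' then w l else r)" for l
    have "v k - (\<Sum>l<Suc q'. N' k l * w' l) = (v k - r * u k) - (\<Sum>l<q'. N k l * w l)" for k
      by (simp add: N'_def w'_def algebra_simps)
    then have "\<forall>k<q. v k - (\<Sum>l<Suc q'. N' k l * w' l) \<in> J" using w(2) by (simp only:)
    moreover have "\<forall>l<Suc q'. w' l \<in> polys n" using w(1) r(1) by (simp add: w'_def)
    ultimately show ?thesis by (intro exI[of _ w'] conjI)
  qed
  have "partial_syzygies p q M t (Suc s) (Suc q') N' s''"
    unfolding partial_syzygies_def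
    by (intro conjI A B C E impI D allI F) (use t in simp_all)
  then show ?thesis by blast
qed

text \<open>Once all variables of \<open>Q (cs t)\<close> are used, the condition on entry t is
  automatic: in a syzygy that vanishes modulo J beyond t, this entry annihilates column t modulo the
  earlier ones. Hence stage \<open>(t, cs t)\<close> is also stage
  \<open>(Suc t, 0)\<close>.\<close>

lemma partial_syzygies_all:
  assumes M: "linear_matrix p q M" "filtered_columns p q M cs"
  shows "t \<le> q \<Longrightarrow> \<exists>q' N s'. partial_syzygies p q M t 0 q' N s'"
proof (induction t)
  case 0
  \<comment> \<open>At this stage all entries lie in \<open>J\<close>, so no column is
    required.\<close>
  have "partial_syzygies p q M 0 0 0 (\<lambda>_ _. 0) (\<lambda>_. 0)"
    unfolding partial_syzygies_def linear_matrix_def filtered_columns_def Q_0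
  proof (intro conjI allI impI)
    fix v assume v: "\<forall>k<q. 0 < k \<longrightarrow> v k \<in> J" "0 < q \<longrightarrow> v 0 \<in> J"
    have "v k \<in> J" if "k < q" for k using v that by (cases "k = 0") auto
    then show "\<exists>w. (\<forall>l<0. w l \<in> polys n) \<and> (\<forall>k<q. v k - (\<Sum>l<0. 0 * w l) \<in> J)"
      by (intro exI[of _ "\<lambda>_. 0"]) simp
  qed simp_all
  then show ?case by blast
next
  case (Suc t)
  then have t: "t < q" by simp
  have Mp: "M j k \<in> polys n" if "j < p" "k < q" for j k
    using M that by (auto simp: linear_matrix_def)
  have "s \<le> cs t \<Longrightarrow> \<exists>q' N s'. partial_syzygies p q M t s q' N s'" for s
  proof (induction s)
    case 0
    then show ?case using Suc by auto
  next
    case (Suc s)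
    then have "\<exists>q' N s'. partial_syzygies p q M t s q' N s'" "s < cs t" by simp_all
    then show ?case using partial_syzygies_extend[OF M t, of s] by blast
  qed
  then obtain q' N s' where ps: "partial_syzygies p q M t (cs t) q' N s'" by blast
  have "v t \<in> Q (cs t)"
    if v: "\<forall>k<q. v k \<in> polys n" "syzygy p q M v" "\<forall>k<q. t < k \<longrightarrow> v k \<in> J" for v
  proof -
    have "(\<Sum>k<t. M j k * v k) + M j t * v t \<in> J" if j: "j < p" for j
    proof -
      have rest: "(\<Sum>k\<in>{t<..<q}. M j k * v k) \<in> J"
        using v(3) Mp[OF j] by (intro ideal_sum[OF J] ideal_mult[OF J]) auto
      have "(\<Sum>k<q. M j k * v k) \<in> J" using v(2) j by simp
      then have "(\<Sum>k<t. M j k * v k) + M j t * v t + (\<Sum>k\<in>{t<..<q}. M j k * v k) \<in> J"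
        by (subst (asm) sum_split_at[OF t])
      from ideal_diff[OF J this rest] show ?thesis by simp
    qed
    then have "\<exists>v'. (\<forall>k<t. v' k \<in> polys n) \<and> (\<forall>j<p. (\<Sum>k<t. M j k * v' k) + M j t * v t \<in> J)"
      using v(1) t by (intro exI[of _ v]) simp
    then show ?thesis
      using M(2)[unfolded filtered_columns_def, rule_format, OF t, THEN conjunct2, rule_format, of "v t"]
        v(1) t by simp
  qed
  note vt = this and ps' = ps[unfolded partial_syzygies_def]
  have F: "in_span q q' N v"
    if v: "\<forall>k<q. v k \<in> polys n" "syzygy p q M v"
      "\<forall>k<q. Suc t < k \<longrightarrow> v k \<in> J" "Suc t < q \<longrightarrow> v (Suc t) \<in> J" for v
  proof -
    have "\<forall>k<q. t < k \<longrightarrow> v k \<in> J" using v(3,4) by (metis Suc_lessI)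
    then show ?thesis
      using ps'[THEN conjunct2, THEN conjunct2, THEN conjunct2, THEN conjunct2, THEN conjunct2, THEN spec[of _ v]]
        v(1,2) vt[OF v(1,2)] by simp
  qed
  have "partial_syzygies p q M (Suc t) 0 q' N s'"
    unfolding partial_syzygies_def Q_0
  proof (intro conjI)
    show "\<forall>l<q'. \<forall>k<q. Suc t < k \<longrightarrow> N k l = 0"
      using ps'[THEN conjunct2, THEN conjunct2, THEN conjunct1] by simp
    show "Suc t < q \<longrightarrow> (\<forall>l<q'. N (Suc t) l \<in> J)"
      using ps'[THEN conjunct2, THEN conjunct2, THEN conjunct1] ideal_zero[OF J] by simp
    show "\<forall>l<q'. \<forall>j<p. (\<Sum>k<q. M j k * N k l) \<in> J"
      using ps'[THEN conjunct2, THEN conjunct2, THEN conjunct2, THEN conjunct2, THEN conjunct1] .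
    show "linear_matrix q q' N" "filtered_columns q q' N s'"
      using ps'[THEN conjunct1] ps'[THEN conjunct2, THEN conjunct1] .
  qed (intro allI impI F; simp)
  then show ?case by blast
qed

lemma syzygy_step:
  assumes "linear_matrix p q M" "filtered_columns p q M cs"
  shows "\<exists>q' N s'. linear_matrix q q' N \<and> filtered_columns q q' N s' \<and>
     (\<forall>v. (\<forall>k<q. v k \<in> polys n) \<longrightarrow> (syzygy p q M v \<longleftrightarrow> in_span q q' N v))"
proof -
  \<comment> \<open>For t = q no position is left to restrict, so the columns generate all
    syzygies.\<close>
  obtain q' N s' where ps: "partial_syzygies p q M q 0 q' N s'"
    using partial_syzygies_all[OF assms, of q] by auto
  have Mp: "M j k \<in> polys n" if "j < p" "k < q" for j k
    using assms that by (auto simp: linear_matrix_def)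
  have syz: "(\<Sum>k<q. M j k * v k) \<in> J"
    if w: "\<forall>l<q'. w l \<in> polys n" "\<forall>k<q. v k - (\<Sum>l<q'. N k l * w l) \<in> J" and j: "j < p" for v w j
  proof -
    have "(\<Sum>k<q. M j k * (\<Sum>l<q'. N k l * w l)) = (\<Sum>l<q'. w l * (\<Sum>k<q. M j k * N k l))"
      unfolding sum_distrib_left by (subst sum.swap) (simp add: algebra_simps)
    also have "\<dots> \<in> J"
      using ps w(1) j unfolding partial_syzygies_def
      by (intro ideal_sum[OF J]) (auto intro: ideal_mult[OF J])
    finally have "(\<Sum>k<q. M j k * (\<Sum>l<q'. N k l * w l)) \<in> J" .
    moreover have "(\<Sum>k<q. M j k * (v k - (\<Sum>l<q'. N k l * w l))) \<in> J"
      using w(2) Mp[OF j] by (intro ideal_sum[OF J] ideal_mult[OF J]) auto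
    moreover have "(\<Sum>k<q. M j k * v k) = (\<Sum>k<q. M j k * (v k - (\<Sum>l<q'. N k l * w l)))
        + (\<Sum>k<q. M j k * (\<Sum>l<q'. N k l * w l))"
      unfolding sum.distrib[symmetric] distrib_left[symmetric] by simp
    ultimately show ?thesis using ideal_add[OF J] by simp
  qed
  have "linear_matrix q q' N" "filtered_columns q q' N s'"
    using ps unfolding partial_syzygies_def by simp_all
  moreover have gen: "in_span q q' N v"
    if "\<forall>k<q. v k \<in> polys n" "syzygy p q M v" for v
    using ps[unfolded partial_syzygies_def, THEN conjunct2, THEN conjunct2, THEN conjunct2,
        THEN conjunct2, THEN conjunct2, THEN spec[of _ v]] that by simp
  moreover have "syzygy p q M v \<longleftrightarrow> in_span q q' N v"
    if "\<forall>k<q. v k \<in> polys n" for v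
  proof
    assume "in_span q q' N v"
    then obtain w where w: "\<forall>l<q'. w l \<in> polys n" "\<forall>k<q. v k - (\<Sum>l<q'. N k l * w l) \<in> J"
      by (elim exE conjE)
    show "syzygy p q M v" by (intro allI impI) (rule syz[OF w])
  qed (rule gen[OF that])
  ultimately show ?thesis
    by (intro exI[of _ q'] exI[of _ N] exI[of _ s'] conjI allI impI)
qed

text \<open>\<open>syzygy_step\<close> is iterated by dependent choice. Beside the matrix and its
  format, the state carries the filtration indices of the columns, which the next step requires. For
  the initial row of variables they are the colon indices \<open>c\<close>.\<close>

theorem linear_resolution_exists:
  shows "\<exists>(b :: nat \<Rightarrow> nat) (M :: nat \<Rightarrow> nat \<Rightarrow> nat \<Rightarrow> 'k mpoly).
       b 0 = 1
     \<and> (\<forall>i j k. j < b i \<longrightarrow> k < b (Suc i) \<longrightarrow>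
           M (Suc i) j k \<in> polys n \<and> homogeneous 1 (M (Suc i) j k))
     \<and> ideal_gen n ({M 1 0 k | k. k < b 1} \<union> J) = ideal_gen n ({var k | k. k < n} \<union> J)
     \<and> (\<forall>i\<ge>1. \<forall>v :: nat \<Rightarrow> 'k mpoly. (\<forall>k<b i. v k \<in> polys n) \<longrightarrow>
          ((\<forall>j<b (i - 1). (\<Sum>k<b i. M i j k * v k) \<in> J) \<longleftrightarrow>
           (\<exists>w :: nat \<Rightarrow> 'k mpoly. (\<forall>l<b (Suc i). w l \<in> polys n) \<and>
              (\<forall>k<b i. v k - (\<Sum>l<b (Suc i). M (Suc i) k l * w l) \<in> J))))"
proof -
  define P where "P = (\<lambda>(p, q, M, s). linear_matrix p q M \<and> filtered_columns p q M s)"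
  define R where "R = (\<lambda>(p :: nat, q :: nat, M, s :: nat \<Rightarrow> nat) (p', q' :: nat, N, s' :: nat \<Rightarrow> nat). p' = q \<and>
     (\<forall>v. (\<forall>k<q. v k \<in> polys n) \<longrightarrow> ((\<forall>j<p. (\<Sum>k<q. M j k * v k) \<in> J) \<longleftrightarrow>
        (\<exists>w. (\<forall>l<q'. w l \<in> polys n) \<and> (\<forall>k<q. v k - (\<Sum>l<q'. N k l * w l) \<in> J)))))"
  have start: "P (1, n, \<lambda>_. var, c)"
  proof -
    have "r \<in> Q (c t) \<longleftrightarrow> (\<exists>v. (\<forall>k<t. v k \<in> polys n) \<and> (\<Sum>k<t. var k * v k) + var t * r \<in> J)"
      if "t < n" "r \<in> polys n" for t r
    proof -
      have "r \<in> Q (c t) \<longleftrightarrow> r * var t \<in> Q t" using colon that by simp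
      also have "\<dots> \<longleftrightarrow> (\<exists>v. (\<forall>k<t. v k \<in> polys n) \<and> (\<Sum>k<t. var k * v k) + var t * r \<in> J)"
      proof
        assume "r * var t \<in> Q t"
        then obtain w where w: "\<forall>i<t. w i \<in> polys n" "r * var t - (\<Sum>i<t. w i * var i) \<in> J"
          by (auto simp: initial_vars_def)
        have "(\<Sum>k<t. var k * (- w k)) + var t * r = r * var t - (\<Sum>i<t. w i * var i)"
          by (simp add: sum_negf algebra_simps)
        then have "(\<Sum>k<t. var k * (- w k)) + var t * r \<in> J" using w(2) by (simp only:)
        moreover have "\<forall>k<t. - w k \<in> polys n" using w(1) by auto
        ultimately show "\<exists>v. (\<forall>k<t. v k \<in> polys n) \<and> (\<Sum>k<t. var k * v k) + var t * r \<in> J"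
          by (intro exI[of _ "\<lambda>k. - w k"] conjI)
      next
        assume "\<exists>v. (\<forall>k<t. v k \<in> polys n) \<and> (\<Sum>k<t. var k * v k) + var t * r \<in> J"
        then obtain v where v: "\<forall>k<t. v k \<in> polys n" "(\<Sum>k<t. var k * v k) + var t * r \<in> J" by blast
        have "r * var t - (\<Sum>k<t. (- v k) * var k) = (\<Sum>k<t. var k * v k) + var t * r"
          by (simp add: sum_negf algebra_simps)
        then have "r * var t - (\<Sum>k<t. (- v k) * var k) \<in> J" using v(2) by (simp only:)
        moreover have "\<forall>k<t. - v k \<in> polys n" "r * var t \<in> polys n" using v(1) that by auto
        ultimately show "r * var t \<in> Q t"
          unfolding initial_vars_def by (intro CollectI conjI exI[of _ "\<lambda>k. - v k"])
      qed
      finally show ?thesis .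
    qed
    moreover have "homogeneous 1 (var k :: 'k mpoly)" for k
      by (auto simp: homogeneous_def)
    ultimately show ?thesis
      by (simp add: P_def linear_matrix_def filtered_columns_def colon_le)
  qed
  have step: "\<exists>y. P y \<and> R x y" if "P x" for x
  proof -
    obtain p q M s where x: "x = (p, q, M, s)" by (metis prod_cases4)
    then have "linear_matrix p q M" "filtered_columns p q M s"
      using that by (simp_all add: P_def)
    from syzygy_step[OF this] obtain q' N s' where
      "linear_matrix q q' N" "filtered_columns q q' N s'"
      "\<forall>v. (\<forall>k<q. v k \<in> polys n) \<longrightarrow> ((\<forall>j<p. (\<Sum>k<q. M j k * v k) \<in> J) \<longleftrightarrow>
        (\<exists>w. (\<forall>l<q'. w l \<in> polys n) \<and> (\<forall>k<q. v k - (\<Sum>l<q'. N k l * w l) \<in> J)))" by blast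
    then have "P (q, q', N, s') \<and> R x (q, q', N, s')" by (simp only: P_def R_def x prod.case simp_thms)
    then show ?thesis by blast
  qed
  have "\<exists>F. \<forall>i. (P (F i) \<and> (i = 0 \<longrightarrow> F i = (1, n, \<lambda>_. var, c))) \<and> R (F i) (F (Suc i))"
    by (rule dependent_nat_choice[where P = "\<lambda>i x. P x \<and> (i = 0 \<longrightarrow> x = (1, n, \<lambda>_. var, c))"])
       (use start in blast, use step in \<open>simp only: nat.distinct simp_thms\<close>)
  then obtain F where F': "\<forall>i. (P (F i) \<and> (i = 0 \<longrightarrow> F i = (1, n, \<lambda>_. var, c))) \<and> R (F i) (F (Suc i))"
    by (elim exE)
  note F = F'[rule_format, THEN conjunct1, THEN conjunct1]
    F'[rule_format, THEN conjunct1, THEN conjunct2, rule_format, OF refl]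
    F'[rule_format, THEN conjunct2]
  define b where "b i = fst (F i)" for i
  \<comment> \<open>State i holds the matrix with number i + 1, hence the shift.\<close>
  define M where "M i = fst (snd (snd (F (i - 1))))" for i
  have b_Suc: "fst (snd (F i)) = b (Suc i)" for i
    using F(3)[of i, unfolded R_def case_prod_beta, THEN conjunct1] unfolding b_def by (rule sym)
  have "b 0 = 1" "M 1 = (\<lambda>_. var)" by (simp_all add: b_def M_def F(2))
  moreover have "b 1 = n" using b_Suc[of 0] by (simp add: F(2))
  moreover have "M (Suc i) j k \<in> polys n \<and> homogeneous 1 (M (Suc i) j k)"
    if "j < b i" "k < b (Suc i)" for i j k
    using F(1)[of i, unfolded P_def case_prod_beta linear_matrix_def b_Suc] that
    by (simp add: b_def M_def)
  moreover have "(\<forall>j<b (i - 1). (\<Sum>k<b i. M i j k * v k) \<in> J) \<longleftrightarrow>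
           (\<exists>w. (\<forall>l<b (Suc i). w l \<in> polys n) \<and>
              (\<forall>k<b i. v k - (\<Sum>l<b (Suc i). M (Suc i) k l * w l) \<in> J))"
    if i: "i \<ge> 1" and v: "\<forall>k<b i. v k \<in> polys n" for i v
  proof -
    obtain i' where i': "i = Suc i'" using i by (cases i) auto
    have M_eq: "fst (snd (snd (F i'))) = M i" "fst (snd (snd (F (Suc i')))) = M (Suc i)"
      "fst (F i') = b (i - 1)" by (simp_all add: M_def b_def i')
    show ?thesis
      using F(3)[of i', unfolded R_def case_prod_beta b_Suc M_eq, THEN conjunct2, THEN spec[of _ v]] v
      unfolding i' by (rule mp)
  qed
  ultimately show ?thesis
    by (intro exI[of _ b] exI[of _ M] conjI allI impI) (simp_all only:)
qed

end


subsection \<open>Numerical semigroups of embedding dimension four\<close>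

definition irreducibles :: "nat set \<Rightarrow> nat set" where
  "irreducibles H = {h \<in> H. h \<noteq> 0 \<and> (\<forall>x\<in>H. \<forall>y\<in>H. h = x + y \<longrightarrow> x = 0 \<or> y = 0)}"

lemma irreducibles_subset_generators:
  assumes "sg_gen S = H"
  shows "irreducibles H \<subseteq> S"
proof
  fix x assume x: "x \<in> irreducibles H"
  then have "x \<in> sg_gen S" using assms by (auto simp: irreducibles_def)
  then show "x \<in> S" using x
  proof (induction rule: sg_gen.induct)
    case (add x y)
    then have "x = 0 \<or> y = 0" using assms by (auto simp: irreducibles_def)
    then show ?case using add by auto
  qed (auto simp: irreducibles_def)
qed

lemma sg_gen_subset:
  assumes "0 \<in> H" "\<And>x y. x \<in> H \<Longrightarrow> y \<in> H \<Longrightarrow> x + y \<in> H" "S \<subseteq> H"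
  shows "sg_gen S \<subseteq> H"
proof
  fix x assume "x \<in> sg_gen S"
  then show "x \<in> H" by induction (use assms in auto)
qed

lemma sg_gen_irreducibles:
  assumes H: "0 \<in> H" "\<And>x y. x \<in> H \<Longrightarrow> y \<in> H \<Longrightarrow> x + y \<in> H"
  shows "sg_gen (irreducibles H) = H"
proof
  show "sg_gen (irreducibles H) \<subseteq> H"
    by (rule sg_gen_subset[OF H]) (auto simp: irreducibles_def)
  show "H \<subseteq> sg_gen (irreducibles H)"
  proof
    fix h assume "h \<in> H"
    then show "h \<in> sg_gen (irreducibles H)"
    proof (induction h rule: less_induct)
      case (less h)
      show ?case
      proof (cases "h = 0 \<or> h \<in> irreducibles H")
        case True
        then show ?thesis by (auto intro: sg_gen.intros)
      next
        case False
        then obtain x y where "x \<in> H" "y \<in> H" "h = x + y" "x \<noteq> 0" "y \<noteq> 0"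
          using less.prems by (auto simp: irreducibles_def)
        then show ?thesis using less.IH[of x] less.IH[of y] by (auto intro: sg_gen.add)
      qed
    qed
  qed
qed

text \<open>The irreducibles lie in every generating set and generate by themselves. This makes the
  definite description well defined.\<close>

lemma min_gens_eq_irreducibles:
  assumes H: "numerical_semigroup H"
  shows "min_gens H = irreducibles H"
  unfolding min_gens_def
proof (rule the_equality)
  have gen: "sg_gen (irreducibles H) = H"
    using H by (intro sg_gen_irreducibles) (auto simp: numerical_semigroup_def)
  then show "irreducibles H \<subseteq> H \<and> sg_gen (irreducibles H) = H
      \<and> (\<forall>T. T \<subset> irreducibles H \<longrightarrow> sg_gen T \<noteq> H)"
    using irreducibles_subset_generators by (auto simp: irreducibles_def)
  fix S assume "S \<subseteq> H \<and> sg_gen S = H \<and> (\<forall>T. T \<subset> S \<longrightarrow> sg_gen T \<noteq> H)"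
  then show "S = irreducibles H"
    using irreducibles_subset_generators[of S H] gen by blast
qed

section \<open>Monomials in four variables\<close>

abbreviation mon4 :: "nat \<Rightarrow> nat \<Rightarrow> nat \<Rightarrow> nat \<Rightarrow> nat \<Rightarrow>\<^sub>0 nat" where
  "mon4 i j k l \<equiv> single 0 i + single 1 j + single 2 k + single 3 l"

lemma mon4_in_mons [simp]: "mon4 i j k l \<in> mons 4"
  by (simp add: mons_add_iff del: One_nat_def)

lemma less_4E:
  assumes "(i::nat) < 4"
  obtains "i = 0" | "i = 1" | "i = 2" | "i = 3"
  using assms by linarith

lemma mons4_eq:
  assumes "m \<in> mons 4"
  shows "m = mon4 (lookup m 0) (lookup m 1) (lookup m 2) (lookup m 3)"
proof (rule poly_mapping_eqI)
  fix i
  show "lookup m i = lookup (mon4 (lookup m 0) (lookup m 1) (lookup m 2) (lookup m 3)) i"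
  proof (cases "i < 4")
    case True
    then show ?thesis
      by (cases rule: less_4E) (simp_all add: lookup_add lookup_single when_def)
  next
    case False
    then have "lookup m i = 0" using assms by (auto simp: mons_def in_keys_iff)
    then show ?thesis using False by (auto simp: lookup_add lookup_single when_def)
  qed
qed

lemma mons4E:
  assumes "m \<in> mons 4"
  obtains i j k l where "m = mon4 i j k l"
  using mons4_eq[OF assms] by blast

lemma mon4_eq_iff [simp]: "mon4 i j k l = mon4 i' j' k' l' \<longleftrightarrow> i = i' \<and> j = j' \<and> k = k' \<and> l = l'"
proof
  assume eq: "mon4 i j k l = mon4 i' j' k' l'"
  have "lookup (mon4 i j k l) p = lookup (mon4 i' j' k' l') p" for p by (simp only: eq)
  from this[of 0] this[of 1] this[of 2] this[of 3]
  show "i = i' \<and> j = j' \<and> k = k' \<and> l = l'"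
    by (simp add: lookup_add lookup_single when_def)
qed simp

text \<open>Modulo 5 the inverse of 2 is 3. As p and r are nonzero and r is neither p nor -p, either
  r = 2 p or p = 2 r. In the first case q = 4 p = 2 r, in the second q = 4 r = 2 p.\<close>

lemma double_mean_mod_5:
  fixes p q r :: nat
  assumes "2 * q = p + r" "p mod 5 \<noteq> 0" "q mod 5 \<noteq> 0" "r mod 5 \<noteq> 0" "(p + r) mod 5 \<noteq> 0"
    "p mod 5 \<noteq> q mod 5" "p mod 5 \<noteq> r mod 5" "q mod 5 \<noteq> r mod 5"
  shows "(2 * p) mod 5 = q mod 5 \<or> (2 * r) mod 5 = q mod 5"
proof -
  define P R where "P = p mod 5" and "R = r mod 5"
  have pr: "(p + r) mod 5 = (P + R) mod 5" by (simp add: P_def R_def mod_simps)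
  have "3 * (2 * q) mod 5 = 3 * ((p + r) mod 5) mod 5"
    unfolding assms(1) by (rule mod_mult_right_eq[symmetric])
  also have "\<dots> = 3 * (P + R) mod 5"
    unfolding pr by (rule mod_mult_right_eq)
  finally have "3 * (2 * q) mod 5 = 3 * (P + R) mod 5" .
  moreover have "3 * (2 * q) = q + q * 5" by simp
  ultimately have q: "q mod 5 = 3 * (P + R) mod 5" by (simp only: mod_mult_self1)
  have res: "x mod 5 = 1 \<or> x mod 5 = 2 \<or> x mod 5 = 3 \<or> x mod 5 = 4" if "x mod 5 \<noteq> 0" for x :: nat
    using that mod_less_divisor[of 5 x] by linarith
  have "(2 * p) mod 5 = (2 * P) mod 5" "(2 * r) mod 5 = (2 * R) mod 5"
    by (simp_all add: P_def R_def mod_simps)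
  moreover have "P \<noteq> R" "P \<noteq> 3 * (P + R) mod 5" "3 * (P + R) mod 5 \<noteq> R" "3 * (P + R) mod 5 \<noteq> 0"
    using assms q by (simp_all add: P_def R_def)
  moreover have "P = 1 \<or> P = 2 \<or> P = 3 \<or> P = 4" "R = 1 \<or> R = 2 \<or> R = 3 \<or> R = 4"
    using res[OF assms(2)] res[OF assms(4)] by (simp_all add: P_def R_def)
  ultimately show ?thesis unfolding q by (elim disjE; simp)
qed

section \<open>Factorizations and the Apery set for four generators\<close>

locale semigroup4 =
  fixes H :: "nat set" and a :: "nat \<Rightarrow> nat"
  assumes num: "numerical_semigroup H"
    and irreducibles_eq: "irreducibles H = {a 0, a 1, a 2, a 3}"
    and a_less: "a 0 < a 1" "a 1 < a 2" "a 2 < a 3"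
begin

abbreviation comb3 :: "nat \<Rightarrow> nat \<Rightarrow> nat \<Rightarrow> nat" where
  "comb3 j k l \<equiv> j * a 1 + k * a 2 + l * a 3"

abbreviation comb4 :: "nat \<Rightarrow> nat \<Rightarrow> nat \<Rightarrow> nat \<Rightarrow> nat" where
  "comb4 i j k l \<equiv> i * a 0 + j * a 1 + k * a 2 + l * a 3"

lemma zero_in [simp]: "0 \<in> H" and add_in [intro]: "x \<in> H \<Longrightarrow> y \<in> H \<Longrightarrow> x + y \<in> H"
  using num by (auto simp: numerical_semigroup_def)

lemma gens_in [simp]: "a 0 \<in> H" "a 1 \<in> H" "a (Suc 0) \<in> H" "a 2 \<in> H" "a 3 \<in> H"
  using irreducibles_eq by (auto simp: irreducibles_def)

lemma a0_pos: "0 < a 0"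
  using irreducibles_eq by (auto simp: irreducibles_def)

lemma mult_in [intro]: "x \<in> H \<Longrightarrow> k * x \<in> H"
  by (induction k) auto

lemma in_H_iff: "h \<in> H \<longleftrightarrow> (\<exists>i j k l. h = comb4 i j k l)"
proof
  assume "h \<in> H"
  then have "h \<in> sg_gen {a 0, a 1, a 2, a 3}"
    using sg_gen_irreducibles[of H] irreducibles_eq by auto
  then show "\<exists>i j k l. h = comb4 i j k l"
  proof induction
    case zero
    then show ?case by (intro exI[of _ 0]) simp
  next
    case (gen x)
    then consider "x = a 0" | "x = a 1" | "x = a 2" | "x = a 3" by auto
    then show ?case
    proof cases
      case 1
      then show ?thesis
        by (intro exI[of _ "1::nat", OF exI[of _ "0::nat", OF exI[of _ "0::nat", OF exI[of _ "0::nat"]]]]) simp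
    next
      case 2
      then show ?thesis
        by (intro exI[of _ "0::nat", OF exI[of _ "1::nat", OF exI[of _ "0::nat", OF exI[of _ "0::nat"]]]]) simp
    next
      case 3
      then show ?thesis
        by (intro exI[of _ "0::nat", OF exI[of _ "0::nat", OF exI[of _ "1::nat", OF exI[of _ "0::nat"]]]]) simp
    next
      case 4
      then show ?thesis
        by (intro exI[of _ "0::nat", OF exI[of _ "0::nat", OF exI[of _ "0::nat", OF exI[of _ "1::nat"]]]]) simp
    qed
  next
    case (add x y)
    then obtain i j k l i' j' k' l' where "x = comb4 i j k l"
      "y = comb4 i' j' k' l'" by blast
    then have "x + y = comb4 (i + i') (j + j') (k + k') (l + l')"
      by (simp add: algebra_simps)
    then show ?case by blast
  qed
qed (auto intro!: add_in mult_in gens_in simp del: One_nat_def)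

lemma comb_in [simp]: "comb4 i j k l \<in> H"
  by (intro add_in mult_in gens_in)

lemma wt_mon4 [simp]: "wt a (mon4 i j k l) = comb4 i j k l"
  by (simp del: One_nat_def)

lemma tdeg_mon4 [simp]: "tdeg (mon4 i j k l) = i + j + k + l"
  by simp

lemma H_eq_wt: "H = wt a ` mons 4"
proof (intro set_eqI iffI)
  fix h assume "h \<in> H"
  then obtain i j k l where "h = comb4 i j k l" using in_H_iff by blast
  then have "h = wt a (mon4 i j k l)" by (simp only: wt_mon4)
  then show "h \<in> wt a ` mons 4" by (rule image_eqI[OF _ mon4_in_mons])
next
  fix h assume "h \<in> wt a ` mons 4"
  then obtain m where "m \<in> mons 4" "h = wt a m" by blast
  then obtain i j k l where "h = wt a (mon4 i j k l)" by (auto elim: mons4E)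
  then show "h \<in> H" by (simp only: wt_mon4 comb_in)
qed

lemma wt_in [simp]: "m \<in> mons 4 \<Longrightarrow> wt a m \<in> H"
  using H_eq_wt by auto

lemma gen_irreducible:
  assumes "i < 4" "a i = x + y" "x \<in> H" "y \<in> H"
  shows "x = 0 \<or> y = 0"
proof -
  have "a i \<in> irreducibles H" using assms(1) irreducibles_eq by (cases rule: less_4E) auto
  then show ?thesis using assms by (auto simp: irreducibles_def)
qed

lemma gens_pos: "i < 4 \<Longrightarrow> 0 < a i"
  using a0_pos a_less by (auto elim!: less_4E)

lemma gens_inj: "i < 4 \<Longrightarrow> j < 4 \<Longrightarrow> a i = a j \<Longrightarrow> i = j"
  using a_less by (elim less_4E) auto

lemma irredundant: "irredundant 4 a"
  unfolding irredundant_def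
proof (intro allI impI conjI ballI)
  fix i m assume i: "i < 4" and m: "m \<in> mons 4" "wt a m = a i"
  have pos: "0 < wt a m" using gens_pos[OF i] m by simp
  then have "m \<noteq> 0" by auto
  then obtain j where j: "j \<in> keys m" by (metis ex_in_conv keys_eq_empty)
  then obtain m' where m': "m = single j 1 + m'" using monomial_split by blast
  have j4: "j < 4" using j m by (auto simp: mons_def)
  have m'4: "m' \<in> mons 4" using m(1) unfolding m' mons_add_iff by simp
  have eq: "a i = wt a (single j 1) + wt a m'" using m m' by simp
  have "wt a (single j 1) = 0 \<or> wt a m' = 0"
    by (rule gen_irreducible[OF i eq]) (use j4 m'4 in \<open>simp_all only: wt_in mons_single\<close>)
  then have "wt a m' = 0" using gens_pos[OF j4] by simp
  then have "tdeg m' = 0" using tdeg_le_wt[OF m'4, of a] gens_pos by simp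
  then have "m' = 0" by (simp add: tdeg_eq_0_iff)
  moreover have "i = j" using eq \<open>wt a m' = 0\<close> gens_inj[OF i j4] by simp
  ultimately show "m = single i 1" using m' by simp
qed (rule gens_pos)

lemma a_not_comb:
  "a 1 \<noteq> i * a 0 + k * a 2 + l * a 3" "a 2 \<noteq> i * a 0 + k * a 1 + l * a 3"
  "a 3 \<noteq> i * a 0 + k * a 1 + l * a 2"
proof -
  have *: "\<And>p m. p < 4 \<Longrightarrow> m \<in> mons 4 \<Longrightarrow> wt a m = a p \<Longrightarrow> m = single p 1"
    using irredundant by (auto simp: irredundant_def)
  show "a 1 \<noteq> i * a 0 + k * a 2 + l * a 3"
  proof
    assume "a 1 = i * a 0 + k * a 2 + l * a 3"
    then have "mon4 i 0 k l = single 1 1" by (intro * mon4_in_mons) simp_all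
    then have "mon4 i 0 k l = mon4 0 1 0 0" by simp
    then show False unfolding mon4_eq_iff by simp
  qed
  show "a 2 \<noteq> i * a 0 + k * a 1 + l * a 3"
  proof
    assume "a 2 = i * a 0 + k * a 1 + l * a 3"
    then have "mon4 i k 0 l = single 2 1" by (intro * mon4_in_mons) simp_all
    then have "mon4 i k 0 l = mon4 0 0 1 0" by simp
    then show False unfolding mon4_eq_iff by simp
  qed
  show "a 3 \<noteq> i * a 0 + k * a 1 + l * a 2"
  proof
    assume "a 3 = i * a 0 + k * a 1 + l * a 2"
    then have "mon4 i k l 0 = single 3 1" by (intro * mon4_in_mons) simp_all
    then have "mon4 i k l 0 = mon4 0 0 0 1" by simp
    then show False unfolding mon4_eq_iff by simp
  qed
qed

text \<open>The condition that w - a_0 is not in H, phrased additively because subtraction on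
  natural numbers truncates.\<close>

definition apery :: "nat set" where
  "apery = {w \<in> H. \<forall>h\<in>H. w \<noteq> h + a 0}"

lemma apery_in: "w \<in> apery \<Longrightarrow> w \<in> H"
  by (simp add: apery_def)

lemma aperyD: "w \<in> apery \<Longrightarrow> h \<in> H \<Longrightarrow> w \<noteq> h + a 0"
  by (simp add: apery_def)

lemma aperyI: "w \<in> H \<Longrightarrow> (\<And>h. h \<in> H \<Longrightarrow> w \<noteq> h + a 0) \<Longrightarrow> w \<in> apery"
  by (simp add: apery_def)

lemma apery_summand:
  assumes "x + y \<in> apery" "x \<in> H" "y \<in> H"
  shows "x \<in> apery"
proof (rule aperyI[OF assms(2)])
  fix h assume h: "h \<in> H"
  have "x + y \<noteq> (h + y) + a 0" by (rule aperyD[OF assms(1) add_in[OF h assms(3)]])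
  then show "x \<noteq> h + a 0" by simp
qed

lemma zero_apery: "0 \<in> apery"
  using a0_pos by (intro aperyI) auto

lemma apery_gen:
  assumes "i < 4" "i \<noteq> 0"
  shows "a i \<in> apery"
proof (rule aperyI)
  show "a i \<in> H" using assms(1) by (cases rule: less_4E) simp_all
  fix h assume "h \<in> H"
  then show "a i \<noteq> h + a 0"
    using gen_irreducible[OF assms(1), of h "a 0"] gens_inj[OF assms(1), of 0] a0_pos assms(2) by auto
qed

lemma apery_gens: "a 1 \<in> apery" "a 2 \<in> apery" "a 3 \<in> apery"
  by (simp_all add: apery_gen del: One_nat_def)

text \<open>A smaller congruent \<open>h\<close> would differ from \<open>w\<close> by a positive
  multiple of a_0, which puts w - a_0 into H.\<close>

lemma apery_mod_less:
  assumes "w \<in> apery" "h \<in> H" "h < w"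
  shows "h mod a 0 \<noteq> w mod a 0"
proof
  assume "h mod a 0 = w mod a 0"
  then have "a 0 dvd w - h" using assms(3) by (metis mod_eq_dvd_iff_nat less_imp_le)
  then obtain k where k: "w - h = a 0 * k" by blast
  moreover have "0 < w - h" using assms(3) by simp
  ultimately have "k \<noteq> 0" by (metis mult_0_right less_irrefl)
  then obtain k' where "k = Suc k'" using not0_implies_Suc by blast
  then have "w = (h + k' * a 0) + a 0" using k assms(3) by (simp add: algebra_simps)
  moreover have "h + k' * a 0 \<in> H" by (intro add_in mult_in gens_in assms)
  ultimately show False using aperyD[OF assms(1)] by blast
qed

lemma apery_mod_inj: "inj_on (\<lambda>w. w mod a 0) apery"
proof (rule inj_onI)
  fix x y assume "x \<in> apery" "y \<in> apery" "x mod a 0 = y mod a 0"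
  then show "x = y"
    using apery_mod_less[of x y] apery_mod_less[of y x] apery_in[of x] apery_in[of y]
    by (cases x y rule: linorder_cases) auto
qed

lemma apery_decomposition:
  assumes "h \<in> H"
  shows "\<exists>w\<in>apery. \<exists>k. h = w + k * a 0"
  using assms
proof (induction h rule: less_induct)
  case (less h)
  show ?case
  proof (cases "h \<in> apery")
    case True
    then show ?thesis by (intro bexI[of _ h] exI[of _ 0]) auto
  next
    case False
    then obtain h' where h': "h' \<in> H" "h = h' + a 0" using less.prems aperyI by blast
    then obtain w k where "w \<in> apery" "h' = w + k * a 0"
      using less.IH[of h'] a0_pos by auto
    then show ?thesis using h' by (intro bexI[of _ w] exI[of _ "Suc k"]) auto
  qed
qed

lemma apery_mod_image: "(\<lambda>w. w mod a 0) ` apery = {..<a 0}"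
proof
  show "(\<lambda>w. w mod a 0) ` apery \<subseteq> {..<a 0}" using a0_pos by auto
  show "{..<a 0} \<subseteq> (\<lambda>w. w mod a 0) ` apery"
  proof
    fix r assume r: "r \<in> {..<a 0}"
    have "finite (UNIV - H)" using num by (simp add: numerical_semigroup_def)
    then obtain B where B: "\<forall>x\<in>UNIV - H. x < B" using finite_nat_set_iff_bounded by blast
    \<comment> \<open>Adding B a_0 takes \<open>r\<close> past every gap without leaving its residue
      class.\<close>
    have "B \<le> r + B * a 0" using a0_pos by (cases "a 0") auto
    then have "r + B * a 0 \<in> H" using B by (metis DiffI UNIV_I not_less)
    then obtain w k where w: "w \<in> apery" "r + B * a 0 = w + k * a 0"
      using apery_decomposition by blast
    then have "(r + B * a 0) mod a 0 = (w + k * a 0) mod a 0" by (simp only:)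
    then have "r mod a 0 = w mod a 0" by (simp only: mod_mult_self1)
    then show "r \<in> (\<lambda>w. w mod a 0) ` apery" using r w(1) by auto
  qed
qed

lemma card_apery: "card apery = a 0" and finite_apery: "finite apery"
proof -
  show "card apery = a 0" using card_image[OF apery_mod_inj] apery_mod_image by simp
  then show "finite apery" using a0_pos card_ge_0_finite by force
qed

end


section \<open>Symmetry and the parametrization in multiplicity five\<close>

context semigroup4
begin

text \<open>With g the Frobenius number, put W = g + a_0. For w in the Apery set, w lies in H and w
  - a_0 does not, so symmetry puts W - w into H and keeps W - w - a_0 out of it. Thus w goes to W -
  w under an involution of the Apery set.\<close>

lemma symmetric_apery:
  assumes sym: "symmetric_sg H"
  obtains W where "W \<in> apery" "\<And>w. w \<in> apery \<Longrightarrow> \<exists>w'\<in>apery. w + w' = W"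
proof -
  define g where "g = frobenius H"
  have s: "(m \<in> int ` H) \<noteq> (g - m \<in> int ` H)" for m
    using sym unfolding symmetric_sg_def g_def by (rule spec)
  have int_image: "int h \<in> int ` H \<longleftrightarrow> h \<in> H" for h by (auto simp: image_iff)
  have "(0::int) \<in> int ` H" using int_image[of 0] by simp
  then have g: "g \<notin> int ` H" using s[of g] by simp
  have "- int (a 0) \<notin> int ` H" using a0_pos by (auto simp: image_iff)
  then have "g + int (a 0) \<in> int ` H" using s[of "- int (a 0)"] by simp
  then obtain W where W: "int W = g + int (a 0)" "W \<in> H" by (metis imageE)
  have Wap: "W \<in> apery"
  proof (rule aperyI[OF W(2)])
    fix h assume "h \<in> H"
    then have "int h \<noteq> g" using g int_image[of h] by auto
    then show "W \<noteq> h + a 0" using W(1) by auto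
  qed
  have "\<exists>w'\<in>apery. w + w' = W" if w: "w \<in> apery" for w
  proof -
    have "int w - int (a 0) \<notin> int ` H"
    proof
      assume "int w - int (a 0) \<in> int ` H"
      then obtain h where h: "int w - int (a 0) = int h" "h \<in> H" by (metis imageE)
      then have "w = h + a 0" by linarith
      then show False using aperyD[OF w h(2)] by blast
    qed
    then have "g - (int w - int (a 0)) \<in> int ` H" using s[of "int w - int (a 0)"] by simp
    then obtain w' where w': "g - (int w - int (a 0)) = int w'" "w' \<in> H" by (metis imageE)
    then have sum: "w + w' = W" using W(1) by linarith
    have "int w \<in> int ` H" using apery_in[OF w] int_image by blast
    then have gw: "g - int w \<notin> int ` H" using s[of "int w"] by simp
    have "w' \<in> apery"
    proof (rule aperyI[OF w'(2)])
      fix h assume "h \<in> H"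
      then have "int h \<noteq> g - int w" using gw int_image[of h] by metis
      then show "w' \<noteq> h + a 0" using w'(1) by auto
    qed
    then show ?thesis using sum by blast
  qed
  then show ?thesis using that[OF Wap] by blast
qed

text \<open>The Apery set has five elements: 0, a_1, a_2, a_3 and W. The complement in W permutes
  a_1 < a_2 < a_3 and reverses their order, so a_1 + a_3 = W = 2 a_2.\<close>

lemma apery_multiplicity5:
  assumes sym: "symmetric_sg H" and e: "a 0 = 5"
  shows "2 * a 2 = a 1 + a 3 \<and> apery = {0, a 1, a 2, a 3, a 1 + a 3}"
proof -
  obtain W where W: "W \<in> apery" "\<And>w. w \<in> apery \<Longrightarrow> \<exists>w'\<in>apery. w + w' = W"
    using symmetric_apery[OF sym] by blast
  have inH: "w \<in> H" if "w \<in> apery" for w using that by (simp add: apery_def)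
  obtain w1 w2 w3 where w: "w1 \<in> apery" "a 1 + w1 = W" "w2 \<in> apery" "a 2 + w2 = W"
    "w3 \<in> apery" "a 3 + w3 = W"
    using W(2) apery_gens by metis
  have ne: "W \<noteq> 0" "W \<noteq> a 1" "W \<noteq> a 2" "W \<noteq> a 3"
    using w a_less a0_pos gen_irreducible[of 2 "a 1" w1] gen_irreducible[of 3 "a 1" w1] inH[OF w(1)]
    by auto
  have "card {0, a 1, a 2, a 3, W} = 5" using ne a_less a0_pos by auto
  then have ap: "apery = {0, a 1, a 2, a 3, W}"
    using W(1) apery_gens zero_apery card_apery finite_apery e
    by (intro card_subset_eq[symmetric]) auto
  have "w1 \<in> {a 1, a 2, a 3}" "w2 \<in> {a 1, a 2, a 3}" "w3 \<in> {a 1, a 2, a 3}"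
    using w ne a_less a0_pos unfolding ap by auto
  then have "W = a 1 + a 3 \<and> W = 2 * a 2" using w a_less by auto
  then show ?thesis using ap by auto
qed

text \<open>\<open>p\<close> is the outer generator whose double is congruent to a_2; then the
  double of the other one, \<open>r\<close>, is congruent to \<open>p\<close>. As a_2 and p are
  Apery elements, hence least in their classes, the doubles exceed them by positive multiples 5 x
  and 5 y.\<close>

lemma multiplicity5_parameters:
  assumes sym: "symmetric_sg H" and e: "a 0 = 5"
  shows "\<exists>x y :: nat. 0 < x \<and> 0 < y \<and> \<not> (5::int) dvd (int x - int y)
      \<and> {a 0, a 1, a 2, a 3} = {5, 4 * x + y, 2 * x + 3 * y, 3 * x + 2 * y}"
proof -
  have q: "2 * a 2 = a 1 + a 3" and ap: "apery = {0, a 1, a 2, a 3, a 1 + a 3}"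
    using apery_multiplicity5[OF assms] by auto
  have mod_ne: "u mod 5 \<noteq> v mod 5" if "u \<in> apery" "v \<in> apery" "u \<noteq> v" for u v
    using inj_onD[OF apery_mod_inj _ that(1,2)] that(3) e by auto
  have sol: "\<exists>x y :: nat. 0 < x \<and> 0 < y \<and> \<not> (5::int) dvd (int x - int y)
      \<and> {p, r} = {4 * x + y, 2 * x + 3 * y} \<and> a 2 = 3 * x + 2 * y"
    if pr: "{p, r} = {a 1, a 3}" "p \<noteq> r" and m: "(2 * p) mod 5 = a 2 mod 5" for p r
  proof -
    have sum: "2 * a 2 = p + r" using pr q by (auto simp: doubleton_eq_iff)
    have pH: "p \<in> apery" "r \<in> apery" "p \<in> H" "r \<in> H"
      using pr apery_gens by (auto simp: doubleton_eq_iff)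
    have "\<not> 2 * p < a 2"
      using apery_mod_less[OF apery_gens(2) mult_in[OF pH(3), of 2]] m e by auto
    moreover have "2 * p \<noteq> a 2"
      using gen_irreducible[of 2 p p] pH a0_pos a_less by auto
    ultimately have lt1: "a 2 < 2 * p" by linarith
    obtain x where x: "2 * p = a 2 + 5 * x"
      using mod_eq_nat1E[OF m less_imp_le[OF lt1]] .
    \<comment> \<open>Eliminating a_2 gives 3 p = r + 10 x, and doubling this exhibits 2 r modulo
      5.\<close>
    have "2 * r + (4 * x) * 5 = p + p * 5" using x sum by linarith
    then have "(2 * r + (4 * x) * 5) mod 5 = (p + p * 5) mod 5" by (simp only:)
    then have r: "(2 * r) mod 5 = p mod 5" by (simp only: mod_mult_self1)
    have "\<not> 2 * r < p"
      using apery_mod_less[OF pH(1) mult_in[OF pH(4), of 2]] r e by auto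
    moreover have "2 * r \<noteq> p"
      using gen_irreducible[of 1 r r] gen_irreducible[of 3 r r] pr pH a0_pos a_less
      by (auto simp: doubleton_eq_iff)
    ultimately have lt2: "p < 2 * r" by linarith
    obtain y where y: "2 * r = p + 5 * y"
      using mod_eq_nat1E[OF r less_imp_le[OF lt2]] .
    have eqs: "p = 4 * x + y" "r = 2 * x + 3 * y" "a 2 = 3 * x + 2 * y"
      using x y sum by linarith+
    have "p \<noteq> 0" using pr a0_pos a_less by (auto simp: doubleton_eq_iff)
    then have "p mod 5 \<noteq> 0" using mod_ne[OF pH(1) zero_apery] by simp
    moreover have "(5::int) dvd int p" if "(5::int) dvd (int x - int y)"
    proof -
      \<comment> \<open>Modulo 5 the generator p is y - x, and p is not divisible by 5 because 0 is
        the only Apery element in its class.\<close>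
      have "int p = 5 * int x - (int x - int y)" using eqs(1) by simp
      then show ?thesis using that by (simp only: dvd_diff dvd_triv_left)
    qed
    ultimately have "\<not> (5::int) dvd (int x - int y)"
      by (metis dvd_imp_mod_0 int_dvd_int_iff of_nat_numeral)
    then show ?thesis using lt1 lt2 x y eqs by (intro exI[of _ x] exI[of _ y]) auto
  qed
  have "a 1 + a 3 \<in> apery" by (simp add: ap)
  note M = apery_gens zero_apery this
  have "(2 * a 1) mod 5 = a 2 mod 5 \<or> (2 * a 3) mod 5 = a 2 mod 5"
  proof (rule double_mean_mod_5[OF q])
    show "a 1 mod 5 \<noteq> 0" using mod_ne[OF M(1,4)] a0_pos a_less by simp
    show "a 2 mod 5 \<noteq> 0" using mod_ne[OF M(2,4)] a0_pos a_less by simp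
    show "a 3 mod 5 \<noteq> 0" using mod_ne[OF M(3,4)] a0_pos a_less by simp
    show "(a 1 + a 3) mod 5 \<noteq> 0" using mod_ne[OF M(5,4)] a0_pos a_less by simp
    show "a 1 mod 5 \<noteq> a 2 mod 5" using mod_ne[OF M(1,2)] a_less by simp
    show "a 1 mod 5 \<noteq> a 3 mod 5" using mod_ne[OF M(1,3)] a_less by simp
    show "a 2 mod 5 \<noteq> a 3 mod 5" using mod_ne[OF M(2,3)] a_less by simp
  qed
  then show ?thesis
  proof
    assume "(2 * a 1) mod 5 = a 2 mod 5"
    from sol[OF _ _ this, of "a 3"] a_less obtain x y where
      "0 < x" "0 < y" "\<not> (5::int) dvd (int x - int y)"
      "{a 1, a 3} = {4 * x + y, 2 * x + 3 * y}" "a 2 = 3 * x + 2 * y" by auto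
    then show ?thesis using e by (intro exI[of _ x] exI[of _ y]) auto
  next
    assume "(2 * a 3) mod 5 = a 2 mod 5"
    from sol[OF _ _ this, of "a 1"] a_less obtain x y where
      "0 < x" "0 < y" "\<not> (5::int) dvd (int x - int y)"
      "{a 3, a 1} = {4 * x + y, 2 * x + 3 * y}" "a 2 = 3 * x + 2 * y" by auto
    then show ?thesis using e by (intro exI[of _ x] exI[of _ y]) auto
  qed
qed

end


section \<open>Apery sets when the squares have second factorizations\<close>

lemma split_two: "2 \<le> j \<Longrightarrow> j * x = 2 * x + (j - 2) * (x::nat)"
  by (metis le_add_diff_inverse add_mult_distrib)

text \<open>The termination measure of both rewriting arguments. Splitting off a positive multiple
  of a_0 lowers the weight by at least 1, so the doubled weight by at least 2, while the exponent of
  x_2 grows by at most 1. The other rule, x_2^2 to x_1 x_3, keeps the weight and lowers that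
  exponent by 2.\<close>

lemma measure_decreases:
  fixes x y i k :: nat
  assumes "x = i + y" "1 \<le> i" "k2 \<le> 1" "k = q + k1"
  shows "2 * y + (k1 + k2) < 2 * x + k"
  using assms by linarith

context semigroup4
begin

lemma apery_comb:
  assumes "comb4 i j k l \<in> apery"
  shows "i = 0"
proof (rule ccontr)
  assume "i \<noteq> 0"
  then obtain i' where "i = Suc i'" using not0_implies_Suc by blast
  then have "comb4 i j k l = comb4 i' j k l + a 0"
    by simp
  then show False using aperyD[OF assms comb_in] by blast
qed

lemma apery_two_summands:
  assumes "comb3 j k l \<in> apery"
  shows "2 \<le> j \<Longrightarrow> 2 * a 1 \<in> apery" "2 \<le> k \<Longrightarrow> 2 * a 2 \<in> apery" "2 \<le> l \<Longrightarrow> 2 * a 3 \<in> apery"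
proof -
  have in2: "2 * a 1 \<in> H" "2 * a 2 \<in> H" "2 * a 3 \<in> H" by (intro mult_in gens_in)+
  show "2 * a 1 \<in> apery" if "2 \<le> j"
  proof (rule apery_summand)
    have "j * a 1 = 2 * a 1 + (j - 2) * a 1" by (rule split_two[OF that])
    then show "2 * a 1 + comb4 0 (j - 2) k l \<in> apery"
      using assms by (simp add: add.assoc)
  qed (use in2 in \<open>simp_all only: comb_in\<close>)
  show "2 * a 2 \<in> apery" if "2 \<le> k"
  proof (rule apery_summand)
    have "k * a 2 = 2 * a 2 + (k - 2) * a 2" by (rule split_two[OF that])
    then show "2 * a 2 + comb4 0 j (k - 2) l \<in> apery"
      using assms by (simp add: algebra_simps)
  qed (use in2 in \<open>simp_all only: comb_in\<close>)
  show "2 * a 3 \<in> apery" if "2 \<le> l"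
  proof (rule apery_summand)
    have "l * a 3 = 2 * a 3 + (l - 2) * a 3" by (rule split_two[OF that])
    then show "2 * a 3 + comb4 0 j k (l - 2) \<in> apery"
      using assms by (simp add: algebra_simps)
  qed (use in2 in \<open>simp_all only: comb_in\<close>)
qed

lemma apery_membership_cases:
  assumes "w \<in> apery"
  obtains j k l where "w = comb3 j k l"
proof -
  obtain i j k l where w: "w = comb4 i j k l"
    using apery_in[OF assms] in_H_iff by blast
  then have "i = 0" using apery_comb assms by blast
  then show ?thesis using that w by simp
qed

context
  assumes squares: "\<And>i. 0 < i \<Longrightarrow> i < 4 \<Longrightarrow>
    \<exists>m\<in>mons 4. m \<noteq> single i 2 \<and> wt a m = 2 * a i \<and> 2 \<le> tdeg m"
begin

lemma squares_comb:
  assumes "0 < p" "p < 4" "2 * a p \<in> apery"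
  obtains j k l where "2 * a p = comb3 j k l" "2 \<le> j + k + l"
    "mon4 0 j k l \<noteq> single p 2"
proof -
  obtain m where m: "m \<in> mons 4" "m \<noteq> single p 2" "wt a m = 2 * a p" "2 \<le> tdeg m"
    using squares[OF assms(1,2)] by blast
  obtain i j k l where ijkl: "m = mon4 i j k l" using mons4E[OF m(1)] .
  have eq: "2 * a p = comb4 i j k l"
    using m(3) unfolding ijkl wt_mon4 by simp
  then have "i = 0" using apery_comb assms(3) by metis
  then show ?thesis using that[of j k l] m(2,4) eq unfolding ijkl tdeg_mon4 by simp
qed

lemma mult_le_a: "j * a 1 \<le> j * a 2" "j * a 2 \<le> j * a 3" "j * a 1 \<le> j * a 3"
  using a_less by (auto intro!: mult_le_mono2)

text \<open>A second factorization would avoid a_0. Without a_1 it is too heavy, with a single a_1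
  it makes a_1 reducible, and with two it is the trivial one.\<close>

lemma double_a1: "2 * a 1 \<notin> apery"
proof
  assume "2 * a 1 \<in> apery"
  then obtain j k l where jkl: "2 * a 1 = comb3 j k l" "2 \<le> j + k + l"
    "mon4 0 j k l \<noteq> single 1 2" using squares_comb[of 1] by auto
  consider "j = 0" | "j = 1" | j' where "j = Suc (Suc j')"
    by (metis One_nat_def not0_implies_Suc)
  then show False
  proof cases
    case 1
    then have "2 * a 2 \<le> (k + l) * a 2" using jkl(2) by (intro mult_le_mono1) simp
    also have "\<dots> \<le> k * a 2 + l * a 3" using mult_le_a(2)[of l] by (simp add: add_mult_distrib)
    finally show False using jkl(1) 1 a_less by simp
  next
    case 2
    then show False using jkl(1) a_not_comb(1)[of 0 k l] by simp
  next
    case 3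
    then have "comb3 j' k l = 0" using jkl(1) by simp
    then have "j' = 0" "k = 0" "l = 0" using a_less a0_pos by auto
    then show False using jkl(3) 3 by (simp add: numeral_2_eq_2)
  qed
qed

text \<open>A second factorization avoids a_2. It contains at most one a_1, as 2 a_1 is not an Apery
  element, and at most one a_3 by size, so only a_1 + a_3 has length two.\<close>

lemma double_a2:
  assumes ap: "2 * a 2 \<in> apery"
  shows "2 * a 2 = a 1 + a 3"
proof -
  obtain j k l where jkl: "2 * a 2 = comb3 j k l" "2 \<le> j + k + l"
    "mon4 0 j k l \<noteq> single 2 2" using squares_comb[of 2] ap by auto
  have jlt: "j < 2"
    using apery_two_summands(1)[of j k l] ap jkl(1) double_a1 by (metis not_le)
  consider "k = 0" | "k = 1" | k' where "k = Suc (Suc k')"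
    by (metis One_nat_def not0_implies_Suc)
  then show ?thesis
  proof cases
    case 1
    have "l < 2"
    proof (rule ccontr)
      assume "\<not> l < 2"
      then have "2 * a 3 \<le> l * a 3" by (intro mult_le_mono1) simp
      then show False using jkl(1) a_less by linarith
    qed
    then have "j = 1" "l = 1" using jlt jkl(2) 1 by auto
    then show ?thesis using jkl(1) 1 by simp
  next
    case 2
    then show ?thesis using jkl(1) a_not_comb(2)[of 0 j l] by simp
  next
    case 3
    then have "comb3 j k' l = 0" using jkl(1) by simp
    then have "j = 0" "k' = 0" "l = 0" using a_less a0_pos by auto
    then show ?thesis using jkl(3) 3 by (simp add: numeral_2_eq_2)
  qed
qed

text \<open>A second factorization avoids a_3 and contains at most one a_1. If a_2 occurs twice,
  replacing 2 a_2 by a_1 + a_3 and cancelling a_3 expresses a_3 by a_1 and a_2. Otherwise the sum is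
  at most a_1 + a_2, which is too small.\<close>

lemma double_a3: "2 * a 3 \<notin> apery"
proof
  assume ap: "2 * a 3 \<in> apery"
  then obtain j k l where jkl: "2 * a 3 = comb3 j k l" "2 \<le> j + k + l"
    "mon4 0 j k l \<noteq> single 3 2" using squares_comb[of 3] by auto
  have jlt: "j < 2"
    using apery_two_summands(1)[of j k l] ap jkl(1) double_a1 by (metis not_le)
  consider "l = 0" | "l = 1" | l' where "l = Suc (Suc l')"
    by (metis One_nat_def not0_implies_Suc)
  then show False
  proof cases
    case 1
    show False
    proof (cases "2 \<le> k")
      case True
      then have d: "2 * a 2 = a 1 + a 3"
        using apery_two_summands(2)[of j k l] ap jkl(1) double_a2 by metis
      have "k * a 2 = 2 * a 2 + (k - 2) * a 2"
        by (rule split_two[OF True])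
      then have "a 3 = 0 * a 0 + (j + 1) * a 1 + (k - 2) * a 2"
        using jkl(1) 1 d by simp
      then show False using a_not_comb(3) by blast
    next
      case False
      then have "j = 1" "k = 1" using jlt jkl(2) 1 by auto
      then show False using jkl(1) 1 a_less by simp
    qed
  next
    case 2
    then show False using jkl(1) a_not_comb(3)[of 0 j k] by simp
  next
    case 3
    then have "comb3 j k l' = 0" using jkl(1) by simp
    then have "j = 0" "k = 0" "l' = 0" using a_less a0_pos by auto
    then show False using jkl(3) 3 by (simp add: numeral_2_eq_2)
  qed
qed

text \<open>Only a_2 can occur more than once. Replacing 2 a_2 by a_1 + a_3 raises the other two
  multiplicities, which are bounded by 1: so they were 0, and the replacement is possible only once,
  leaving at most one a_2.\<close>

lemma apery_squarefree:
  assumes w: "w \<in> apery"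
  shows "\<exists>j\<le>1. \<exists>k\<le>1. \<exists>l\<le>1. w = comb3 j k l"
proof -
  have bound: "j \<le> 1 \<and> l \<le> 1" if "w = comb3 j k l" for j k l
    using apery_two_summands(1,3)[of j k l] that w double_a1 double_a3 by fastforce
  obtain j k l where jkl: "w = comb3 j k l"
    using apery_membership_cases[OF w] .
  show ?thesis
  proof (cases "k \<le> 1")
    case True
    then show ?thesis using jkl bound[OF jkl] by blast
  next
    case False
    then have d: "2 * a 2 = a 1 + a 3"
      using apery_two_summands(2)[of j k l] w jkl double_a2 by simp
    have step: "comb3 x (y + 2) z = comb3 (x + 1) y (z + 1)" for x y z
      using d by (simp add: algebra_simps)
    have jkl': "w = comb3 (j + 1) (k - 2) (l + 1)"
    proof -
      have "k = (k - 2) + 2" using False by simp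
      then show ?thesis using jkl step[of j "k - 2" l] by simp
    qed
    then have jl: "j = 0" "l = 0" using bound[OF jkl'] by auto
    have "k - 2 \<le> 1"
    proof (rule ccontr)
      assume "\<not> k - 2 \<le> 1"
      then have "k - 2 = (k - 4) + 2" by simp
      then have "w = comb3 (j + 1 + 1) (k - 4) (l + 1 + 1)"
        using jkl' step[of "j + 1" "k - 4" "l + 1"] by simp
      from bound[OF this] show False by simp
    qed
    then show ?thesis using jkl' jl
      by (intro exI[of _ 1] exI[of _ "k - 2"] conjI) simp_all
  qed
qed

text \<open>Seven squarefree sums remain as candidates. W = a_1 + a_2 leaves no complement for a_3,
  and W = a_2 + a_3 none for a_1, so W = a_1 + a_3. This excludes a_1 + a_2, whose complement would
  split a_3, and a_2 + a_3, which exceeds W.\<close>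

lemma multiplicity_eq_5:
  assumes sym: "symmetric_sg H" and full: "a 1 + a 2 + a 3 \<notin> apery"
  shows "a 0 = 5"
proof -
  obtain W where W: "W \<in> apery" "\<And>w. w \<in> apery \<Longrightarrow> \<exists>w'\<in>apery. w + w' = W"
    using symmetric_apery[OF sym] by blast
  have cases7: "w = 0 \<or> w = a 1 \<or> w = a 2 \<or> w = a 3 \<or> w = a 1 + a 2 \<or> w = a 1 + a 3 \<or> w = a 2 + a 3"
    if w': "w \<in> apery" for w
  proof -
    obtain j k l where "j \<le> 1" "k \<le> 1" "l \<le> 1" and w: "w = comb3 j k l"
      using apery_squarefree[OF w'] by blast
    then have "j = 0 \<or> j = 1" "k = 0 \<or> k = 1" "l = 0 \<or> l = 1" by auto
    then show ?thesis using full w' unfolding w by (elim disjE) simp_all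
  qed
  obtain w1 where w1: "w1 \<in> apery" "a 1 + w1 = W" using W(2) apery_gens(1) by blast
  obtain w2 where w2: "w2 \<in> apery" "a 2 + w2 = W" using W(2) apery_gens(2) by blast
  obtain w3 where w3: "w3 \<in> apery" "a 3 + w3 = W" using W(2) apery_gens(3) by blast
  have irr: "a 2 \<noteq> 2 * a 1" "a 3 \<noteq> 2 * a 1" "a 3 \<noteq> a 1 + a 2" "a 3 \<noteq> 2 * a 2"
    using a_not_comb(2)[of 0 2 0] a_not_comb(3)[of 0 2 0] a_not_comb(3)[of 0 1 1] a_not_comb(3)[of 0 0 2]
    by simp_all
  note a_pos = a0_pos a_less
  have "W \<noteq> a 2" using gen_irreducible[of 2 "a 1" w1] w1 a_pos apery_in[OF w1(1)] by auto
  moreover have "W \<noteq> a 3" using gen_irreducible[of 3 "a 1" w1] w1 a_pos apery_in[OF w1(1)] by auto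
  moreover have "W \<noteq> 0" "W \<noteq> a 1" using w2 a_pos by auto
  ultimately consider "W = a 1 + a 2" | "W = a 1 + a 3" | "W = a 2 + a 3"
    using cases7[OF W(1)] by blast
  then have "W = a 1 + a 3"
  proof cases
    case 1
    then show ?thesis using cases7[OF w3(1)] w3(2) irr a_pos by (elim disjE) linarith+
  next
    case 3
    then show ?thesis using cases7[OF w1(1)] w1(2) irr a_pos by (elim disjE) linarith+
  qed simp
  moreover have "a 1 + a 2 \<notin> apery"
  proof
    assume "a 1 + a 2 \<in> apery"
    then obtain w' where w': "w' \<in> apery" "a 1 + a 2 + w' = W" using W(2) by blast
    then have "a 3 = a 2 + w'" using \<open>W = a 1 + a 3\<close> by simp
    then show False using gen_irreducible[of 3 "a 2" w'] apery_in[OF w'(1)] a_pos by auto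
  qed
  moreover have "a 2 + a 3 \<notin> apery"
  proof
    assume "a 2 + a 3 \<in> apery"
    then obtain w' where "a 2 + a 3 + w' = W" using W(2) by blast
    then show False using \<open>W = a 1 + a 3\<close> a_pos by simp
  qed
  ultimately have "apery = {0, a 1, a 2, a 3, a 1 + a 3}"
    using cases7 W(1) zero_apery apery_gens by blast
  then show ?thesis using card_apery a_pos by simp
qed

end

end


subsection \<open>Multiplicity five gives a Koszul filtration\<close>

lemma lookup_mult_var_eq_0:
  assumes "lookup m i = 0"
  shows "lookup (r * var i :: 'k::field mpoly) m = 0"
proof -
  have "lookup (var i * r) m = 0"
    by (rule lookup_monomial_mult_eq_0) (use assms in \<open>auto simp: lookup_add\<close>)
  then show ?thesis by (simp only: mult.commute)
qed

lemma lookup_mult_var_add: "lookup (r * var i :: 'k::field mpoly) (single i 1 + m) = lookup r m"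
  using lookup_monomial_mult_add[of "single i 1" 1 r m] by (simp only: mult.commute mult_1)

text \<open>The monomials in x_1, x_2, x_3 that represent the five Apery elements; for a_1 + a_3 the
  choice is x_1 x_3 rather than x_2^2.\<close>

definition std :: "nat \<Rightarrow> nat \<Rightarrow> nat \<Rightarrow> bool" where
  "std j k l \<longleftrightarrow> (j, k, l) \<in> {(0,0,0), (1,0,0), (0,1,0), (0,0,1), (1,0,1)}"

lemma fsum_pair:
  assumes "A \<noteq> B"
  shows "fsum (\<lambda>m. m = A \<or> m = B) f = lookup f A + lookup f B"
proof -
  have "fsum (\<lambda>m. m = A \<or> m = B) f
      = (\<Sum>m\<in>insert A (insert B (keys f)). if m = A \<or> m = B then lookup f m else 0)"
    by (rule fsum_superset) auto
  also have "\<dots> = (\<Sum>m\<in>{A, B}. lookup f m)"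
    by (rule sum.mono_neutral_cong_right) auto
  finally show ?thesis using assms by simp
qed

lemma longest_binomial_in_graded_kernel:
  assumes "u \<in> mons n" "w \<in> mons n" "longest n a u" "longest n a w" "wt a u = wt a w"
  shows "single u 1 - single w 1 \<in> graded_kernel n a"
  using assms by (auto simp: graded_kernel_def fsum_diff)

context homogeneous_ideal
begin

lemma J_subset_Q: "J \<subseteq> Q j"
  using Q_mono[of 0 j] by simp

lemma mult_var_in_Q:
  assumes "i < j" "j \<le> n" "r \<in> polys n"
  shows "r * var i \<in> Q j"
  using assms by (intro ideal_mult[OF is_ideal_Q] var_in_Q) auto

lemma lookup_Q_eq_0:
  assumes f: "f \<in> Q j" and m: "\<And>i. i < j \<Longrightarrow> lookup m i = 0" and "\<And>g. g \<in> J \<Longrightarrow> lookup g m = 0"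
  shows "lookup f m = 0"
proof -
  obtain r where "f - (\<Sum>i<j. r i * var i) \<in> J" using f by (auto simp: initial_vars_def)
  then have "lookup (f - (\<Sum>i<j. r i * var i)) m = 0" by (rule assms(3))
  moreover have "(\<Sum>i<j. lookup (r i * var i) m) = 0"
    using m lookup_mult_var_eq_0 by (intro sum.neutral) blast
  ultimately show ?thesis by (simp add: lookup_minus lookup_sum)
qed

lemma colon_contains:
  assumes r: "r \<in> Q k" and j: "j < n" "k \<le> n" and v: "\<And>i. i < k \<Longrightarrow> var i * var j \<in> Q j"
  shows "r * var j \<in> Q j"
proof -
  have Qj: "is_ideal n (Q j)" using j by (intro is_ideal_Q) simp
  obtain s where s: "\<forall>i<k. s i \<in> polys n" "r - (\<Sum>i<k. s i * var i) \<in> J"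
    using r by (auto simp: initial_vars_def)
  have "(r - (\<Sum>i<k. s i * var i)) * var j \<in> Q j"
    using s(2) j J_subset_Q by (intro ideal_mult_right[OF Qj]) auto
  moreover have "(\<Sum>i<k. s i * (var i * var j)) \<in> Q j"
    using s(1) v by (intro ideal_sum[OF Qj] ideal_mult[OF Qj, of "s _"]) simp_all
  moreover have "r * var j = (r - (\<Sum>i<k. s i * var i)) * var j + (\<Sum>i<k. s i * (var i * var j))"
    by (simp add: left_diff_distrib sum_distrib_right mult.assoc)
  ultimately show ?thesis using ideal_add[OF Qj] by (simp only:)
qed

end

section \<open>Standard monomials and colon ideals in multiplicity five\<close>

context semigroup4
begin

context
  assumes mean: "2 * a 2 = a 1 + a 3" and ap: "apery = {0, a 1, a 2, a 3, a 1 + a 3}"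
begin

lemma apery_eq_wt_standard:
  assumes "w \<in> apery"
  obtains j k l where "w = comb3 j k l"
    "std j k l"
proof -
  consider "w = 0" | "w = a 1" | "w = a 2" | "w = a 3" | "w = a 1 + a 3"
    using assms unfolding ap by blast
  then show ?thesis
  proof cases
    case 1 then show ?thesis using that[of 0 0 0] by (simp add: std_def)
  next
    case 2 then show ?thesis using that[of 1 0 0] by (simp add: std_def)
  next
    case 3 then show ?thesis using that[of 0 1 0] by (simp add: std_def)
  next
    case 4 then show ?thesis using that[of 0 0 1] by (simp add: std_def)
  next
    case 5 then show ?thesis using that[of 1 0 1] by (simp add: std_def)
  qed
qed

lemma std_apery: "std j k l \<Longrightarrow> comb3 j k l \<in> apery"
  unfolding std_def ap by auto

lemma bad_quads_not_apery:
  "2 * a 1 \<notin> apery" "a 1 + a 2 \<notin> apery" "a 2 + a 3 \<notin> apery" "2 * a 3 \<notin> apery"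
  using a_not_comb(2)[of 0 2 0] a_not_comb(3)[of 0 2 0] a_not_comb(3)[of 0 1 1] a0_pos a_less
  unfolding ap by simp_all

text \<open>The quadrics x_1^2, x_1 x_2, x_2 x_3, x_3^2, whose weights are outside the Apery set.
  The other two quadrics in x_1, x_2, x_3, namely x_1 x_3 and x_2^2, have the Apery weight a_1 +
  a_3.\<close>

definition bad :: "nat \<Rightarrow> nat \<Rightarrow> nat \<Rightarrow> bool" where
  "bad j k l \<longleftrightarrow> (j, k, l) \<in> {(2,0,0), (1,1,0), (0,1,1), (0,0,2)}"

text \<open>The weight is not an Apery element, so x_0 can be split off. The length does not drop
  below 2: a pure power of x_0 has exponent above 2 because the weight exceeds 2 a_0.\<close>

lemma bad_rewrite:
  assumes "bad j k l"
  obtains i j' k' l' where "0 < i" "std j' k' l'"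
    "comb3 j k l = comb4 i j' k' l'"
    "2 \<le> i + j' + k' + l'"
proof -
  let ?h = "comb3 j k l"
  have not_ap: "?h \<notin> apery" using assms bad_quads_not_apery unfolding bad_def by auto
  have gt: "2 * a 0 < ?h" using assms a_less unfolding bad_def by auto
  have "?h \<in> H" using comb_in[of 0 j k l] by simp
  then obtain w i where w: "w \<in> apery" "?h = w + i * a 0" using apery_decomposition by blast
  have i: "0 < i" using w not_ap by (cases "i = 0") auto
  obtain j' k' l' where jkl: "w = comb3 j' k' l'"
    "std j' k' l'"
    using apery_eq_wt_standard[OF w(1)] .
  have "2 \<le> i + j' + k' + l'"
  proof (cases "j' + k' + l' = 0")
    case True
    then have "?h = i * a 0" using w jkl by simp
    then have "2 < i" using gt by simp
    then show ?thesis by simp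
  next
    case False
    then show ?thesis using i by linarith
  qed
  then show ?thesis using that[OF i jkl(2)] w(2) jkl(1) by simp
qed

lemma no_bad_quad:
  assumes "\<not> 2 \<le> j" "\<not> (1 \<le> j \<and> 1 \<le> k)" "\<not> (1 \<le> k \<and> 1 \<le> l)" "\<not> 2 \<le> l"
  shows "std j k l \<or> (j = 0 \<and> l = 0 \<and> 2 \<le> (k::nat))"
proof -
  have "j = 0 \<or> j = 1" "l = 0 \<or> l = 1" "k = 0 \<or> k = 1 \<or> 2 \<le> k" using assms by auto
  then show ?thesis using assms(2,3) by (elim disjE) (simp_all add: std_def)
qed

lemma bad_divisor:
  assumes "2 \<le> j \<or> (1 \<le> j \<and> 1 \<le> k) \<or> (1 \<le> k \<and> 1 \<le> l) \<or> 2 \<le> l"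
  obtains p q r j' k' l' where "bad p q r" "j = p + j'" "k = q + k'" "l = r + l'"
proof -
  consider "2 \<le> j" | "1 \<le> j \<and> 1 \<le> k" | "1 \<le> k \<and> 1 \<le> l" | "2 \<le> l" using assms by blast
  then show ?thesis
  proof cases
    case 1 then show ?thesis using that[of 2 0 0 "j - 2" k l] by (simp add: bad_def)
  next
    case 2 then show ?thesis using that[of 1 1 0 "j - 1" "k - 1" l] by (simp add: bad_def)
  next
    case 3 then show ?thesis using that[of 0 1 1 j "k - 1" "l - 1"] by (simp add: bad_def)
  next
    case 4 then show ?thesis using that[of 0 0 2 j k "l - 2"] by (simp add: bad_def)
  qed
qed

text \<open>Replacing bad quadrics by \<open>bad_rewrite\<close> and x_2^2 by x_1 x_3 never shortens
  a factorization, so lengths need to be compared only with standard forms.\<close>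

lemma normal_form:
  "\<exists>i' j' k' l'. std j' k' l' \<and>
     comb4 i j k l = comb4 i' j' k' l' \<and>
     i + j + k + l \<le> i' + j' + k' + l'"
proof (induction "2 * comb3 j k l + k" arbitrary: i j k l rule: less_induct)
  case less
  show ?case
  proof (cases "2 \<le> j \<or> (1 \<le> j \<and> 1 \<le> k) \<or> (1 \<le> k \<and> 1 \<le> l) \<or> 2 \<le> l")
    case True
    obtain p q r j1 k1 l1 where b: "bad p q r" "j = p + j1" "k = q + k1" "l = r + l1"
      using bad_divisor[OF True] .
    obtain i2 j2 k2 l2 where r: "0 < i2" "std j2 k2 l2"
      "comb3 p q r = comb4 i2 j2 k2 l2" "2 \<le> i2 + j2 + k2 + l2"
      using bad_rewrite[OF b(1)] .
    have pqr: "p + q + r = 2" using b(1) by (auto simp: bad_def)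
    have k2: "k2 \<le> 1" using r(2) by (auto simp: std_def)
    have pos: "1 \<le> i2 * a 0" using r(1) a0_pos by simp
    have lt: "2 * comb3 (j1 + j2) (k1 + k2) (l1 + l2) + (k1 + k2)
        < 2 * comb3 j k l + k"
    proof -
      have "comb3 j k l
          = i2 * a 0 + comb3 (j1 + j2) (k1 + k2) (l1 + l2)"
        using r(3) unfolding b(2-4) add_mult_distrib by simp
      then show ?thesis using pos k2 b(3) by (rule measure_decreases)
    qed
    obtain i' j' k' l' where nf: "std j' k' l'"
      "comb4 (i + i2) (j1 + j2) (k1 + k2) (l1 + l2)
        = comb4 i' j' k' l'"
      "(i + i2) + (j1 + j2) + (k1 + k2) + (l1 + l2) \<le> i' + j' + k' + l'"
      using less[OF lt, of "i + i2"] by blast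
    have "comb4 i j k l = comb4 i' j' k' l'"
      using nf(2) r(3) unfolding b(2-4) add_mult_distrib by simp
    moreover have "i + j + k + l \<le> i' + j' + k' + l'"
      using nf(3) r(4) pqr unfolding b(2-4) by linarith
    ultimately show ?thesis using nf(1) by blast
  next
    case False
    then consider "std j k l" | "j = 0" "l = 0" "2 \<le> k"
      using no_bad_quad[of j k l] by blast
    then show ?thesis
    proof cases
      case 1
      then show ?thesis by blast
    next
      case 2
      have k: "k * a 2 = 2 * a 2 + (k - 2) * a 2" by (rule split_two[OF 2(3)])
      have lt: "2 * comb3 1 (k - 2) 1 + (k - 2) < 2 * comb3 j k l + k"
        using 2 k mean by simp
      obtain i' j' k' l' where nf: "std j' k' l'"
        "comb4 i 1 (k - 2) 1 = comb4 i' j' k' l'"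
        "i + 1 + (k - 2) + 1 \<le> i' + j' + k' + l'"
        using less[OF lt, of i] by blast
      have "comb4 i j k l = comb4 i' j' k' l'"
        using nf(2) k mean 2 by simp
      moreover have "i + j + k + l \<le> i' + j' + k' + l'" using nf(3) 2 by simp
      ultimately show ?thesis using nf(1) by blast
    qed
  qed
qed

text \<open>A standard form of the product's weight must contain x_0, since that weight minus a_0
  lies in H. Cancelling one x_0 reduces the comparison to the weight of \<open>m\<close>.\<close>

lemma longest_mult_x0:
  assumes m: "m \<in> mons 4" "longest 4 a m"
  shows "longest 4 a (single 0 1 + m)"
  unfolding longest_def
proof (intro ballI impI)
  fix m2 assume m2: "m2 \<in> mons 4" "wt a m2 = wt a (single 0 1 + m)"
  obtain i j k l where ijkl: "m2 = mon4 i j k l" using mons4E[OF m2(1)] .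
  obtain i' j' k' l' where nf: "std j' k' l'"
    "wt a m2 = wt a (mon4 i' j' k' l')" "tdeg m2 \<le> tdeg (mon4 i' j' k' l')"
    using normal_form[of i j k l] unfolding ijkl wt_mon4 tdeg_mon4 by blast
  have "i' \<noteq> 0"
  proof
    assume "i' = 0"
    then have "wt a m2 \<in> apery" using std_apery[OF nf(1)] nf(2) unfolding wt_mon4 by simp
    then show False using aperyD[of "wt a m2" "wt a m"] m(1) m2(2) by simp
  qed
  then obtain i'' where i'': "i' = Suc i''" using not0_implies_Suc by blast
  have "wt a (mon4 i'' j' k' l') = wt a m"
    using nf(2) m2(2) unfolding wt_mon4 i'' wt_add by simp
  then have "tdeg (mon4 i'' j' k' l') \<le> tdeg m" using m(2) mon4_in_mons unfolding longest_def by blast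
  then show "tdeg m2 \<le> tdeg (single 0 1 + m)" using nf(3) unfolding tdeg_mon4 i'' by simp
qed

lemma graded_kernel_x0_regular:
  assumes r: "r \<in> polys 4" and "r * var 0 \<in> graded_kernel 4 a"
  shows "(r :: 'k::field mpoly) \<in> graded_kernel 4 a"
proof -
  have "fsum (\<lambda>m. wt a m = h \<and> longest 4 a m) r = 0" for h
  proof -
    have "0 = fsum (\<lambda>m. wt a m = a 0 + h \<and> longest 4 a m) (r * var 0)"
      using assms(2) by (simp add: graded_kernel_def)
    also have "\<dots> = fsum (\<lambda>m. wt a m = a 0 + h \<and> longest 4 a m) (var 0 * r)"
      by (simp only: mult.commute)
    also have "\<dots> = fsum (\<lambda>m. wt a (single 0 1 + m) = a 0 + h \<and> longest 4 a (single 0 1 + m)) r"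
      by (simp only: fsum_monomial_mult mult_1)
    also have "\<dots> = fsum (\<lambda>m. wt a m = h \<and> longest 4 a m) r"
    proof (rule fsum_cong)
      fix m assume "m \<in> keys r"
      then have "m \<in> mons 4" using r by (auto simp: polys_iff)
      then show "wt a (single 0 1 + m) = a 0 + h \<and> longest 4 a (single 0 1 + m) \<longleftrightarrow>
          wt a m = h \<and> longest 4 a m"
        using longest_mult_x0[of m] longest_addD[of "single 0 1" 4 a m] by auto
    qed
    finally show ?thesis by simp
  qed
  then show ?thesis using r by (simp add: graded_kernel_def)
qed

lemma mean_fibre:
  assumes m: "m \<in> mons 4"
  shows "wt a m = a 1 + a 3 \<longleftrightarrow> m = mon4 0 1 0 1 \<or> m = mon4 0 0 2 0"
proof
  obtain i j k l where ijkl: "m = mon4 i j k l" using mons4E[OF m] .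
  assume "wt a m = a 1 + a 3"
  then have eq: "comb4 i j k l = a 1 + a 3" unfolding ijkl wt_mon4 .
  have "a 1 + a 3 \<in> apery" by (simp add: ap)
  then have i: "i = 0" using apery_comb[of i j k l] eq by simp
  have not_bad: "\<not> (2 \<le> j \<or> (1 \<le> j \<and> 1 \<le> k) \<or> (1 \<le> k \<and> 1 \<le> l) \<or> 2 \<le> l)"
  proof
    assume "2 \<le> j \<or> (1 \<le> j \<and> 1 \<le> k) \<or> (1 \<le> k \<and> 1 \<le> l) \<or> 2 \<le> l"
    then obtain p q r j1 k1 l1 where b: "bad p q r" "j = p + j1" "k = q + k1" "l = r + l1"
      by (rule bad_divisor)
    have "comb3 p q r + comb3 j1 k1 l1 = a 1 + a 3"
      using eq i unfolding b(2-4) add_mult_distrib by simp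
    then have "comb3 p q r \<in> apery"
      using apery_summand[of "comb3 p q r" "comb3 j1 k1 l1"]
        \<open>a 1 + a 3 \<in> apery\<close> comb_in[of 0 p q r] comb_in[of 0 j1 k1 l1] by simp
    then show False using b(1) bad_quads_not_apery unfolding bad_def by auto
  qed
  then consider "std j k l" | "j = 0" "l = 0" "2 \<le> k"
    using no_bad_quad[of j k l] by blast
  then show "m = mon4 0 1 0 1 \<or> m = mon4 0 0 2 0"
  proof cases
    case 1
    then have "j = 1 \<and> k = 0 \<and> l = 1" using eq i mean a0_pos a_less by (auto simp: std_def)
    then show ?thesis unfolding ijkl i by simp
  next
    case 2
    then have "k * a 2 = 2 * a 2" using eq i mean by simp
    then have "k = 2" using a_less by simp
    then show ?thesis unfolding ijkl i 2 by simp
  qed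
next
  assume "m = mon4 0 1 0 1 \<or> m = mon4 0 0 2 0"
  then show "wt a m = a 1 + a 3" using mean wt_mon4[of 0 1 0 1] wt_mon4[of 0 0 2 0] by auto
qed

lemma longest_mean: "longest 4 a (mon4 0 1 0 1)" "longest 4 a (mon4 0 0 2 0)"
proof -
  have "tdeg (mon4 0 1 0 1) = 2" "tdeg (mon4 0 0 2 0) = 2" "wt a (mon4 0 1 0 1) = a 1 + a 3"
    "wt a (mon4 0 0 2 0) = a 1 + a 3"
    unfolding wt_mon4 tdeg_mon4 using mean by simp_all
  then show "longest 4 a (mon4 0 1 0 1)" "longest 4 a (mon4 0 0 2 0)"
    unfolding longest_def by (simp_all only:) (auto simp only: mean_fibre)
qed

lemma graded_kernel_mean:
  assumes f: "f \<in> graded_kernel 4 a"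
  shows "lookup f (mon4 0 1 0 1) + lookup f (mon4 0 0 2 0) = 0"
proof -
  have "fsum (\<lambda>m. wt a m = a 1 + a 3 \<and> longest 4 a m) f = fsum (\<lambda>m. m = mon4 0 1 0 1 \<or> m = mon4 0 0 2 0) f"
  proof (rule fsum_cong)
    fix m assume "m \<in> keys f"
    then have "m \<in> mons 4" using f by (auto simp: graded_kernel_def polys_iff)
    then show "wt a m = a 1 + a 3 \<and> longest 4 a m \<longleftrightarrow> m = mon4 0 1 0 1 \<or> m = mon4 0 0 2 0"
      using mean_fibre[of m] longest_mean by blast
  qed
  also have "\<dots> = lookup f (mon4 0 1 0 1) + lookup f (mon4 0 0 2 0)"
    by (rule fsum_pair) (unfold mon4_eq_iff, simp)
  finally show ?thesis using f by (simp only: graded_kernel_def mem_Collect_eq)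
qed

lemma homogeneous_ideal_graded_kernel: "homogeneous_ideal 4 (graded_kernel 4 a :: 'k::field mpoly set)"
  by unfold_locales (rule is_ideal_graded_kernel, rule hcomp_graded_kernel)

text \<open>A bad quadric that is not longest lies in J. A longest one is congruent modulo J to its
  rewriting, which then has the same length and contains x_0.\<close>

lemma bad_in_x0_ideal:
  assumes "bad j k l"
  shows "single (mon4 0 j k l) (1::'k::field) \<in> initial_vars 4 (graded_kernel 4 a) 1"
proof -
  interpret homogeneous_ideal 4 "graded_kernel 4 a :: 'k mpoly set"
    by (rule homogeneous_ideal_graded_kernel)
  let ?m = "mon4 0 j k l"
  have tdeg2: "tdeg ?m = 2" unfolding tdeg_mon4 using assms by (auto simp: bad_def)
  have Q1: "is_ideal 4 (Q 1)" by (rule is_ideal_Q) simp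
  show ?thesis
  proof (cases "longest 4 a ?m")
    case False
    then have "single ?m (1::'k) \<in> graded_kernel 4 a" by (intro short_in_graded_kernel mon4_in_mons)
    then show ?thesis using J_subset_Q by blast
  next
    case True
    obtain i j' k' l' where r: "0 < i" "std j' k' l'"
      "comb3 j k l = comb4 i j' k' l'" "2 \<le> i + j' + k' + l'"
      using bad_rewrite[OF assms] .
    let ?m' = "mon4 i j' k' l'"
    have wt: "wt a ?m = wt a ?m'" unfolding wt_mon4 using r(3) by simp
    then have "tdeg ?m' \<le> tdeg ?m" using True unfolding longest_def by (metis mon4_in_mons)
    then have "tdeg ?m = tdeg ?m'" using r(4) tdeg2 unfolding tdeg_mon4 by linarith
    then have "longest 4 a ?m'" by (rule longest_transfer[OF True wt])
    then have diff: "single ?m (1::'k) - single ?m' 1 \<in> Q 1"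
      using longest_binomial_in_graded_kernel[OF mon4_in_mons mon4_in_mons True _ wt] J_subset_Q by blast
    obtain i' where i': "i = Suc i'" using r(1) by (cases i) auto
    have "single (mon4 i' j' k' l') (1::'k) * var 0 \<in> Q 1"
      by (rule mult_var_in_Q[OF _ _ polys_single[OF mon4_in_mons]]) simp_all
    also have "single (mon4 i' j' k' l') (1::'k) * var 0 = single ?m' 1"
    proof -
      have "single (0::nat) i = single 0 i' + single 0 1" by (simp add: i' flip: single_add)
      then show ?thesis by (simp add: mult_single ac_simps)
    qed
    finally show ?thesis using ideal_add_cancel[OF Q1 diff] by blast
  qed
qed

lemma var_products:
  "var 1 * var 1 = (single (mon4 0 2 0 0) 1 :: 'k::field mpoly)"
  "var 2 * var 1 = (single (mon4 0 1 1 0) 1 :: 'k mpoly)"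
  "var 2 * var 2 = (single (mon4 0 0 2 0) 1 :: 'k mpoly)"
  "var 3 * var 1 = (single (mon4 0 1 0 1) 1 :: 'k mpoly)"
  "var 3 * var 2 = (single (mon4 0 0 1 1) 1 :: 'k mpoly)"
  "var 3 * var 3 = (single (mon4 0 0 0 2) 1 :: 'k mpoly)"
  by (simp_all add: mult_single single_add[symmetric] add.commute numeral_2_eq_2)

text \<open>x_0 is regular modulo J. Modulo x_0 the variable x_1 is killed by x_1 and x_2, but not
  by x_3, since x_1 x_3 is standard. Modulo x_0 and x_1, x_2 is killed by all variables because
  x_2^2 equals x_1 x_3, and the same holds for x_3 at the last stage because x_3^2 is bad.\<close>

theorem koszul_filtration_graded_kernel:
  "koszul_filtration 4 (graded_kernel 4 a :: 'k::field mpoly set)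
     (\<lambda>j. if j = 0 then 0 else if j = 1 then 3 else 4)"
proof -
  let ?J = "graded_kernel 4 a :: 'k mpoly set"
  interpret homogeneous_ideal 4 ?J by (rule homogeneous_ideal_graded_kernel)
  have low: "lookup g m = 0" if "g \<in> ?J" "tdeg m \<le> 1" for g m
    using graded_kernel_low_degree[OF irredundant that] .
  have Q1_subset: "Q 1 \<subseteq> Q j" if "1 \<le> j" for j using Q_mono[OF that] .
  have bad_in: "single (mon4 0 j k l) (1::'k) \<in> Q p" if "bad j k l" "1 \<le> p" for j k l p
    using bad_in_x0_ideal[OF that(1)] Q1_subset[OF that(2)] by blast
  have Q4: "r \<in> Q 4" if "r \<in> polys 4" "lookup r 0 = 0" for r
    by (rule in_ideal_if_no_constant[OF is_ideal_Q _ that]) (simp_all only: order_refl var_in_Q)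
  have square2: "var 2 * var 2 \<in> Q 2"
  proof -
    have Q2: "is_ideal 4 (Q 2)" by (rule is_ideal_Q) simp
    have "wt a (mon4 0 0 2 0) = wt a (mon4 0 1 0 1)" unfolding wt_mon4 using mean by simp
    then have "single (mon4 0 0 2 0) (1::'k) - single (mon4 0 1 0 1) 1 \<in> Q 2"
      using longest_binomial_in_graded_kernel[OF mon4_in_mons mon4_in_mons longest_mean(2,1)] J_subset_Q
      by blast
    moreover have "single (mon4 0 1 0 1) (1::'k) \<in> Q 2"
      using mult_var_in_Q[of 1 2 "var 3"] unfolding var_products by simp
    ultimately show ?thesis using ideal_add_cancel[OF Q2] unfolding var_products by blast
  qed
  have v1: "var i * var 1 \<in> Q 1" if i: "i < 3" for i
  proof -
    consider "i = 0" | "i = 1" | "i = 2" using i by linarith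
    then show ?thesis
    proof cases
      case 1
      then show ?thesis using mult_var_in_Q[of 0 1 "var 1"] by (simp add: mult.commute)
    next
      case 2
      show ?thesis unfolding 2 var_products by (rule bad_in) (simp_all add: bad_def)
    next
      case 3
      show ?thesis unfolding 3 var_products by (rule bad_in) (simp_all add: bad_def)
    qed
  qed
  have v2: "var i * var 2 \<in> Q 2" if i: "i < 4" for i
    using i
  proof (cases rule: less_4E)
    case 1
    then show ?thesis using mult_var_in_Q[of 0 2 "var 2"] by (simp add: mult.commute)
  next
    case 2
    then show ?thesis using mult_var_in_Q[of 1 2 "var 2"] by (simp add: mult.commute)
  next
    case 3
    then show ?thesis using square2 by simp
  next
    case 4
    show ?thesis unfolding 4 var_products by (rule bad_in) (simp_all add: bad_def)
  qed
  have v3: "var i * var 3 \<in> Q 3" if i: "i < 4" for i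
  proof (cases "i < 3")
    case True
    then show ?thesis using mult_var_in_Q[of i 3 "var 3"] by (simp add: mult.commute)
  next
    case False
    then have i3: "i = 3" using i by simp
    show ?thesis unfolding i3 var_products by (rule bad_in) (simp_all add: bad_def)
  qed
  \<comment> \<open>A constant term of r would contribute x_j, which is free of the earlier
    variables and occurs in no element of J.\<close>
  have const: "lookup r 0 = 0" if r: "r * var j \<in> Q j" and j: "j < 4" for r j
  proof -
    have "lookup (r * var j) (single j 1) = 0"
      by (rule lookup_Q_eq_0[OF r]) (use low in \<open>auto simp: lookup_single when_def\<close>)
    then show ?thesis using lookup_mult_var_add[of r j 0] by simp
  qed
  \<comment> \<open>A term of r in x_3 would contribute x_1 x_3. Multiples of x_0 contain neither
    x_1 x_3 nor x_2^2, and multiples of x_1 do not contain x_2^2, so the functional of weight a_1 +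
    a_3 forbids it.\<close>
  have linear3: "lookup r (single 3 1) = 0" if r: "r * var 1 \<in> Q 1" for r
  proof -
    let ?A = "mon4 0 1 0 1" and ?B = "mon4 0 0 2 0"
    obtain s where s: "r * var 1 - s * var 0 \<in> ?J"
      using r by (auto simp: initial_vars_def)
    have "lookup (r * var 1 - s * var 0) ?A + lookup (r * var 1 - s * var 0) ?B = 0"
      by (rule graded_kernel_mean[OF s])
    moreover have "lookup (s * var 0) ?A = 0" "lookup (s * var 0) ?B = 0" "lookup (r * var 1) ?B = 0"
      by (rule lookup_mult_var_eq_0; simp add: lookup_add lookup_single when_def)+
    moreover have "lookup (r * var 1) ?A = lookup r (single 3 1)"
      using lookup_mult_var_add[of r 1 "single 3 1"] by simp
    ultimately show ?thesis by (simp only: lookup_minus diff_zero add_0_right)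
  qed
  have Q3: "r \<in> Q 3" if r: "r \<in> polys 4" "lookup r 0 = 0" "lookup r (single 3 1) = 0" for r
  proof (rule in_ideal_if_monomials[OF is_ideal_Q r(1)])
    have Q3: "is_ideal 4 (Q 3)" by (rule is_ideal_Q) simp
    fix m assume m: "m \<in> keys r" "m \<in> mons 4"
    show "single m 1 \<in> Q 3"
    proof (cases "\<exists>i<3. i \<in> keys m")
      case True
      then obtain i where i: "i < 3" "i \<in> keys m" by blast
      obtain m' where m': "m = single i 1 + m'" using monomial_split[OF i(2)] by blast
      then have "single m' 1 * var i \<in> Q 3"
        using i m(2) by (intro mult_var_in_Q polys_single) (auto simp: mons_add_iff)
      then show ?thesis by (simp add: mult_single m' add.commute)
    next
      case False
      then have "lookup m 0 = 0" "lookup m 1 = 0" "lookup m 2 = 0" by (auto simp: in_keys_iff)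
      then have m3: "m = single 3 (lookup m 3)" using mons4_eq[OF m(2)] by simp
      have "lookup m 3 \<noteq> 0" "lookup m 3 \<noteq> 1" using m3 m(1) r(2,3) by (metis in_keys_iff single_zero, metis in_keys_iff)
      \<comment> \<open>Only powers of x_3 from the square on remain, and x_3^2 is a bad
        quadric.\<close>
      then have "lookup m 3 = 2 + (lookup m 3 - 2)" by simp
      then have "m = mon4 0 0 0 2 + single 3 (lookup m 3 - 2)"
        using m3 by (simp add: single_add[symmetric])
      moreover have "single (single 3 (lookup m 3 - 2)) (1::'k) * single (mon4 0 0 0 2) 1 \<in> Q 3"
        by (intro ideal_mult[OF Q3] bad_in) (simp_all add: bad_def)
      ultimately show ?thesis by (simp only: mult_single add.commute mult_1)
    qed
  qed simp
  show ?thesis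
  proof unfold_locales
    fix j :: nat and r :: "'k mpoly" assume j: "j < 4" and r: "r \<in> polys 4"
    from j show "r * var j \<in> Q j \<longleftrightarrow> r \<in> Q (if j = 0 then 0 else if j = 1 then 3 else 4)"
    proof (cases rule: less_4E)
      case 1
      have "r * var 0 \<in> ?J \<longleftrightarrow> r \<in> ?J"
        using graded_kernel_x0_regular[OF r] ideal_mult_right[OF is_ideal_graded_kernel, of "var 0" 4 r a]
        by auto
      then show ?thesis by (simp add: 1)
    next
      case 2
      have "r * var 1 \<in> Q 1 \<longleftrightarrow> r \<in> Q 3"
        using colon_contains[of r 3 1, OF _ _ _ v1] Q3[OF r] const[of r 1] linear3[of r] by auto
      then show ?thesis by (simp add: 2)
    next
      case 3
      have "r * var 2 \<in> Q 2 \<longleftrightarrow> r \<in> Q 4"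
        using colon_contains[of r 4 2, OF _ _ _ v2] Q4[OF r] const[of r 2] by auto
      then show ?thesis by (simp add: 3)
    next
      case 4
      have "r * var 3 \<in> Q 3 \<longleftrightarrow> r \<in> Q 4"
        using colon_contains[of r 4 3, OF _ _ _ v3] Q4[OF r] const[of r 3] by auto
      then show ?thesis by (simp add: 4)
    qed
  qed simp
qed

end

end


subsection \<open>Chains of prime ideals\<close>

text \<open>The image of f in the monoid algebra over the target of \<open>v\<close>.\<close>

definition pushforward :: "((nat \<Rightarrow>\<^sub>0 nat) \<Rightarrow> 'm) \<Rightarrow> 'k::field mpoly \<Rightarrow> 'm \<Rightarrow>\<^sub>0 'k" where
  "pushforward v f = (\<Sum>m\<in>keys f. single (v m) (lookup f m))"

lemma fsum_pushforward: "fsum P (pushforward v f) = fsum (\<lambda>m. P (v m)) f"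
  by (simp add: pushforward_def fsum_sum fsum_superset[of "keys f"])

lemma lookup_pushforward: "lookup (pushforward v f) h = fsum (\<lambda>m. v m = h) f"
  using fsum_pushforward[of "\<lambda>x. x = h" v f] by (simp add: fsum_eq_lookup)

lemma fibre_kernel_iff: "f \<in> fibre_kernel n v \<longleftrightarrow> f \<in> polys n \<and> pushforward v f = 0"
  by (auto simp: fibre_kernel_def poly_mapping_eq_iff lookup_pushforward fun_eq_iff)

lemma pushforward_add: "pushforward v (f + g) = pushforward v f + pushforward v g"
  by (intro poly_mapping_eqI) (simp add: lookup_pushforward lookup_add fsum_add)

lemma pushforward_sum: "pushforward v (\<Sum>i\<in>A. f i) = (\<Sum>i\<in>A. pushforward v (f i))"
  by (induction A rule: infinite_finite_induct) (auto simp: pushforward_add pushforward_def[of v 0])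

lemma pushforward_single: "pushforward v (single m c) = single (v m) c"
  by (intro poly_mapping_eqI) (auto simp: lookup_pushforward lookup_single when_def)

lemma pushforward_mult:
  fixes v :: "(nat \<Rightarrow>\<^sub>0 nat) \<Rightarrow> 'm::cancel_comm_monoid_add"
  assumes v: "\<And>x y. v (x + y) = v x + v y"
  shows "pushforward v (f * g) = pushforward v f * pushforward v g"
proof -
  have mon: "pushforward v (single u c * g) = single (v u) c * pushforward v g" for u c
  proof (rule poly_mapping_eqI)
    fix h
    have "lookup (single (v u) c * pushforward v g) h = c * fsum (\<lambda>x. v u + x = h) (pushforward v g)"
      using fsum_monomial_mult[of "\<lambda>x. x = h" "v u" c "pushforward v g"] by (simp add: fsum_eq_lookup)
    also have "\<dots> = lookup (pushforward v (single u c * g)) h"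
      by (simp add: fsum_pushforward lookup_pushforward fsum_monomial_mult v)
    finally show "lookup (pushforward v (single u c * g)) h = lookup (single (v u) c * pushforward v g) h"
      by simp
  qed
  have "pushforward v (f * g) = (\<Sum>u\<in>keys f. single (v u) (lookup f u) * pushforward v g)"
    by (subst mult_decomposition) (simp add: pushforward_sum mon)
  also have "\<dots> = pushforward v f * pushforward v g"
    by (simp add: pushforward_def[of v f] sum_distrib_right)
  finally show ?thesis .
qed

text \<open>The monoid algebra of a linearly ordered cancellative monoid has no zero
  divisors.\<close>

lemma prime_ideal_fibre_kernel:
  fixes v :: "(nat \<Rightarrow>\<^sub>0 nat) \<Rightarrow> 'm::{ordered_cancel_comm_monoid_add, cancel_comm_monoid_add, linorder}"
  assumes v: "\<And>x y. v (x + y) = v x + v y"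
  shows "prime_ideal n (fibre_kernel n v :: 'k::field mpoly set)"
proof -
  have "pushforward v (1 :: 'k mpoly) = single (v 0) 1"
    using pushforward_single[of v 0 "1::'k"] by simp
  then have "(1 :: 'k mpoly) \<notin> fibre_kernel n v" by (simp add: fibre_kernel_iff)
  then have "fibre_kernel n v \<noteq> (polys n :: 'k mpoly set)" using polys_one by blast
  moreover have "f \<in> fibre_kernel n v \<or> g \<in> fibre_kernel n v"
    if "f \<in> polys n" "g \<in> polys n" "f * g \<in> fibre_kernel n v" for f g :: "'k mpoly"
  proof -
    have "pushforward v f * pushforward v g = 0"
      using that(3) pushforward_mult[of v f g, OF v] by (simp add: fibre_kernel_iff)
    then show ?thesis using that by (simp add: fibre_kernel_iff)
  qed
  moreover have "is_ideal n (fibre_kernel n v :: 'k mpoly set)"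
    by (rule is_ideal_fibre_kernel[OF v])
  ultimately show ?thesis by (auto simp: prime_ideal_def)
qed

lemma fibre_kernel_mono:
  assumes "\<And>m. v' m = \<pi> (v m)"
  shows "fibre_kernel n v \<subseteq> fibre_kernel n v'"
proof
  fix f :: "'k::field mpoly" assume f: "f \<in> fibre_kernel n v"
  then have "fsum (\<lambda>m. v' m = h) f = 0" for h
    using fsum_pushforward[of "\<lambda>x. \<pi> x = h" v f] assms by (simp add: fibre_kernel_iff)
  then show "f \<in> fibre_kernel n v'" using f by (simp add: fibre_kernel_def)
qed

lemma binomial_notin_fibre_kernel:
  assumes "v u \<noteq> v w"
  shows "single u (1::'k::field) - single w 1 \<notin> fibre_kernel n v"
proof
  assume "single u (1::'k) - single w 1 \<in> fibre_kernel n v"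
  then have "fsum (\<lambda>m. v m = v u) (single u (1::'k) - single w 1) = 0"
    unfolding fibre_kernel_def by blast
  then show False using assms by (auto simp: fsum_diff)
qed

lemma prime_ideal_zero: "prime_ideal n {0 :: 'k::field mpoly}"
proof -
  have "is_ideal n {0 :: 'k mpoly}" by (auto simp: is_ideal_def)
  moreover have "(1 :: 'k mpoly) \<notin> {0}" "(1 :: 'k mpoly) \<in> polys n" by simp_all
  then have "{0 :: 'k mpoly} \<noteq> polys n" by blast
  ultimately show ?thesis by (simp add: prime_ideal_def)
qed

lemma prime_ideal_irrelevant: "prime_ideal n {f \<in> polys n. lookup f 0 = (0 :: 'k::field)}" (is "prime_ideal n ?m")
proof -
  have "is_ideal n ?m"
    by (auto simp: is_ideal_def lookup_add lookup_mult_zero)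
  moreover have "(1 :: 'k mpoly) \<notin> ?m" "(1 :: 'k mpoly) \<in> polys n" by simp_all
  then have "?m \<noteq> polys n" by blast
  ultimately show ?thesis by (simp add: prime_ideal_def lookup_mult_zero)
qed

text \<open>Gaussian elimination: a vector \<open>t0\<close> with a nonzero entry at
  \<open>c\<close> is the pivot, and its own coefficient is chosen last so as to clear
  \<open>c\<close>.\<close>

lemma linear_dependence:
  fixes v :: "'t \<Rightarrow> 'c \<Rightarrow> 'k::field"
  assumes "finite C" "finite T" "card C < card T"
  shows "\<exists>\<alpha>. (\<exists>t\<in>T. \<alpha> t \<noteq> 0) \<and> (\<forall>c\<in>C. (\<Sum>t\<in>T. \<alpha> t * v t c) = 0)"
  using assms
proof (induction C arbitrary: T v rule: finite_induct)
  case empty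
  then have "T \<noteq> {}" by auto
  then obtain t where "t \<in> T" by blast
  then show ?case by (intro exI[of _ "\<lambda>_. 1"]) auto
next
  case (insert c C)
  show ?case
  proof (cases "\<forall>t\<in>T. v t c = 0")
    case True
    have "card C < card T" using insert by simp
    then obtain \<alpha> where "\<exists>t\<in>T. \<alpha> t \<noteq> 0" "\<forall>c\<in>C. (\<Sum>t\<in>T. \<alpha> t * v t c) = 0"
      using insert.IH[OF insert.prems(1)] by blast
    moreover have "(\<Sum>t\<in>T. \<alpha> t * v t c) = 0" using True by simp
    ultimately show ?thesis by blast
  next
    case False
    then obtain t0 where t0: "t0 \<in> T" "v t0 c \<noteq> 0" by blast
    let ?T = "T - {t0}"
    define v' where "v' t d = v t d - v t c / v t0 c * v t0 d" for t d
    have "card C < card ?T" using insert t0 by simp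
    then obtain \<beta> where \<beta>: "\<exists>t\<in>?T. \<beta> t \<noteq> 0" "\<forall>d\<in>C. (\<Sum>t\<in>?T. \<beta> t * v' t d) = 0"
      using insert.IH[of ?T v'] insert.prems(1) by blast
    define s where "s = (\<Sum>t\<in>?T. \<beta> t * v t c) / v t0 c"
    define \<alpha> where "\<alpha> t = (if t = t0 then - s else \<beta> t)" for t
    have sum_\<alpha>: "(\<Sum>t\<in>T. \<alpha> t * v t d) = (\<Sum>t\<in>?T. \<beta> t * v t d) - s * v t0 d" for d
    proof -
      have "(\<Sum>t\<in>T. \<alpha> t * v t d) = \<alpha> t0 * v t0 d + (\<Sum>t\<in>?T. \<alpha> t * v t d)"
        using t0 insert.prems(1) by (simp add: sum.remove)
      also have "(\<Sum>t\<in>?T. \<alpha> t * v t d) = (\<Sum>t\<in>?T. \<beta> t * v t d)"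
        by (rule sum.cong) (auto simp: \<alpha>_def)
      finally show ?thesis by (simp add: \<alpha>_def)
    qed
    have "\<beta> t * v' t d = \<beta> t * v t d - \<beta> t * v t c * (v t0 d / v t0 c)" for t d
      by (simp add: v'_def right_diff_distrib)
    then have "(\<Sum>t\<in>?T. \<beta> t * v' t d) = (\<Sum>t\<in>?T. \<beta> t * v t d) - s * v t0 d" for d
      by (simp add: s_def sum_subtractf sum_distrib_right[symmetric] sum_divide_distrib[symmetric])
    then have "(\<Sum>t\<in>T. \<alpha> t * v t d) = 0" if "d \<in> C" for d
      using \<beta>(2) that by (simp add: sum_\<alpha>)
    moreover have "(\<Sum>t\<in>T. \<alpha> t * v t c) = 0"
      using t0(2) by (simp add: sum_\<alpha> s_def)
    moreover have "\<exists>t\<in>T. \<alpha> t \<noteq> 0" using \<beta>(1) by (auto simp: \<alpha>_def)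
    ultimately show ?thesis by blast
  qed
qed

section \<open>Algebraic independence along chains of primes\<close>

fun power_product :: "'k::field mpoly list \<Rightarrow> nat list \<Rightarrow> 'k mpoly" where
  "power_product (f # fs) (n # ns) = f ^ n * power_product fs ns"
| "power_product _ _ = 1"

definition exponents :: "nat \<Rightarrow> nat \<Rightarrow> nat list set" where
  "exponents N k = {ns. set ns \<subseteq> {..<N} \<and> length ns = k}"

lemma finite_exponents: "finite (exponents N k)" and card_exponents: "card (exponents N k) = N ^ k"
  unfolding exponents_def using finite_lists_length_eq[of "{..<N}" k] card_lists_length_eq[of "{..<N}" k]
  by simp_all

lemma sum_exponents_Suc:
  "(\<Sum>ns\<in>exponents N (Suc k). g ns) = (\<Sum>n<N. \<Sum>ns\<in>exponents N k. g (n # ns))"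
proof -
  have "exponents N (Suc k) = (\<lambda>(n, ns). n # ns) ` ({..<N} \<times> exponents N k)"
    by (auto simp: exponents_def image_iff length_Suc_conv)
  moreover have "inj_on (\<lambda>(n, ns). n # ns) ({..<N} \<times> exponents N k)"
    by (auto simp: inj_on_def)
  ultimately have "(\<Sum>ns\<in>exponents N (Suc k). g ns) = (\<Sum>p\<in>{..<N} \<times> exponents N k. g (fst p # snd p))"
    by (simp add: sum.reindex case_prod_unfold)
  then show ?thesis by (simp add: sum.cartesian_product case_prod_unfold)
qed

text \<open>Algebraic independence modulo \<open>P\<close>, restricted to exponents below
  \<open>N\<close> so that only finitely many coefficients occur and the power products can be
  counted.\<close>

definition independent_mod :: "'k::field mpoly set \<Rightarrow> 'k mpoly list \<Rightarrow> nat \<Rightarrow> bool" where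
  "independent_mod P fs N \<longleftrightarrow> (\<forall>\<alpha>.
     (\<Sum>ns\<in>exponents N (length fs). single 0 (\<alpha> ns) * power_product fs ns) \<in> P \<longrightarrow>
     (\<forall>ns\<in>exponents N (length fs). \<alpha> ns = 0))"

lemma power_product_in_polys: "set fs \<subseteq> polys n \<Longrightarrow> power_product fs ns \<in> polys n"
  by (induction fs ns rule: power_product.induct) (auto intro!: polys_mult polys_power)

text \<open>A relation modulo P is read as a polynomial in f with coefficients G_m. As f lies in Q,
  the coefficient G_0 lies in Q and vanishes by independence modulo Q. As P is prime and does not
  contain f, a factor f cancels, and the next coefficient is treated likewise.\<close>

lemma independent_mod_Cons:
  assumes P: "prime_ideal n P" and Q: "is_ideal n Q" "P \<subseteq> Q"
    and f: "f \<in> Q" "f \<notin> P" and fs: "set fs \<subseteq> polys n" and ind: "independent_mod Q fs N"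
  shows "independent_mod P (f # fs) N"
  unfolding independent_mod_def
proof (intro allI impI)
  fix \<alpha>
  define G where "G m = (\<Sum>ns\<in>exponents N (length fs). single 0 (\<alpha> (m # ns)) * power_product fs ns)" for m
  assume "(\<Sum>ns\<in>exponents N (length (f # fs)). single 0 (\<alpha> ns) * power_product (f # fs) ns) \<in> P"
  moreover have "(\<Sum>ns\<in>exponents N (length (f # fs)). single 0 (\<alpha> ns) * power_product (f # fs) ns)
      = (\<Sum>m<N. f ^ m * G m)"
    by (simp add: sum_exponents_Suc G_def sum_distrib_left mult.left_commute)
  ultimately have sum_in: "(\<Sum>m<N. f ^ m * G m) \<in> P" by simp
  have fp: "f \<in> polys n" using ideal_in_polys[OF Q(1) f(1)] .
  have shift: "\<forall>m<M. K m = 0"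
    if "(\<Sum>m<M. f ^ m * K m) \<in> P" "\<And>m. K m \<in> Q \<Longrightarrow> K m = 0" "\<And>m. K m \<in> polys n"
    for M and K :: "nat \<Rightarrow> 'a mpoly"
    using that
  proof (induction M arbitrary: K)
    case (Suc M)
    let ?R = "\<Sum>m<M. f ^ m * K (Suc m)"
    have split: "(\<Sum>m<Suc M. f ^ m * K m) = K 0 + f * ?R"
      by (subst sum.lessThan_Suc_shift) (simp add: sum_distrib_left mult.assoc)
    have R: "?R \<in> polys n" using Suc.prems(3) fp by (intro polys_sum polys_mult polys_power)
    have "f * ?R \<in> Q" using ideal_mult_right[OF Q(1) R f(1)] .
    moreover have "K 0 + f * ?R \<in> Q" using Suc.prems(1) Q(2) unfolding split by blast
    ultimately have "(K 0 + f * ?R) - f * ?R \<in> Q" by (intro ideal_diff[OF Q(1)])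
    then have "K 0 \<in> Q" by simp
    then have K0: "K 0 = 0" by (rule Suc.prems(2))
    then have "f * ?R \<in> P" using Suc.prems(1) unfolding split by simp
    then have "?R \<in> P" using P R fp f(2) unfolding prime_ideal_def by blast
    then have "\<forall>m<M. K (Suc m) = 0" by (rule Suc.IH) (use Suc.prems in auto)
    then show ?case using K0 by (metis less_Suc_eq_0_disj)
  qed simp
  have zero: "\<forall>ns\<in>exponents N (length fs). \<alpha> (m # ns) = 0" if "G m \<in> Q" for m
    using ind that unfolding independent_mod_def G_def by (elim allE[of _ "\<lambda>ns. \<alpha> (m # ns)"]) simp
  then have G0: "G m = 0" if "G m \<in> Q" for m using that by (simp add: G_def)
  have "G m \<in> polys n" for m
    unfolding G_def by (intro polys_sum polys_mult power_product_in_polys fs polys_single mons_zero)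
  then have "\<forall>m<N. G m = 0" using shift[OF sum_in G0] by blast
  then have "\<forall>m<N. \<forall>ns\<in>exponents N (length fs). \<alpha> (m # ns) = 0"
    using zero ideal_zero[OF Q(1)] by simp
  then show "\<forall>ns\<in>exponents N (length (f # fs)). \<alpha> ns = 0"
    by (auto simp: exponents_def length_Suc_conv)
qed

lemma independent_mod_Nil:
  assumes P: "prime_ideal n P"
  shows "independent_mod P [] N"
proof -
  have "c = 0" if "single 0 c \<in> P" for c
  proof (rule ccontr)
    assume "c \<noteq> 0"
    have idl: "is_ideal n P" using P by (simp add: prime_ideal_def)
    have "single 0 (inverse c) * single 0 c \<in> P" by (rule ideal_mult[OF idl _ that]) simp
    then have one: "1 \<in> P" using \<open>c \<noteq> 0\<close> by (simp add: mult_single)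
    have "r \<in> P" if "r \<in> polys n" for r using ideal_mult[OF idl that one] by simp
    then have "P = polys n" using ideal_in_polys[OF idl] by blast
    then show False using P by (simp add: prime_ideal_def)
  qed
  moreover have "exponents N 0 = {[]}" by (auto simp: exponents_def)
  ultimately show ?thesis by (simp add: independent_mod_def)
qed

lemma prime_chain_independent:
  assumes "\<forall>i\<le>k. prime_ideal n (c i)" "\<forall>i<k. c i \<subset> c (Suc i)"
  shows "\<exists>fs. length fs = k \<and> set fs \<subseteq> polys n \<and> (\<forall>N. independent_mod (c 0) fs N)"
  using assms
proof (induction k arbitrary: c)
  case 0
  then show ?case using independent_mod_Nil by (intro exI[of _ "[]"]) auto
next
  case (Suc k)
  have "\<exists>fs. length fs = k \<and> set fs \<subseteq> polys n \<and> (\<forall>N. independent_mod (c (Suc 0)) fs N)"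
    using Suc.IH[of "\<lambda>i. c (Suc i)"] Suc.prems by simp
  then obtain fs where fs: "length fs = k" "set fs \<subseteq> polys n" "\<And>N. independent_mod (c (Suc 0)) fs N"
    by blast
  have sub: "c 0 \<subset> c (Suc 0)" using Suc.prems(2) by simp
  then obtain f where f: "f \<in> c (Suc 0)" "f \<notin> c 0" by blast
  have pr: "prime_ideal n (c 0)" "is_ideal n (c (Suc 0))"
    using Suc.prems(1) by (simp_all add: prime_ideal_def)
  have "independent_mod (c 0) (f # fs) N" for N
    by (rule independent_mod_Cons[OF pr _ f fs(2,3)]) (use sub in blast)
  moreover have "f \<in> polys n" using ideal_in_polys[OF pr(2) f(1)] .
  ultimately show ?case using fs by (intro exI[of _ "f # fs"]) auto
qed

lemma tdeg_mult_le:
  assumes "\<And>m. m \<in> keys f \<Longrightarrow> tdeg m \<le> d" "\<And>m. m \<in> keys g \<Longrightarrow> tdeg m \<le> e" "m \<in> keys (f * g)"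
  shows "tdeg m \<le> d + e"
  using assms keys_mult[of f g] by (fastforce intro: add_mono)

lemma tdeg_power_le:
  assumes "\<And>m. m \<in> keys f \<Longrightarrow> tdeg m \<le> d"
  shows "m \<in> keys (f ^ k :: 'k::field mpoly) \<Longrightarrow> tdeg m \<le> k * d"
proof (induction k arbitrary: m)
  case (Suc k)
  then show ?case using tdeg_mult_le[of f d "f ^ k" "k * d" m] assms by simp
qed simp

lemma tdeg_power_product_le:
  assumes "\<And>f m. f \<in> set fs \<Longrightarrow> m \<in> keys f \<Longrightarrow> tdeg m \<le> d" "ns \<in> exponents N (length fs)"
  shows "m \<in> keys (power_product fs ns) \<Longrightarrow> tdeg m \<le> length fs * (N * d)"
  using assms
proof (induction fs ns arbitrary: m rule: power_product.induct)
  case (1 f fs k ns)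
  have k: "k * d \<le> N * d" using 1 by (auto simp: exponents_def intro!: mult_le_mono1)
  have "tdeg m \<le> k * d + length fs * (N * d)"
  proof (rule tdeg_mult_le)
    show "m \<in> keys (f ^ k * power_product fs ns)" using 1 by simp
    show "tdeg m' \<le> k * d" if "m' \<in> keys (f ^ k)" for m'
      by (rule tdeg_power_le[OF "1.prems"(2) that]) simp_all
    show "tdeg m' \<le> length fs * (N * d)" if "m' \<in> keys (power_product fs ns)" for m'
      by (rule "1.IH"[OF that]) (use 1 in \<open>auto simp: exponents_def\<close>)
  qed
  then have "tdeg m \<le> N * d + length fs * (N * d)" using k by linarith
  then show ?case by simp
qed (auto simp: tdeg_zero)

lemma finite_bounded_mons: "finite {m \<in> mons n. tdeg m \<le> D}" (is "finite ?C")
  and card_bounded_mons: "card {m \<in> mons n. tdeg m \<le> D} \<le> (D + 1) ^ n"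
proof -
  let ?l = "\<lambda>m. map (lookup m) [0..<n]"
  have inj: "inj_on ?l ?C"
  proof (rule inj_onI)
    fix x y assume xy: "x \<in> ?C" "y \<in> ?C" "?l x = ?l y"
    show "x = y"
    proof (rule poly_mapping_eqI)
      fix i
      show "lookup x i = lookup y i"
      proof (cases "i < n")
        case True
        have "?l x ! i = ?l y ! i" by (simp only: xy(3))
        then show ?thesis using True by simp
      next
        case False
        have "lookup z i = 0" if z: "z \<in> ?C" for z
        proof (rule ccontr)
          assume "lookup z i \<noteq> 0"
          then have "i \<in> keys z" by (simp add: in_keys_iff)
          then show False using z False by (auto simp: mons_def)
        qed
        then show ?thesis using xy(1,2) by simp
      qed
    qed
  qed
  have "lookup m i \<le> D" if "m \<in> ?C" for m i
  proof (cases "i \<in> keys m")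
    case True
    then have "lookup m i \<le> tdeg m" unfolding tdeg_def by (intro member_le_sum) auto
    then show ?thesis using that by simp
  qed (auto simp: in_keys_iff)
  then have sub: "?l ` ?C \<subseteq> exponents (D + 1) n"
    by (auto simp: exponents_def less_Suc_eq_le)
  show "finite ?C" using finite_subset[OF sub finite_exponents] finite_imageD[OF _ inj] by blast
  show "card ?C \<le> (D + 1) ^ n"
    using card_mono[OF finite_exponents sub] card_image[OF inj] card_exponents[of "D + 1" n] by simp
qed

text \<open>A chain with n + 1 strict steps yields n + 1 independent polynomials. Their power
  products with exponents below N number N^(n+1), while their degrees grow linearly in N, so they
  lie in a space of dimension of order N^n and are dependent for large N.\<close>

theorem prime_chain_length_le:
  fixes c :: "nat \<Rightarrow> 'k::field mpoly set"
  assumes "\<forall>i\<le>k. prime_ideal n (c i)" "\<forall>i<k. c i \<subset> c (Suc i)"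
  shows "k \<le> n"
proof (rule ccontr)
  assume "\<not> k \<le> n"
  then have k: "Suc n \<le> k" by simp
  obtain fs where fs: "length fs = Suc n" "set fs \<subseteq> polys n" "\<And>N. independent_mod (c 0) fs N"
    using prime_chain_independent[of "Suc n" n c] assms k by auto
  have "finite (\<Union>f\<in>set fs. tdeg ` keys f)" by simp
  then obtain d where d: "\<And>f m. f \<in> set fs \<Longrightarrow> m \<in> keys f \<Longrightarrow> tdeg m \<le> d"
    unfolding finite_nat_set_iff_bounded_le by blast
  \<comment> \<open>D + 1 is at most N ((n + 1) d + 1), so (D + 1)^n is at most N^n B; hence N = B +
    1 is large enough.\<close>
  define B where "B = (Suc n * d + 1) ^ n"
  define N where "N = B + 1"
  define D where "D = Suc n * (N * d)"
  let ?C = "{m \<in> mons n. tdeg m \<le> D}" and ?T = "exponents N (Suc n)"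
  have "card ?C \<le> (D + 1) ^ n" by (rule card_bounded_mons)
  also have "\<dots> \<le> (N * (Suc n * d + 1)) ^ n"
    by (rule power_mono) (simp_all add: D_def N_def algebra_simps)
  also have "\<dots> = N ^ n * B" by (simp only: B_def power_mult_distrib)
  also have "\<dots> < N ^ n * N" by (simp add: N_def)
  also have "\<dots> = card ?T" by (simp add: card_exponents mult.commute)
  finally obtain \<alpha> where \<alpha>: "\<exists>t\<in>?T. \<alpha> t \<noteq> 0"
    "\<forall>m\<in>?C. (\<Sum>t\<in>?T. \<alpha> t * lookup (power_product fs t) m) = 0"
    using linear_dependence[OF finite_bounded_mons finite_exponents, of n D N "Suc n"
        "\<lambda>t m. lookup (power_product fs t) m"] by blast
  have "(\<Sum>t\<in>?T. single 0 (\<alpha> t) * power_product fs t) = 0"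
  proof (rule poly_mapping_eqI)
    fix m
    have coeff: "lookup (single 0 c * f) m = c * lookup f m" for c and f :: "'k mpoly"
      using lookup_monomial_mult_add[of 0 c f m] by simp
    have "lookup (power_product fs t) m = 0" if "m \<notin> ?C" "t \<in> ?T" for t
    proof (rule ccontr)
      assume "lookup (power_product fs t) m \<noteq> 0"
      then have m: "m \<in> keys (power_product fs t)" by (simp add: in_keys_iff)
      have "tdeg m \<le> length fs * (N * d)"
        by (rule tdeg_power_product_le[OF d _ m]) (use that(2) fs(1) in simp_all)
      moreover have "m \<in> mons n" using m power_product_in_polys[OF fs(2), of t] by (auto simp: polys_iff)
      ultimately show False using that(1) fs(1) by (simp add: D_def)
    qed
    then show "lookup (\<Sum>t\<in>?T. single 0 (\<alpha> t) * power_product fs t) m = lookup 0 m"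
      unfolding lookup_sum coeff lookup_zero using \<alpha>(2) by (cases "m \<in> ?C") (blast, simp)
  qed
  moreover have "0 \<in> c 0" using assms(1) by (auto simp: prime_ideal_def is_ideal_def)
  ultimately have "(\<Sum>t\<in>exponents N (length fs). single 0 (\<alpha> t) * power_product fs t) \<in> c 0"
    by (simp add: fs(1))
  then have "\<forall>t\<in>exponents N (length fs). \<alpha> t = 0"
    using fs(3)[of N, unfolded independent_mod_def, THEN spec[of _ \<alpha>]] by simp
  then show False using \<alpha>(1) by (simp add: fs(1))
qed


subsection \<open>The complete intersection case\<close>

lemma fibre_kernel_lookup_eq_0:
  assumes f: "f \<in> fibre_kernel n v" and m0: "m0 \<in> mons n"
    and uniq: "\<And>m. m \<in> mons n \<Longrightarrow> v m = v m0 \<Longrightarrow> m = m0"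
  shows "lookup f m0 = 0"
proof -
  have "fsum (\<lambda>m. v m = v m0) f = fsum (\<lambda>m. m = m0) f"
  proof (rule fsum_cong)
    fix m assume "m \<in> keys f"
    then have "m \<in> mons n" using f by (auto simp: fibre_kernel_def polys_iff)
    then show "v m = v m0 \<longleftrightarrow> m = m0" using uniq by blast
  qed
  then show ?thesis using f by (simp add: fibre_kernel_def fsum_eq_lookup)
qed

section \<open>Height of the toric ideal\<close>

context semigroup4
begin

abbreviation toric :: "'k::field mpoly set" where
  "toric \<equiv> fibre_kernel 4 (wt a)"

lemma toric_low_degree:
  assumes f: "f \<in> toric" and m: "m \<in> mons 4" "tdeg m \<le> 1"
  shows "lookup f m = 0"
proof (rule fibre_kernel_lookup_eq_0[OF f m(1)])
  fix m' assume m': "m' \<in> mons 4" "wt a m' = wt a m"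
  show "m' = m"
  proof (cases "tdeg m = 0")
    case True
    then show ?thesis using m' wt_eq_0_iff[OF irredundant m'(1)] by (simp add: tdeg_eq_0_iff)
  next
    case False
    then obtain i where "i < 4" "m = single i 1" using tdeg_eq_1E[OF _ m(1)] m(2) by auto
    then show ?thesis using m' irredundant by (auto simp: irredundant_def)
  qed
qed

text \<open>The intermediate primes are kernels of maps that remember, beside the weight, the
  exponents of x_2 and x_3, then only that of x_3. The binomials x_i^(a_0) - x_0^(a_i) for i = 1, 2,
  3 make the inclusions strict: they preserve the weight but not the exponent of x_i.\<close>

lemma height_prime_ge_3:
  assumes P: "prime_ideal 4 P" "toric \<subseteq> (P :: 'k::field mpoly set)"
  shows "enat 3 \<le> height_prime 4 P"
proof -
  define v1 where "v1 m = single (0::nat) (wt a m) + single 2 (lookup m 2) + single 3 (lookup m 3)" for m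
  define v2 where "v2 m = single (0::nat) (wt a m) + single 3 (lookup m 3)" for m
  have add1: "v1 (x + y) = v1 x + v1 y" for x y by (simp add: v1_def lookup_add single_add ac_simps)
  have add2: "v2 (x + y) = v2 x + v2 y" for x y by (simp add: v2_def lookup_add single_add ac_simps)
  have l1: "lookup (v1 m) 0 = wt a m" "lookup (v1 m) 2 = lookup m 2" "lookup (v1 m) 3 = lookup m 3" for m
    by (simp_all add: v1_def lookup_add lookup_single when_def)
  have l2: "lookup (v2 m) 0 = wt a m" "lookup (v2 m) 3 = lookup m 3" for m
    by (simp_all add: v2_def lookup_add lookup_single when_def)
  let ?p1 = "fibre_kernel 4 v1 :: 'k mpoly set" and ?p2 = "fibre_kernel 4 v2 :: 'k mpoly set"
  let ?b = "\<lambda>i. single (single i (a 0)) (1::'k) - single (single 0 (a i)) 1"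
  have ne: "single i (a 0) \<noteq> single 0 (a i)" if "i \<noteq> 0" for i
  proof
    assume "single i (a 0) = single 0 (a i)"
    then have "lookup (single i (a 0)) i = lookup (single 0 (a i)) i" by simp
    then show False using a0_pos that by (simp add: lookup_single when_def)
  qed
  have b1: "?b 1 \<in> ?p1" "?b 1 \<notin> {0}"
    using ne[of 1] by (auto intro!: binomial_in_fibre_kernel simp: v1_def lookup_single when_def mult.commute)
  have b2: "?b 2 \<in> ?p2" "?b 2 \<notin> ?p1"
  proof -
    show "?b 2 \<in> ?p2"
      by (rule binomial_in_fibre_kernel) (simp_all add: v2_def lookup_single when_def mult.commute)
    have "lookup (v1 (single 2 (a 0))) 2 \<noteq> lookup (v1 (single 0 (a 2))) 2"
      unfolding l1 using a0_pos by (simp add: lookup_single when_def)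
    then show "?b 2 \<notin> ?p1" by (intro binomial_notin_fibre_kernel) metis
  qed
  have b3: "?b 3 \<in> toric" "?b 3 \<notin> ?p2"
  proof -
    show "?b 3 \<in> toric"
      by (rule binomial_in_fibre_kernel) (simp_all add: mult.commute)
    have "lookup (v2 (single 3 (a 0))) 3 \<noteq> lookup (v2 (single 0 (a 3))) 3"
      unfolding l2 using a0_pos by (simp add: lookup_single when_def)
    then show "?b 3 \<notin> ?p2" by (intro binomial_notin_fibre_kernel) metis
  qed
  have "{0} \<subset> ?p1"
    using b1 ideal_zero[OF is_ideal_fibre_kernel[of v1 4, OF add1]] by blast
  moreover have "?p1 \<subseteq> ?p2"
    by (rule fibre_kernel_mono[where \<pi> = "\<lambda>x. single 0 (lookup x 0) + single 3 (lookup x 3)"])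
       (simp only: l1 v2_def)
  moreover have "?p2 \<subseteq> toric"
    by (rule fibre_kernel_mono[where \<pi> = "\<lambda>x. lookup x 0"]) (simp only: l2)
  ultimately have chain: "{0} \<subset> ?p1" "?p1 \<subset> ?p2" "?p2 \<subset> P" using b2 b3 P(2) by blast+
  define c where "c = (\<lambda>i::nat. if i = 0 then {0} else if i = 1 then ?p1 else if i = 2 then ?p2 else P)"
  have "prime_ideal 4 (c i)" for i
    unfolding c_def
    using P(1) prime_ideal_zero[where ?'k = 'k] prime_ideal_fibre_kernel[of v1 4, where ?'k = 'k, OF add1]
      prime_ideal_fibre_kernel[of v2 4, where ?'k = 'k, OF add2] by simp
  moreover have "c i \<subset> c (Suc i)" if "i < 3" for i
  proof -
    have "i = 0 \<or> i = 1 \<or> i = 2" using that by linarith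
    then show ?thesis using chain unfolding c_def by (elim disjE) simp_all
  qed
  moreover have "c 3 = P" by (simp add: c_def)
  ultimately have "enat 3 \<in> {enat k | k. \<exists>c. (\<forall>i\<le>k. prime_ideal 4 (c i)) \<and> (\<forall>i<k. c i \<subset> c (Suc i)) \<and> c k = P}"
    by blast
  then show ?thesis unfolding height_prime_def by (rule Sup_upper)
qed

text \<open>A chain ending in the toric ideal is prolonged strictly by the ideal of polynomials
  without constant term, so the bound 4 for the longer chain leaves 3.\<close>

lemma height_prime_toric_le_3: "height_prime 4 (toric :: 'k::field mpoly set) \<le> enat 3"
  unfolding height_prime_def
proof (rule Sup_least)
  fix x assume "x \<in> {enat k | k. \<exists>c. (\<forall>i\<le>k. prime_ideal 4 (c i)) \<and> (\<forall>i<k. c i \<subset> c (Suc i)) \<and> c k = (toric :: 'k mpoly set)}"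
  then obtain k c where c: "x = enat k" "\<forall>i\<le>k. prime_ideal 4 (c i)" "\<forall>i<k. c i \<subset> c (Suc i)"
    "c k = (toric :: 'k mpoly set)" by blast
  let ?m = "{f \<in> polys 4. lookup f 0 = (0::'k)}"
  have "toric \<subseteq> ?m"
    using toric_low_degree[of _ 0] by (auto simp: fibre_kernel_def)
  moreover have "(var 0 :: 'k mpoly) \<in> ?m" by (simp add: lookup_single when_def)
  moreover have "(var 0 :: 'k mpoly) \<notin> toric"
    using toric_low_degree[of "var 0" "single 0 1"] by auto
  ultimately have m: "toric \<subset> ?m" by blast
  define c' where "c' i = (if i \<le> k then c i else ?m)" for i
  have "Suc k \<le> 4"
  proof (rule prime_chain_length_le)
    show "\<forall>i\<le>Suc k. prime_ideal 4 (c' i)"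
      using c(2) prime_ideal_irrelevant[of 4, where ?'k = 'k] by (simp add: c'_def)
    show "\<forall>i<Suc k. c' i \<subset> c' (Suc i)"
    proof (intro allI impI)
      fix i assume i: "i < Suc k"
      show "c' i \<subset> c' (Suc i)"
      proof (cases "i < k")
        case True
        then show ?thesis using c(3) unfolding c'_def by simp
      next
        case False
        then have "i = k" using i by simp
        then show ?thesis using c(4) m unfolding c'_def by simp
      qed
    qed
  qed
  then show "x \<le> enat 3" using c(1) by simp
qed

theorem height_toric: "height 4 (toric :: 'k::field mpoly set) = enat 3"
proof (rule antisym)
  have "prime_ideal 4 (toric :: 'k mpoly set)" by (rule prime_ideal_fibre_kernel) simp
  then have "height 4 (toric :: 'k mpoly set) \<le> height_prime 4 (toric :: 'k mpoly set)"
    unfolding height_def by (intro INF_lower) simp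
  then show "height 4 (toric :: 'k mpoly set) \<le> enat 3"
    using height_prime_toric_le_3 by (rule order_trans)
  show "enat 3 \<le> height 4 (toric :: 'k mpoly set)"
    unfolding height_def using height_prime_ge_3 by (intro INF_greatest) blast
qed

section \<open>Three binomials generate the toric ideal\<close>

context
  assumes apery_sqf: "\<And>w. w \<in> apery \<Longrightarrow> \<exists>j\<le>1. \<exists>k\<le>1. \<exists>l\<le>1. w = comb3 j k l"
    and full: "a 1 + a 2 + a 3 \<in> apery"
    and doubles: "2 * a 1 \<notin> apery" "2 * a 3 \<notin> apery" "2 * a 2 \<in> apery \<Longrightarrow> 2 * a 2 = a 1 + a 3"
begin

definition sqf :: "nat \<Rightarrow> nat \<Rightarrow> nat \<Rightarrow> bool" where
  "sqf j k l \<longleftrightarrow> j \<le> 1 \<and> k \<le> 1 \<and> l \<le> 1"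

lemma sqf_apery:
  assumes "sqf j k l"
  shows "comb3 j k l \<in> apery"
proof (rule apery_summand)
  have "j * a 1 + (1 - j) * a 1 = a 1" "k * a 2 + (1 - k) * a 2 = a 2" "l * a 3 + (1 - l) * a 3 = a 3"
    using assms by (auto simp: sqf_def le_Suc_eq)
  then have "comb3 j k l + comb3 (1 - j) (1 - k) (1 - l) = a 1 + a 2 + a 3"
    by linarith
  then show "comb3 j k l + comb3 (1 - j) (1 - k) (1 - l) \<in> apery"
    using full by (simp only:)
  show "comb3 j k l \<in> H" "comb3 (1 - j) (1 - k) (1 - l) \<in> H"
    by (intro add_in mult_in gens_in)+
qed

text \<open>For positive a_1 < a_2 < a_3 the only possible coincidence among disjoint subset sums is
  a_3 = a_1 + a_2, which irreducibility excludes.\<close>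

lemma sqf_inj:
  assumes "sqf j k l" "sqf j' k' l'" "comb3 j k l = comb3 j' k' l'"
  shows "j = j' \<and> k = k' \<and> l = l'"
proof -
  have irr: "a 3 \<noteq> a 1 + a 2" using a_not_comb(3)[of 0 1 1] by simp
  have "j = 0 \<or> j = 1" "k = 0 \<or> k = 1" "l = 0 \<or> l = 1" "j' = 0 \<or> j' = 1" "k' = 0 \<or> k' = 1" "l' = 0 \<or> l' = 1"
    using assms by (auto simp: sqf_def)
  then show ?thesis using assms(3) irr a_less a0_pos by (elim disjE; simp)
qed

lemma normal_form_unique:
  assumes "sqf j k l" "sqf j' k' l'"
    "comb4 i j k l = comb4 i' j' k' l'"
  shows "mon4 i j k l = mon4 i' j' k' l'"
proof -
  let ?w = "comb3 j k l" and ?w' = "comb3 j' k' l'"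
  have eq: "?w + i * a 0 = ?w' + i' * a 0" using assms(3) by simp
  then have "(?w + i * a 0) mod a 0 = (?w' + i' * a 0) mod a 0" by (simp only:)
  then have "?w mod a 0 = ?w' mod a 0" by (simp only: mod_mult_self1)
  then have w: "?w = ?w'"
    by (rule inj_onD[OF apery_mod_inj _ sqf_apery[OF assms(1)] sqf_apery[OF assms(2)]])
  then have "i * a 0 = i' * a 0" using eq by simp
  then have "i = i'" using a0_pos by simp
  then show ?thesis using sqf_inj[OF assms(1,2) w] by simp
qed

lemma normal_form_exists:
  assumes "h \<in> H"
  shows "\<exists>i j k l. sqf j k l \<and> h = comb4 i j k l"
proof -
  obtain w i where w: "w \<in> apery" "h = w + i * a 0" using apery_decomposition[OF assms] by blast
  obtain j k l where "sqf j k l" "w = comb3 j k l"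
    using apery_sqf[OF w(1)] unfolding sqf_def by blast
  then have "sqf j k l \<and> h = comb4 i j k l" using w(2) by simp
  then show ?thesis by blast
qed

definition is_nf :: "nat \<Rightarrow> (nat \<Rightarrow>\<^sub>0 nat) \<Rightarrow> bool" where
  "is_nf h m \<longleftrightarrow> (\<exists>i j k l. m = mon4 i j k l \<and> sqf j k l \<and> h = comb4 i j k l)"

text \<open>For elements of H the choice is forced by \<open>normal_form_unique\<close>.\<close>

definition nf :: "nat \<Rightarrow> nat \<Rightarrow>\<^sub>0 nat" where
  "nf h = (SOME m. is_nf h m)"

lemma nfE:
  assumes "h \<in> H"
  obtains i j k l where "nf h = mon4 i j k l" "sqf j k l" "h = comb4 i j k l"
proof -
  obtain i j k l where *: "sqf j k l" "h = comb4 i j k l"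
    using normal_form_exists[OF assms] by (elim exE conjE)
  have "is_nf h (mon4 i j k l)"
    unfolding is_nf_def
    by (rule exI[of _ i], rule exI[of _ j], rule exI[of _ k], rule exI[of _ l], intro conjI refl *)
  then have "is_nf h (nf h)" unfolding nf_def by (rule someI)
  then show ?thesis using that unfolding is_nf_def by (elim exE conjE)
qed

lemma nf_eq:
  assumes "sqf j k l"
  shows "nf (comb4 i j k l) = mon4 i j k l"
proof -
  obtain i' j' k' l' where n: "nf (comb4 i j k l) = mon4 i' j' k' l'" "sqf j' k' l'"
    "comb4 i j k l = comb4 i' j' k' l'"
    using nfE[OF comb_in[of i j k l]] .
  show ?thesis unfolding n(1) by (rule normal_form_unique[OF assms n(2,3), symmetric])
qed

lemma nf_wt:
  assumes "h \<in> H"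
  shows "nf h \<in> mons 4" "wt a (nf h) = h"
proof -
  obtain i j k l where n: "nf h = mon4 i j k l" "h = comb4 i j k l"
    using nfE[OF assms] .
  show "nf h \<in> mons 4" unfolding n(1) by (rule mon4_in_mons)
  show "wt a (nf h) = h" unfolding n(1) wt_mon4 by (rule n(2)[symmetric])
qed

definition square_binomial :: "nat \<Rightarrow> 'k::field mpoly" where
  "square_binomial p = single (single p 2) 1 - single (nf (2 * a p)) 1"

lemma a_in: "p < 4 \<Longrightarrow> a p \<in> H"
  by (erule less_4E) simp_all

lemma square_binomial_in_toric:
  assumes "p < 4"
  shows "square_binomial p \<in> toric"
  unfolding square_binomial_def
  using nf_wt[OF mult_in[OF a_in[OF assms], of 2]] assms
  by (intro binomial_in_fibre_kernel) simp_all

abbreviation square_binomials :: "'k::field mpoly set" where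
  "square_binomials \<equiv> square_binomial ` {1, 2, 3}"

lemma is_ideal_square_binomials: "is_ideal 4 (ideal_gen 4 square_binomials :: 'k::field mpoly set)"
proof (rule is_ideal_ideal_gen)
  show "(square_binomials :: 'k mpoly set) \<subseteq> polys 4"
    using square_binomial_in_toric[of 1] square_binomial_in_toric[of 2] square_binomial_in_toric[of 3]
    by (auto simp: fibre_kernel_def)
qed

lemma square_factor:
  assumes "\<not> sqf j k l"
  obtains p j1 k1 l1 where "p \<in> {1, 2, 3}" "mon4 i j k l = single p 2 + mon4 i j1 k1 l1"
    "comb3 j k l = 2 * a p + comb3 j1 k1 l1"
    "k = k1 + (if p = 2 then 2 else 0)"
proof -
  have s: "single q (x::nat) = single q 2 + single q (x - 2)" if "2 \<le> x" for q :: nat and x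
  proof -
    have "x = 2 + (x - 2)" using that by simp
    then show ?thesis by (metis single_add)
  qed
  consider "2 \<le> j" | "2 \<le> k" | "2 \<le> l" using assms unfolding sqf_def by linarith
  then show ?thesis
  proof cases
    case 1
    have "mon4 i j k l = single 1 2 + mon4 i (j - 2) k l"
      by (subst s[OF 1, of 1]) (simp only: ac_simps)
    then show ?thesis using that[of 1 "j - 2" k l] split_two[OF 1, of "a 1"] by simp
  next
    case 2
    have "mon4 i j k l = single 2 2 + mon4 i j (k - 2) l"
      by (subst s[OF 2, of 2]) (simp only: ac_simps)
    then show ?thesis using that[of 2 j "k - 2" l] split_two[OF 2, of "a 2"] 2 by simp
  next
    case 3
    have "mon4 i j k l = single 3 2 + mon4 i j k (l - 2)"
      by (subst s[OF 3, of 3]) (simp only: ac_simps)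
    then show ?thesis using that[of 3 j k "l - 2"] split_two[OF 3, of "a 3"] by simp
  qed
qed

text \<open>A square x_p^2 is replaced by its normal form. If that contains x_0, the weight of the
  remaining part drops. Otherwise 2 a_p is an Apery element, so p = 2 and the rule is x_2^2 to x_1
  x_3.\<close>

lemma reduce_to_nf:
  "single (mon4 i j k l) 1 - single (nf (wt a (mon4 i j k l))) 1
     \<in> (ideal_gen 4 square_binomials :: 'k::field mpoly set)"
proof (induction "2 * comb3 j k l + k" arbitrary: i j k l rule: less_induct)
  case less
  let ?I = "ideal_gen 4 square_binomials :: 'k mpoly set"
  note idl = is_ideal_square_binomials[where ?'k = 'k]
  show ?case
  proof (cases "sqf j k l")
    case True
    then show ?thesis using ideal_zero[OF idl] unfolding wt_mon4 nf_eq[OF True] by simp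
  next
    case False
    obtain p j1 k1 l1 where p: "p \<in> {1, 2, 3}" "mon4 i j k l = single p 2 + mon4 i j1 k1 l1"
      "comb3 j k l = 2 * a p + comb3 j1 k1 l1"
      "k = k1 + (if p = 2 then 2 else 0)"
      using square_factor[OF False] .
    have pH: "2 * a p \<in> H" using p(1) by (intro mult_in a_in) auto
    obtain i2 j2 k2 l2 where n: "nf (2 * a p) = mon4 i2 j2 k2 l2" "sqf j2 k2 l2"
      "2 * a p = comb4 i2 j2 k2 l2" using nfE[OF pH] .
    let ?m1 = "mon4 i j1 k1 l1" and ?m' = "mon4 (i2 + i) (j2 + j1) (k2 + k1) (l2 + l1)"
    have m': "?m' = nf (2 * a p) + ?m1" unfolding n(1) single_add by (simp only: ac_simps)
    have wt: "wt a ?m' = wt a (mon4 i j k l)"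
      using n(3) p(3) unfolding wt_mon4 by (simp add: add_mult_distrib)
    have less': "2 * comb3 (j2 + j1) (k2 + k1) (l2 + l1) + (k2 + k1)
        < 2 * comb3 j k l + k"
    proof (cases "i2 = 0")
      case False
      have "2 * comb3 (j2 + j1) (k2 + k1) (l2 + l1) + (k1 + k2)
        < 2 * comb3 j k l + k"
      proof (rule measure_decreases)
        show "comb3 j k l = i2 * a 0 + comb3 (j2 + j1) (k2 + k1) (l2 + l1)"
          using n(3) p(3) by (simp add: add_mult_distrib)
        show "1 \<le> i2 * a 0" using False a0_pos by (simp add: Suc_le_eq)
        show "k2 \<le> 1" using n(2) by (simp add: sqf_def)
        show "k = (if p = 2 then 2 else 0) + k1" using p(4) by simp
      qed
      then show ?thesis by (simp only: add.commute[of k1])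
    next
      case True
      then have ap: "2 * a p \<in> apery" using sqf_apery[OF n(2)] n(3) by simp
      then have p2: "p = 2" using doubles p(1) by auto
      then have d: "2 * a 2 = a 1 + a 3" using doubles(3) ap by simp
      have "j2 = 1 \<and> k2 = 0 \<and> l2 = 1"
        by (rule sqf_inj[OF n(2)]) (use n(3) d p2 True in \<open>simp_all add: sqf_def\<close>)
      then show ?thesis using p(3,4) p2 d by (simp add: add_mult_distrib)
    qed
    have "single ?m' 1 - single (nf (wt a (mon4 i j k l))) 1 \<in> ?I"
      using less[OF less', of "i2 + i"] unfolding wt .
    moreover have "single (mon4 i j k l) 1 - single ?m' 1 \<in> ?I"
    proof -
      have "single ?m1 1 * square_binomial p \<in> ?I"
        by (rule ideal_mult[OF idl polys_single[OF mon4_in_mons] ideal_gen_base])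
           (use p(1) in blast)
      also have "single ?m1 1 * square_binomial p = single (mon4 i j k l) (1::'k) - single ?m' 1"
        unfolding square_binomial_def p(2) m' right_diff_distrib mult_single mult_1
        by (simp only: add.commute)
      finally show ?thesis .
    qed
    ultimately have "(single (mon4 i j k l) 1 - single ?m' 1)
        + (single ?m' 1 - single (nf (wt a (mon4 i j k l))) 1) \<in> ?I" by (intro ideal_add[OF idl])
    then show ?thesis by (simp only: diff_add_eq add_diff_cancel diff_add_cancel add.commute add_diff_eq)
  qed
qed

theorem toric_generated: "ideal_gen 4 square_binomials = (toric :: 'k::field mpoly set)"
proof
  let ?I = "ideal_gen 4 square_binomials :: 'k mpoly set"
  note idl = is_ideal_square_binomials[where ?'k = 'k]
  show "?I \<subseteq> toric"
    by (rule ideal_gen_least[OF is_ideal_fibre_kernel]) (auto intro: square_binomial_in_toric)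
  show "toric \<subseteq> ?I"
  proof
    fix f :: "'k mpoly" assume f: "f \<in> toric"
    then have keysf: "keys f \<subseteq> mons 4" by (auto simp: fibre_kernel_def polys_iff)
    have "f = (\<Sum>m\<in>keys f. single m (lookup f m))" by (rule single_decomposition)
    also have "\<dots> = (\<Sum>m\<in>keys f. single 0 (lookup f m) * (single m 1 - single (nf (wt a m)) 1))
        + (\<Sum>m\<in>{m\<in>keys f. True}. single (nf (wt a m)) (lookup f m))"
      by (simp add: sum.distrib[symmetric] algebra_simps mult_single)
    also have "(\<Sum>m\<in>{m\<in>keys f. True}. single (nf (wt a m)) (lookup f m)) = 0"
      by (rule fibre_representatives_cancel) (use f in \<open>simp add: fibre_kernel_def\<close>)
    finally have f_eq: "f = (\<Sum>m\<in>keys f. single 0 (lookup f m) * (single m 1 - single (nf (wt a m)) 1))"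
      by simp
    have "single m 1 - single (nf (wt a m)) 1 \<in> ?I" if "m \<in> keys f" for m
    proof -
      have "m \<in> mons 4" using that keysf by blast
      then obtain i j k l where "m = mon4 i j k l" by (rule mons4E)
      then show ?thesis by (simp only: reduce_to_nf)
    qed
    then have "(\<Sum>m\<in>keys f. single 0 (lookup f m) * (single m 1 - single (nf (wt a m)) 1)) \<in> ?I"
      by (intro ideal_sum[OF idl] ideal_mult[OF idl, of "single 0 _"]) simp_all
    then show "f \<in> ?I" using f_eq by (simp only:)
  qed
qed

text \<open>Normal forms contain no square of x_1, x_2, x_3, so these coefficient functionals are
  dual to the binomials.\<close>

lemma lookup_square_binomial:
  assumes "p \<in> {1, 2, 3}" "q \<in> {1, 2, 3}"
  shows "lookup (square_binomial p :: 'k::field mpoly) (single q 2) = (if p = q then 1 else 0)"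
proof -
  have pH: "2 * a p \<in> H" using assms(1) by (intro mult_in a_in) auto
  obtain i j k l where n: "nf (2 * a p) = mon4 i j k l" "sqf j k l" using nfE[OF pH] .
  have "nf (2 * a p) \<noteq> single q 2"
  proof
    assume "nf (2 * a p) = single q 2"
    then have "lookup (mon4 i j k l) q = 2" unfolding n(1) by (simp only: lookup_single_eq)
    then show False using n(2) assms(2) by (auto simp: sqf_def lookup_add lookup_single when_def)
  qed
  moreover have "single p (2::nat) = single q 2 \<longleftrightarrow> p = q"
    by (metis lookup_single_eq lookup_single_not_eq zero_neq_numeral)
  ultimately show ?thesis
    by (auto simp: square_binomial_def lookup_minus lookup_single when_def)
qed

text \<open>With fewer than three generators, some nontrivial combination of the coefficients at
  x_1^2, x_2^2, x_3^2 vanishes on all of them. Toric elements have no terms of degree below two, so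
  only constant terms of multipliers matter and the combination vanishes on the whole ideal, against
  the duality with the square binomials.\<close>

lemma num_gens_ge_3:
  assumes S: "finite S" "S \<subseteq> polys 4" "ideal_gen 4 S = (toric :: 'k::field mpoly set)"
  shows "3 \<le> card S"
proof (rule ccontr)
  assume "\<not> 3 \<le> card S"
  then have "card S < card {1, 2, 3 :: nat}" "finite {1, 2, 3 :: nat}" by simp_all
  from linear_dependence[OF S(1) this(2,1), of "\<lambda>t s. lookup s (single t 2)"]
  obtain \<alpha> where \<alpha>: "\<exists>t\<in>{1, 2, 3 :: nat}. \<alpha> t \<noteq> 0"
    "\<forall>s\<in>S. (\<Sum>t\<in>{1, 2, 3}. \<alpha> t * lookup s (single t 2)) = 0"
    by (elim exE conjE)
  have coeff: "lookup (r * s) (single t 2) = lookup r 0 * lookup s (single t 2)"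
    if s: "s \<in> S" and t: "t \<in> {1, 2, 3}" for r s t
  proof (rule lookup_mult_unit_part)
    fix u v :: "nat \<Rightarrow>\<^sub>0 nat" assume uv: "u \<noteq> 0" "u + v = single t 2"
    have "tdeg (u + v) = 2" unfolding uv(2) by simp
    then have "tdeg u + tdeg v = 2" by simp
    moreover have "tdeg u \<noteq> 0" using uv(1) by (simp add: tdeg_eq_0_iff)
    ultimately have "tdeg v \<le> 1" by simp
    moreover have "u + v \<in> mons 4" unfolding uv(2) using t by (intro mons_single) auto
    then have "v \<in> mons 4" by (simp only: mons_add_iff)
    moreover have "s \<in> toric" using ideal_gen_base[OF s, of 4] S(3) by simp
    ultimately show "lookup s v = 0" by (intro toric_low_degree)
  qed
  have vanish: "(\<Sum>t\<in>{1, 2, 3}. \<alpha> t * lookup f (single t 2)) = 0" if "f \<in> toric" for f :: "'k mpoly"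
  proof -
    have "f \<in> ideal_gen 4 S" using that by (simp only: S(3))
    then obtain T r where T: "finite T" "T \<subseteq> S" "f = (\<Sum>s\<in>T. r s * s)"
      unfolding ideal_gen_def mem_Collect_eq by (elim exE conjE)
    let ?U = "{1, 2, 3 :: nat}"
    have "(\<Sum>t\<in>?U. \<alpha> t * lookup f (single t 2)) = (\<Sum>t\<in>?U. \<Sum>s\<in>T. \<alpha> t * lookup (r s * s) (single t 2))"
      unfolding T(3) lookup_sum sum_distrib_left ..
    also have "\<dots> = (\<Sum>s\<in>T. \<Sum>t\<in>?U. \<alpha> t * lookup (r s * s) (single t 2))"
      by (rule sum.swap)
    also have "\<dots> = (\<Sum>s\<in>T. 0)"
    proof (rule sum.cong[OF refl])
      fix s assume "s \<in> T"
      then have s: "s \<in> S" using T(2) by blast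
      have "(\<Sum>t\<in>?U. \<alpha> t * lookup (r s * s) (single t 2))
          = (\<Sum>t\<in>?U. lookup (r s) 0 * (\<alpha> t * lookup s (single t 2)))"
        by (rule sum.cong[OF refl]) (simp only: coeff[OF s] mult.left_commute)
      also have "\<dots> = lookup (r s) 0 * (\<Sum>t\<in>?U. \<alpha> t * lookup s (single t 2))"
        by (rule sum_distrib_left[symmetric])
      also have "\<dots> = 0" using \<alpha>(2) s by (simp only: mult_zero_right)
      finally show "(\<Sum>t\<in>?U. \<alpha> t * lookup (r s * s) (single t 2)) = 0" .
    qed
    finally show ?thesis by (simp only: sum.neutral_const)
  qed
  have "\<alpha> q = 0" if q: "q \<in> {1, 2, 3}" for q
  proof -
    have "square_binomial q \<in> toric" using q by (intro square_binomial_in_toric) auto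
    from vanish[OF this] have "(\<Sum>t\<in>{1, 2, 3}. \<alpha> t * (if q = t then 1 else 0)) = 0"
      by (rule trans[OF sum.cong[OF refl], rotated]) (simp only: lookup_square_binomial[OF q])
    then show ?thesis using q by auto
  qed
  then show False using \<alpha>(1) by blast
qed

theorem num_gens_toric: "num_gens 4 (toric :: 'k::field mpoly set) = 3"
  unfolding num_gens_def
proof (rule Least_equality)
  have "inj_on (square_binomial :: nat \<Rightarrow> 'k mpoly) {1, 2, 3}"
  proof (rule inj_onI)
    fix p q assume pq: "p \<in> {1, 2, 3::nat}" "q \<in> {1, 2, 3::nat}"
      "square_binomial p = (square_binomial q :: 'k mpoly)"
    then have "lookup (square_binomial p :: 'k mpoly) (single p 2) = lookup (square_binomial q :: 'k mpoly) (single p 2)"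
      by simp
    then show "p = q"
      unfolding lookup_square_binomial[OF pq(1,1)] lookup_square_binomial[OF pq(2,1)] by (simp split: if_splits)
  qed
  then have "card (square_binomials :: 'k mpoly set) = 3" by (simp add: card_image)
  moreover have "(square_binomials :: 'k mpoly set) \<subseteq> polys 4"
    using square_binomial_in_toric[of 1] square_binomial_in_toric[of 2] square_binomial_in_toric[of 3]
    by (auto simp: fibre_kernel_def)
  ultimately show "\<exists>S. finite S \<and> card S = 3 \<and> S \<subseteq> polys 4 \<and> ideal_gen 4 S = (toric :: 'k mpoly set)"
    using toric_generated by (intro exI[of _ square_binomials]) simp
next
  fix k assume "\<exists>S. finite S \<and> card S = k \<and> S \<subseteq> polys 4 \<and> ideal_gen 4 S = (toric :: 'k mpoly set)"
  then show "3 \<le> k" using num_gens_ge_3 by blast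
qed

end

end


section \<open>Passage from the stated notions to weights, and the equivalences\<close>

lemma coeff_sg_eval: "coeff (sg_eval as f) h = fsum (\<lambda>m. wt ((!) as) m = h) f"
  unfolding sg_eval_def coeff_sum coeff_monom wt_def[symmetric]
  by (simp add: fsum_superset[of "keys f"])

lemma toric_ideal_eq: "toric_ideal TYPE('k::field) H = fibre_kernel (embdim H) (wt ((!) (gens_list H)))"
  unfolding toric_ideal_def fibre_kernel_def poly_eq_iff coeff_sg_eval by simp

lemma embdim4_gens:
  assumes "numerical_semigroup H" "embdim H = 4"
  shows "semigroup4 H ((!) (gens_list H))"
    "min_gens H = {gens_list H ! 0, gens_list H ! 1, gens_list H ! 2, gens_list H ! 3}"
proof -
  let ?g = "gens_list H"
  have card: "card (min_gens H) = 4" using assms(2) by (simp add: embdim_def)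
  then have fin: "finite (min_gens H)" using card_ge_0_finite by force
  have len: "length ?g = 4" and set: "set ?g = min_gens H"
    using fin card by (simp_all add: gens_list_def)
  have "set ?g = {?g ! i | i. i < 4}" using len by (simp add: set_conv_nth)
  also have "\<dots> = {?g ! 0, ?g ! 1, ?g ! 2, ?g ! 3}"
  proof (intro set_eqI iffI)
    fix x assume "x \<in> {?g ! i | i. i < 4}"
    then obtain i where "i < 4" "x = ?g ! i" by blast
    then show "x \<in> {?g ! 0, ?g ! 1, ?g ! 2, ?g ! 3}" by (elim less_4E) simp_all
  next
    fix x assume "x \<in> {?g ! 0, ?g ! 1, ?g ! 2, ?g ! 3}"
    then consider "x = ?g ! 0" | "x = ?g ! 1" | "x = ?g ! 2" | "x = ?g ! 3" by blast
    then show "x \<in> {?g ! i | i. i < 4}"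
    proof cases
      case 1 then show ?thesis by (intro CollectI exI[of _ 0]) simp
    next
      case 2 then show ?thesis by (intro CollectI exI[of _ 1]) simp
    next
      case 3 then show ?thesis by (intro CollectI exI[of _ 2]) simp
    next
      case 4 then show ?thesis by (intro CollectI exI[of _ 3]) simp
    qed
  qed
  finally show gens: "min_gens H = {?g ! 0, ?g ! 1, ?g ! 2, ?g ! 3}" using set by simp
  have "sorted_wrt (<) ?g" by (simp add: gens_list_def)
  then have less: "?g ! i < ?g ! Suc i" if "Suc i < 4" for i
    using that len by (simp add: sorted_wrt_iff_nth_less)
  show "semigroup4 H ((!) ?g)"
  proof
    show "irreducibles H = {?g ! 0, ?g ! 1, ?g ! 2, ?g ! 3}"
      using gens min_gens_eq_irreducibles[OF assms(1)] by simp
    show "?g ! 0 < ?g ! 1" using less[of 0] by simp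
    show "?g ! 1 < ?g ! 2" using less[of 1] by (simp add: numeral_2_eq_2)
    show "?g ! 2 < ?g ! 3" using less[of 2] by (simp add: eval_nat_numeral)
  qed (rule assms(1))
qed

lemma koszul_imp_quadratic:
  assumes irr: "irredundant (embdim H) a" and J: "initial_ideal TYPE('k::field) H = graded_kernel (embdim H) a"
    and koszul: "koszul TYPE('k) H"
  shows "quadratic TYPE('k) H"
proof -
  let ?n = "embdim H" and ?J = "graded_kernel (embdim H) a :: 'k mpoly set"
  obtain b :: "nat \<Rightarrow> nat" and M :: "nat \<Rightarrow> nat \<Rightarrow> nat \<Rightarrow> 'k mpoly" where
    b0: "b 0 = 1"
    and lin: "\<forall>i j k. j < b i \<longrightarrow> k < b (Suc i) \<longrightarrow>
           M (Suc i) j k \<in> polys ?n \<and> homogeneous 1 (M (Suc i) j k)"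
    and gen: "ideal_gen ?n ({M 1 0 k | k. k < b 1} \<union> ?J) = {f \<in> polys ?n. lookup f 0 = 0}"
    and exact: "\<forall>i\<ge>1. \<forall>v. (\<forall>k<b i. v k \<in> polys ?n) \<longrightarrow>
          ((\<forall>j<b (i - 1). (\<Sum>k<b i. M i j k * v k) \<in> ?J) \<longleftrightarrow>
           (\<exists>w. (\<forall>l<b (Suc i). w l \<in> polys ?n) \<and>
              (\<forall>k<b i. v k - (\<Sum>l<b (Suc i). M (Suc i) k l * w l) \<in> ?J)))"
    using koszul unfolding koszul_def Let_def J by (elim exE conjE)
  have exact1: "(\<Sum>k<b 1. M 1 0 k * v k) \<in> ?J \<longleftrightarrow>
      (\<exists>w. (\<forall>l<b 2. w l \<in> polys ?n) \<and> (\<forall>k<b 1. v k - (\<Sum>l<b 2. M 2 k l * w l) \<in> ?J))"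
    if "\<forall>k<b 1. v k \<in> polys ?n" for v
    using exact[THEN spec[of _ 1], THEN mp, OF order_refl, THEN spec[of _ v], THEN mp, OF that] b0
    by (simp add: numeral_2_eq_2)
  have l: "M 1 0 k \<in> polys ?n" "homogeneous 1 (M 1 0 k)" if "k < b 1" for k
    using lin[THEN spec[of _ 0], THEN spec[of _ 0], THEN spec[of _ k]] b0 that by simp_all
  have M2: "M 2 k j \<in> polys ?n" "homogeneous 1 (M 2 k j)" if "k < b 1" "j < b 2" for k j
    using lin[THEN spec[of _ 1], THEN spec[of _ k], THEN spec[of _ j]] that
    by (simp_all add: numeral_2_eq_2)
  have "ideal_gen ?n {q \<in> ?J. homogeneous 2 q} = ?J"
  proof (rule linear_syzygies_imp_quadratic[where l = "M 1 0" and M = "M 2" and b = "b 1" and c = "b 2"])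
    \<comment> \<open>Exactness applied to a unit vector shows that each column of
      \<open>M 2\<close> is a syzygy.\<close>
    show "(\<Sum>k<b 1. M 1 0 k * M 2 k j) \<in> ?J" if j: "j < b 2" for j
    proof -
      let ?w = "\<lambda>i. if i = j then 1 else (0 :: 'k mpoly)"
      have "(\<Sum>l<b 2. M 2 k l * ?w l) = M 2 k j" for k
        using j by (simp add: if_distrib cong: if_cong)
      then have "\<forall>k<b 1. M 2 k j - (\<Sum>l<b 2. M 2 k l * ?w l) \<in> ?J"
        by (simp add: ideal_zero[OF is_ideal_graded_kernel])
      moreover have "\<forall>l<b 2. ?w l \<in> polys ?n" by simp
      ultimately have "\<exists>w. (\<forall>l<b 2. w l \<in> polys ?n) \<and> (\<forall>k<b 1. M 2 k j - (\<Sum>l<b 2. M 2 k l * w l) \<in> ?J)"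
        by (intro exI[of _ ?w] conjI)
      then show ?thesis by (subst exact1) (use M2 j in simp)
    qed
    show "\<exists>w. (\<forall>j<b 2. w j \<in> polys ?n) \<and> (\<forall>k<b 1. v k - (\<Sum>j<b 2. M 2 k j * w j) \<in> ?J)"
      if "\<forall>k<b 1. v k \<in> polys ?n" "(\<Sum>k<b 1. M 1 0 k * v k) \<in> ?J" for v
      using exact1[OF that(1)] that(2) by (rule iffD1)
  qed (use l M2 gen graded_kernel_low_degree[OF irr] hcomp_graded_kernel is_ideal_graded_kernel in auto)
  then show ?thesis
    unfolding quadratic_def J
    by (intro exI[of _ "{q \<in> ?J. homogeneous 2 q}"]) (auto simp: graded_kernel_def)
qed

context semigroup4
begin

lemma multiplicity5_koszul:
  assumes sym: "symmetric_sg H" and e: "a 0 = 5" and n: "embdim H = 4"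
    and J: "initial_ideal TYPE('k::field) H = graded_kernel 4 a"
  shows "koszul TYPE('k) H"
proof -
  let ?J = "graded_kernel 4 a :: 'k mpoly set"
  have mean: "2 * a 2 = a 1 + a 3" and ap: "apery = {0, a 1, a 2, a 3, a 1 + a 3}"
    using apery_multiplicity5[OF sym e] by (rule conjunct1, rule conjunct2)
  interpret koszul_filtration 4 ?J "\<lambda>j. if j = 0 then 0 else if j = 1 then 3 else 4"
    by (rule koszul_filtration_graded_kernel[OF mean ap])
  have gen: "ideal_gen 4 ({var k | k. k < 4} \<union> ?J) = {f \<in> polys 4. lookup f 0 = 0}" (is "?I = ?m")
  proof
    have m: "is_ideal 4 ?m" using prime_ideal_irrelevant[of 4, where ?'k = 'k] unfolding prime_ideal_def by (rule conjunct1)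
    have var_m: "var k \<in> ?m" if "k < 4" for k
      using that by (intro CollectI conjI polys_single mons_single) (simp_all add: lookup_single when_def)
    have J_m: "f \<in> ?m" if "f \<in> ?J" for f
      by (intro CollectI conjI ideal_in_polys[OF J that] graded_kernel_low_degree[OF irredundant that]) simp
    have sub: "{var k | k. k < 4} \<union> ?J \<subseteq> ?m"
    proof
      fix x assume "x \<in> {var k | k. k < 4} \<union> ?J"
      then consider k where "k < 4" "x = var k" | "x \<in> ?J" by (elim UnE CollectE exE conjE)
      then show "x \<in> ?m"
      proof cases
        case 1 show ?thesis unfolding 1(2) by (rule var_m[OF 1(1)])
      qed (rule J_m)
    qed
    then show "?I \<subseteq> ?m" by (rule ideal_gen_least[OF m])
    have m_polys: "?m \<subseteq> polys 4" by (rule subsetI, erule CollectE, erule conjunct1)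
    have I: "is_ideal 4 ?I" by (rule is_ideal_ideal_gen[OF subset_trans[OF sub m_polys]])
    have var_I: "var i \<in> ?I" if "i < 4" for i
      by (intro ideal_gen_base UnI1 CollectI exI[of _ i] conjI refl that)
    show "?m \<subseteq> ?I"
    proof
      fix f :: "'k mpoly" assume "f \<in> ?m"
      then have f: "f \<in> polys 4" "lookup f 0 = 0" by simp_all
      show "f \<in> ?I" by (rule in_ideal_if_no_constant[OF I _ f]) (rule var_I)
    qed
  qed
  show ?thesis
    using linear_resolution_exists[unfolded gen] unfolding koszul_def Let_def n assms(4) .
qed

lemma quadratic_imp_multiplicity5:
  assumes sym: "symmetric_sg H" and n: "embdim H = 4"
    and J: "initial_ideal TYPE('k::field) H = graded_kernel 4 a"
    and I: "toric_ideal TYPE('k) H = fibre_kernel 4 (wt a)"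
    and not_ci: "\<not> complete_intersection TYPE('k) H" and quad: "quadratic TYPE('k) H"
  shows "a 0 = 5"
proof -
  obtain S :: "'k mpoly set" where S: "\<And>s. s \<in> S \<Longrightarrow> s \<in> polys 4 \<and> homogeneous 2 s"
    "ideal_gen 4 S = graded_kernel 4 a"
    using quad unfolding quadratic_def n J by blast
  have squares: "\<exists>m\<in>mons 4. m \<noteq> single i 2 \<and> wt a m = 2 * a i \<and> 2 \<le> tdeg m" if i: "0 < i" "i < 4" for i
  proof (rule quadratic_imp_square_relation[OF S i(2) _ a0_pos])
    show "a 0 < a i" using i a_less by (auto elim: less_4E)
  qed
  have not_full: "a 1 + a 2 + a 3 \<notin> apery"
  proof
    assume full: "a 1 + a 2 + a 3 \<in> apery"
    have "num_gens 4 (fibre_kernel 4 (wt a) :: 'k mpoly set) = 3"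
      by (rule num_gens_toric[OF apery_squarefree[OF squares] full double_a1[OF squares]
            double_a3[OF squares] double_a2[OF squares]])
    then have "complete_intersection TYPE('k) H"
      unfolding complete_intersection_def n I height_toric by simp
    then show False using not_ci by blast
  qed
  show ?thesis by (rule multiplicity_eq_5[OF _ sym not_full]) (rule squares)
qed

end

text \<open>As the four numbers are distinct, their sum 5 + 3 (3 a + 2 b) is read off the set, which
  fixes the generator 3 a + 2 b. The other two can match in two ways; the crossed one gives a' - b'
  = 5 (a - b').\<close>

lemma parameters_unique:
  fixes a b a' b' :: nat
  assumes eq: "{5, 4*a + b, 2*a + 3*b, 3*a + 2*b} = {5, 4*a' + b', 2*a' + 3*b', 3*a' + 2*b'}"
    and card: "card {5, 4*a + b, 2*a + 3*b, 3*a + 2*b} = 4"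
    and ndvd: "\<not> (5::int) dvd (int a' - int b')"
  shows "a = a' \<and> b = b'"
proof -
  have distinct: "distinct [5, x, y, z]" if "card {5, x, y, z} = 4" for x y z :: nat
    using that card_distinct[of "[5, x, y, z]"] by simp
  have d: "distinct [5, 4*a + b, 2*a + 3*b, 3*a + 2*b]" by (rule distinct[OF card])
  have d': "distinct [5, 4*a' + b', 2*a' + 3*b', 3*a' + 2*b']"
    by (rule distinct) (use card eq in simp)
  have "\<Sum>{5, 4*a + b, 2*a + 3*b, 3*a + 2*b} = \<Sum>{5, 4*a' + b', 2*a' + 3*b', 3*a' + 2*b'}"
    by (simp only: eq)
  then have mid: "3*a + 2*b = 3*a' + 2*b'" using d d' by simp
  have "{4*a + b, 2*a + 3*b} = {5, 4*a + b, 2*a + 3*b, 3*a + 2*b} - {5, 3*a + 2*b}"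
    using d by auto
  also have "\<dots> = {4*a' + b', 2*a' + 3*b'}" unfolding eq unfolding mid using d' by auto
  finally consider "4*a + b = 4*a' + b'" | "4*a + b = 2*a' + 3*b'" by (auto simp: doubleton_eq_iff)
  then show ?thesis
  proof cases
    case 1
    then show ?thesis using mid by linarith
  next
    case 2
    then have "5 * a = a' + 4 * b'" using mid by linarith
    then have "int (5 * a) = int (a' + 4 * b')" by (simp only:)
    then have "int a' - int b' = 5 * (int a - int b')" by simp
    then have "(5::int) dvd (int a' - int b')" by (simp only: dvd_triv_left)
    then show ?thesis using ndvd by contradiction
  qed
qed

theorem theorem3p12:
  fixes H :: "nat set"
  assumes "numerical_semigroup H"
    and "embdim H = 4"
    and "symmetric_sg H"
    and "\<not> complete_intersection TYPE('k::field) H"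
  shows "(koszul TYPE('k) H \<longleftrightarrow> quadratic TYPE('k) H)
       \<and> (quadratic TYPE('k) H \<longleftrightarrow> sg_mult H = 5)
       \<and> (sg_mult H = 5 \<longleftrightarrow>
            (\<exists>a b :: nat. 0 < a \<and> 0 < b \<and> \<not> (5::int) dvd (int a - int b)
               \<and> H = sg_gen {5, 4*a + b, 2*a + 3*b, 3*a + 2*b}))
       \<and> (\<forall>a b a' b' :: nat.
            (0 < a \<and> 0 < b \<and> \<not> (5::int) dvd (int a - int b)
               \<and> H = sg_gen {5, 4*a + b, 2*a + 3*b, 3*a + 2*b})
          \<longrightarrow> (0 < a' \<and> 0 < b' \<and> \<not> (5::int) dvd (int a' - int b')
               \<and> H = sg_gen {5, 4*a' + b', 2*a' + 3*b', 3*a' + 2*b'})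
          \<longrightarrow> a = a' \<and> b = b')"
proof -
  let ?a = "(!) (gens_list H)"
  interpret semigroup4 H ?a by (rule embdim4_gens(1)[OF assms(1,2)])
  have gens: "min_gens H = {?a 0, ?a 1, ?a 2, ?a 3}" by (rule embdim4_gens(2)[OF assms(1,2)])
  have mult: "sg_mult H = ?a 0"
    unfolding sg_mult_def gens using a_less by (intro Min_eqI) auto
  have I: "toric_ideal TYPE('k) H = fibre_kernel 4 (wt ?a)"
    unfolding toric_ideal_eq assms(2) ..
  have J: "initial_ideal TYPE('k) H = graded_kernel 4 ?a"
    unfolding initial_ideal_def I assms(2) by (rule init_ideal_eq_graded_kernel) (rule gens_pos)
  have min_gens_card: "min_gens H = S" if "H = sg_gen S" "finite S" "card S \<le> 4" for S
  proof (rule card_seteq[OF that(2)])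
    show "min_gens H \<subseteq> S"
      unfolding min_gens_eq_irreducibles[OF assms(1)]
      by (rule irreducibles_subset_generators) (rule that(1)[symmetric])
    show "card S \<le> card (min_gens H)" using that(3) assms(2) by (simp add: embdim_def)
  qed
  \<comment> \<open>Embedding dimension 4 forces these four generators to be distinct and
    minimal.\<close>
  have gens_d: "min_gens H = {5, 4*a + b, 2*a + 3*b, 3*a + 2*b}"
    if "H = sg_gen {5, 4*a + b, 2*a + 3*b, 3*a + 2*b}" for a b :: nat
    by (rule min_gens_card[OF that]) (simp_all add: card_insert_if)
  have koszul_quadratic: "quadratic TYPE('k) H" if "koszul TYPE('k) H"
    by (rule koszul_imp_quadratic[OF _ _ that, where a = ?a]) (simp_all add: assms(2) irredundant J)
  have quadratic_mult: "sg_mult H = 5" if "quadratic TYPE('k) H"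
    unfolding mult by (rule quadratic_imp_multiplicity5[OF assms(3,2) J I assms(4) that])
  have mult_koszul: "koszul TYPE('k) H" if "sg_mult H = 5"
    using multiplicity5_koszul[OF assms(3) _ assms(2) J] that mult by simp
  have mult_d: "\<exists>a b :: nat. 0 < a \<and> 0 < b \<and> \<not> (5::int) dvd (int a - int b)
      \<and> H = sg_gen {5, 4*a + b, 2*a + 3*b, 3*a + 2*b}" if "sg_mult H = 5"
  proof -
    have H: "H = sg_gen {?a 0, ?a 1, ?a 2, ?a 3}"
      using sg_gen_irreducibles[of H] irreducibles_eq by auto
    have "?a 0 = 5" using that mult by simp
    from multiplicity5_parameters[OF assms(3) this] obtain x y :: nat where
      xy: "0 < x" "0 < y" "\<not> (5::int) dvd (int x - int y)"
        "{?a 0, ?a 1, ?a 2, ?a 3} = {5, 4*x + y, 2*x + 3*y, 3*x + 2*y}"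
      by (elim exE conjE)
    show ?thesis
      by (rule exI[of _ x], rule exI[of _ y]) (intro conjI xy(1-3) H[unfolded xy(4)])
  qed
  have d_mult: "sg_mult H = 5" if "0 < a" "0 < b" "H = sg_gen {5, 4*a + b, 2*a + 3*b, 3*a + 2*b}"
    for a b :: nat
    unfolding sg_mult_def gens_d[OF that(3)] using that(1,2) by (intro Min_eqI) auto
  have unique: "a = a' \<and> b = b'"
    if "H = sg_gen {5, 4*a + b, 2*a + 3*b, 3*a + 2*b}" "H = sg_gen {5, 4*a' + b', 2*a' + 3*b', 3*a' + 2*b'}"
      "\<not> (5::int) dvd (int a' - int b')" for a b a' b' :: nat
  proof (rule parameters_unique[OF _ _ that(3)])
    show "{5, 4*a + b, 2*a + 3*b, 3*a + 2*b} = {5, 4*a' + b', 2*a' + 3*b', 3*a' + 2*b'}"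
      using gens_d[OF that(1)] gens_d[OF that(2)] by simp
    show "card {5, 4*a + b, 2*a + 3*b, 3*a + 2*b} = 4"
      using assms(2) unfolding embdim_def gens_d[OF that(1)] .
  qed
  show ?thesis
  proof (intro conjI)
    show "koszul TYPE('k) H \<longleftrightarrow> quadratic TYPE('k) H"
      by (rule iffI, erule koszul_quadratic, intro mult_koszul quadratic_mult)
    show "quadratic TYPE('k) H \<longleftrightarrow> sg_mult H = 5"
      by (rule iffI, erule quadratic_mult, intro koszul_quadratic mult_koszul)
    show "sg_mult H = 5 \<longleftrightarrow> (\<exists>a b :: nat. 0 < a \<and> 0 < b \<and> \<not> (5::int) dvd (int a - int b)
        \<and> H = sg_gen {5, 4*a + b, 2*a + 3*b, 3*a + 2*b})"
      by (rule iffI, erule mult_d, elim exE conjE, rule d_mult)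
  qed (intro allI impI, elim conjE, rule unique)
qed

end
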